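(* Let $t=q^{-1}$. (1) (No-pairing case, $q=\#\mathfrak{o}/\mathfrak{p}$.) For every partition $\lambda$, $$\mathbf{P}(u;\lambda)=\frac{q^{-u|\lambda|}\prod_{j\ge1}(1-q^{-u-j})}{q^{|\lambda|+2n(\lambda)}\prod_{i\ge1}(q^{-1};q^{-1})_{m_i(\lambda)}}=\frac{P_\lambda(t^{1+u},t^{2+u},\ldots;t)\,Q_\lambda(1,t,t^2,\ldots;t)}{\Pi_t(t^{1+u},t^{2+u},\ldots;1,t,t^2,\ldots)}.$$ (2) (Alternating case, $q=\#\mathfrak{o}/\mathfrak{p}$.) $$\mathbf{P}^{\mathrm{alt}}(u;\lambda)=\frac{q^{(2-2u)|\lambda|}\prod_{j\ge1}(1-q^{-2u-2j+1})}{q^{4n(\lambda)+3|\lambda|}\prod_{i\ge1}(q^{-2};q^{-2})_{m_i(\lambda)}}=\frac{P_\lambda(t^{1+2u},t^{3+2u},\ldots;t^2)\,Q_\lambda(1,t^2,t^4,\ldots;t^2)}{\Pi_{t^2}(t^{1+2u},t^{3+2u},\ldots;1,t^2,t^4,\ldots)}.$$ (3) (Hermitian case, $q^2=\#\mathfrak{o}/\mathfrak{p}$.) $$\mathbf{P}^{\mathrm{her}}(u;\lambda)=\frac{q^{-u|\lambda|}\prod_{j\ge1}(1-(-1)^{j-1}q^{-u-j})}{q^{|\lambda|+2n(\lambda)}\prod_{i\ge1}(-q^{-1};-q^{-1})_{m_i(\lambda)}}=\frac{P_\lambda(t^{1+u},-t^{2+u},t^{3+u},\ldots;-t)\,Q_\lambda(1,-t,t^2,\ldots;-t)}{\Pi_{-t}(t^{1+u},-t^{2+u},t^{3+u},\ldots;1,-t,t^2,\ldots)},$$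 where the sequences are $((-1)^{j-1}t^{j+u})_{j\ge1}$ and $((-t)^j)_{j\ge0}$.
   Context: Partitions: $|\lambda|=\sum\lambda_i$, $n(\lambda)=\sum_i(i-1)\lambda_i$, $m_i(\lambda)=\#\{j:\lambda_j=i\}$; $(a;x)_k=\prod_{l=0}^{k-1}(1-ax^l)$. $u$ is a real parameter. Settings: $F$ a non-archimedean local field, ring of integers $\mathfrak{o}$, maximal ideal $\mathfrak{p}=\pi\mathfrak{o}$. Module of type $\lambda$: $\bigoplus_i\mathfrak{o}/\mathfrak{p}^{\lambda_i}$. Alternating module of type $\lambda$: $\bigoplus_i(\mathfrak{o}/\mathfrak{p}^{\lambda_i})^2$ with perfect alternating pairing $x^T(\pi^{\mathrm{alt}}_\lambda)^{-1}y\in F/\mathfrak{o}$, $\pi^{\mathrm{alt}}_\lambda$ block diagonal with blocks $\begin{pmatrix}0&\pi^{\lambda_i}\\-\pi^{\lambda_i}&0\end{pmatrix}$. Hermitian case: $F$ has an involution $*$ with fixed field $F_0$, $F/F_0$ unramified, $\pi\in F_0$, $\#\mathfrak{o}/\mathfrak{p}=q^2$; Hermitian module of type $\lambda$: $\bigoplus_i\mathfrak{o}/\mathfrak{p}^{\lambda_i}$ with pairing $\sum_i\pi^{-\lambda_i}x_i^*y_i\in F/\mathfrak{o}$. Measures: $\mathbf{P}(u;\lambda)=\frac{q^{-u|\lambda|}}{\#\mathrm{Aut}(M_\lambda)}\prod_{j\ge1}(1-q^{-u-j})$ ($M_\lambda$ of type $\lambda$); $\mathbf{P}^{\mathrm{alt}}(u;\lambda)=\frac{q^{-2u|\lambda|}\#M_\lambda}{\#\mathrm{Aut}^A(M_\lambda)}\prod_{j\ge1}(1-q^{-2u-2j+1})$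 ($M_\lambda$ alternating of type $\lambda$, $\mathrm{Aut}^A$ pairing-preserving automorphisms); $\mathbf{P}^{\mathrm{her}}(u;\lambda)=\frac{q^{-u|\lambda|}}{\#\mathrm{Aut}^H(M_\lambda)}\prod_{j\ge1}(1-(-1)^{j-1}q^{-u-j})$ ($M_\lambda$ Hermitian of type $\lambda$, $\mathrm{Aut}^H$ pairing-preserving automorphisms). Symmetric functions: $P_\lambda(x;s)$ Hall-Littlewood polynomial (monic in $x^\lambda$), $Q_\lambda=\prod_i(s;s)_{m_i(\lambda)}P_\lambda$, evaluated at infinite sequences as limits of finite truncations; $\Pi_s(x;y)=\prod_{i,j}\frac{1-sx_iy_j}{1-x_iy_j}$. *)

theory Defs
  imports
    "HOL-Analysis.Infinite_Products"
    "HOL-Algebra.QuotRing"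
    "HOL-Algebra.Module"
    "HOL-Combinatorics.Permutations"
begin

section \<open>Partitions and q-Pochhammer products\<close>

text \<open>
  Partitions are weakly decreasing lists of positive integers.  Lists are indexed from 0, so the
  part usually called \<open>\<lambda>\<^sub>i\<close> is \<open>lam ! (i - 1)\<close>; the size is \<open>sum_list lam\<close> and the multiplicity
  \<open>m\<^sub>i\<close> is \<open>count_list lam i\<close>.
\<close>

definition is_partition :: "nat list \<Rightarrow> bool" where
  "is_partition lam \<longleftrightarrow> sorted_wrt (\<ge>) lam \<and> 0 \<notin> set lam"

definition n_part :: "nat list \<Rightarrow> nat" where
  "n_part lam = (\<Sum>i<length lam. i * lam ! i)"

definition qpoch :: "real \<Rightarrow> real \<Rightarrow> nat \<Rightarrow> real" where
  "qpoch a x k = (\<Prod>l<k. 1 - a * x ^ l)"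

text \<open>
  \<open>\<Prod>\<^sub>i\<^sub>\<ge>\<^sub>1 (s;s)\<^bsub>m_i\<^esub>\<close>; values \<open>i\<close> that are not parts have \<open>m_i = 0\<close> and contribute the factor 1.
\<close>

definition b_part :: "nat list \<Rightarrow> real \<Rightarrow> real" where
  "b_part lam s = (\<Prod>i\<in>set lam. qpoch s s (count_list lam i))"


section \<open>Hall-Littlewood functions\<close>

text \<open>
  Polynomial functions in the variables \<open>x 0, \<dots>, x (n - 1)\<close>.  The reals being infinite, these are
  the same as polynomials with real coefficients.
\<close>

inductive poly_fun :: "nat \<Rightarrow> ((nat \<Rightarrow> real) \<Rightarrow> real) \<Rightarrow> bool" for n where
  const: "poly_fun n (\<lambda>x. c)"
| var: "i < n \<Longrightarrow> poly_fun n (\<lambda>x. x i)"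
| add: "poly_fun n f \<Longrightarrow> poly_fun n g \<Longrightarrow> poly_fun n (\<lambda>x. f x + g x)"
| mult: "poly_fun n f \<Longrightarrow> poly_fun n g \<Longrightarrow> poly_fun n (\<lambda>x. f x * g x)"

text \<open>
  \<open>v_m(s) = \<Prod>\<^sub>i\<^sub>\<le>\<^sub>m (1 - s^i) / (1 - s)\<close> and \<open>v_\<lambda>(s) = \<Prod>\<^sub>i\<^sub>\<ge>\<^sub>0 v_m\<^sub>i(s)\<close>, where \<open>m\<^sub>0 = n - length lam\<close> when
  \<open>\<lambda>\<close> is padded by zeros to \<open>n\<close> entries.  This is the factor that makes the symmetrization below
  monic in \<open>x^\<lambda>\<close>; it is nonzero for \<open>s > -1\<close>.
\<close>

definition hl_v :: "nat \<Rightarrow> real \<Rightarrow> real" where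
  "hl_v m s = (\<Prod>i=1..m. \<Sum>j<i. s ^ j)"

definition hl_v_part :: "nat \<Rightarrow> nat list \<Rightarrow> real \<Rightarrow> real" where
  "hl_v_part n lam s = hl_v (n - length lam) s * (\<Prod>i\<in>set lam. hl_v (count_list lam i) s)"

definition hl_sym :: "nat \<Rightarrow> nat list \<Rightarrow> real \<Rightarrow> (nat \<Rightarrow> real) \<Rightarrow> real" where
  "hl_sym n lam s x =
     (\<Sum>w | w permutes {..<n}.
        (\<Prod>i<length lam. x (w i) ^ (lam ! i)) *
        (\<Prod>(i, j)\<in>{(i, j). i < j \<and> j < n}. (x (w i) - s * x (w j)) / (x (w i) - x (w j))))
     / hl_v_part n lam s"

text \<open>
  The Hall-Littlewood polynomial in \<open>n\<close> variables: the polynomial represented by the rational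
  expression \<^const>\<open>hl_sym\<close>, which only makes sense literally at points with pairwise distinct
  coordinates.  It is 0 if there are fewer variables than parts.
\<close>

definition HL_P_fin :: "nat \<Rightarrow> nat list \<Rightarrow> real \<Rightarrow> (nat \<Rightarrow> real) \<Rightarrow> real" where
  "HL_P_fin n lam s =
     (if n < length lam then (\<lambda>x. 0)
      else (THE p. poly_fun n p \<and> (\<forall>x. inj_on x {..<n} \<longrightarrow> p x = hl_sym n lam s x)))"

definition HL_P :: "nat list \<Rightarrow> real \<Rightarrow> (nat \<Rightarrow> real) \<Rightarrow> real" where
  "HL_P lam s x = lim (\<lambda>n. HL_P_fin n lam s x)"

definition HL_Q :: "nat list \<Rightarrow> real \<Rightarrow> (nat \<Rightarrow> real) \<Rightarrow> real" where
  "HL_Q lam s x = b_part lam s * HL_P lam s x"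

text \<open>
  If some \<open>x i * y j\<close> equals 1, division by zero makes the value below 0, and dividing by it gives 0
  again.  For geometric sequences \<open>x i = x 0 * s^i\<close>, \<open>y j = s^j\<close> the reciprocal kernel is
  \<open>\<Prod>\<^sub>i (1 - x i)\<close>, which does vanish in this case since \<open>x (i + j) = 1\<close>.
\<close>

definition HL_Pi :: "real \<Rightarrow> (nat \<Rightarrow> real) \<Rightarrow> (nat \<Rightarrow> real) \<Rightarrow> real" where
  "HL_Pi s x y = (\<Prod>i. \<Prod>j. (1 - s * x i * y j) / (1 - x i * y j))"


section \<open>Non-archimedean local fields\<close>

text \<open>
  For a valuation \<open>v\<close> (whose value at 0 is irrelevant), \<open>pp v k\<close> is the fractional ideal \<open>\<pp>^k\<close>,
  so that \<open>pp v 0\<close> is the ring of integers and \<open>pp v 1\<close> its maximal ideal.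
\<close>

definition pp :: "('a::field \<Rightarrow> int) \<Rightarrow> int \<Rightarrow> 'a set" where
  "pp v k = {x. x = 0 \<or> k \<le> v x}"

definition int_ring :: "('a::field \<Rightarrow> int) \<Rightarrow> 'a ring" where
  "int_ring v = \<lparr>carrier = pp v 0, mult = (*), one = 1, zero = 0, add = (+)\<rparr>"

abbreviation residue_field :: "('a::field \<Rightarrow> int) \<Rightarrow> 'a set ring" where
  "residue_field v \<equiv> int_ring v Quot pp v 1"

text \<open>
  A non-archimedean local field is a field that is complete for a normalized discrete valuation
  with finite residue field.
\<close>

locale nonarch_local_field =
  fixes v :: "'a::field \<Rightarrow> int"
  assumes v_mult: "x \<noteq> 0 \<Longrightarrow> y \<noteq> 0 \<Longrightarrow> v (x * y) = v x + v y"
    and v_add: "x \<noteq> 0 \<Longrightarrow> y \<noteq> 0 \<Longrightarrow> x + y \<noteq> 0 \<Longrightarrow> min (v x) (v y) \<le> v (x + y)"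
    and v_normalized: "\<exists>x. x \<noteq> 0 \<and> v x = 1"
    and v_complete: "(\<forall>k. \<exists>N. \<forall>m\<ge>N. \<forall>n\<ge>N. X m - X n \<in> pp v k) \<Longrightarrow>
                     \<exists>L. \<forall>k. \<exists>N. \<forall>n\<ge>N. (X :: nat \<Rightarrow> 'a) n - L \<in> pp v k"
    and finite_residue_field: "finite (carrier (residue_field v))"

text \<open>
  For a subfield \<open>K\<close>, unramified means that the maximal ideal is generated by that of \<open>K\<close>;
  separability of the residue field extension is automatic, as residue fields are finite.
  That \<open>\<sigma>\<close> preserves the valuation is automatic as well: a field automorphism of a local field
  maps the ring of integers to itself.
\<close>

definition unramified_over :: "('a::field \<Rightarrow> int) \<Rightarrow> 'a set \<Rightarrow> bool" where
  "unramified_over v K \<longleftrightarrow> Idl\<^bsub>int_ring v\<^esub> (pp v 1 \<inter> K) = pp v 1"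

definition field_involution :: "('a::field \<Rightarrow> 'a) \<Rightarrow> bool" where
  "field_involution \<sigma> \<longleftrightarrow>
     (\<forall>x y. \<sigma> (x + y) = \<sigma> x + \<sigma> y) \<and> (\<forall>x y. \<sigma> (x * y) = \<sigma> x * \<sigma> y) \<and>
     (\<forall>x. \<sigma> (\<sigma> x) = x) \<and> \<sigma> \<noteq> id"

definition fixed_field :: "('a::field \<Rightarrow> 'a) \<Rightarrow> 'a set" where
  "fixed_field \<sigma> = {x. \<sigma> x = x}"


section \<open>Modules of a given type and their automorphisms\<close>

text \<open>
  The module \<open>\<Oplus>\<^sub>i \<oo>/\<pp>^\<lambda>\<^sub>i\<close>.  An element is an extensional function sending \<open>i\<close> to a coset of \<open>\<pp>^\<lambda>\<^sub>i\<close>.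
  The (irrelevant) fields \<open>mult\<close> and \<open>one\<close> of the module record are filled componentwise.
\<close>

definition cyc :: "('a::field \<Rightarrow> int) \<Rightarrow> nat \<Rightarrow> 'a set ring" where
  "cyc v k = int_ring v Quot pp v (int k)"

definition type_module :: "('a::field \<Rightarrow> int) \<Rightarrow> nat list \<Rightarrow> ('a, nat \<Rightarrow> 'a set) module" where
  "type_module v lam =
     \<lparr>carrier = (\<Pi>\<^sub>E i\<in>{..<length lam}. carrier (cyc v (lam ! i))),
      mult = (\<lambda>x y. \<lambda>i\<in>{..<length lam}. x i \<otimes>\<^bsub>cyc v (lam ! i)\<^esub> y i),
      one = (\<lambda>i\<in>{..<length lam}. \<one>\<^bsub>cyc v (lam ! i)\<^esub>),
      zero = (\<lambda>i\<in>{..<length lam}. \<zero>\<^bsub>cyc v (lam ! i)\<^esub>),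
      add = (\<lambda>x y. \<lambda>i\<in>{..<length lam}. x i \<oplus>\<^bsub>cyc v (lam ! i)\<^esub> y i),
      smult = (\<lambda>r x. \<lambda>i\<in>{..<length lam}.
                 (pp v (int (lam ! i)) +>\<^bsub>int_ring v\<^esub> r) \<otimes>\<^bsub>cyc v (lam ! i)\<^esub> x i)\<rparr>"

definition module_auts :: "'a ring \<Rightarrow> ('a, 'b) module \<Rightarrow> ('b \<Rightarrow> 'b) set" where
  "module_auts R M =
     {f \<in> carrier M \<rightarrow>\<^sub>E carrier M.
        bij_betw f (carrier M) (carrier M) \<and>
        (\<forall>x\<in>carrier M. \<forall>y\<in>carrier M. f (x \<oplus>\<^bsub>M\<^esub> y) = f x \<oplus>\<^bsub>M\<^esub> f y) \<and>
        (\<forall>r\<in>carrier R. \<forall>x\<in>carrier M. f (r \<odot>\<^bsub>M\<^esub> x) = r \<odot>\<^bsub>M\<^esub> f x)}"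

text \<open>
  The pairing with values in \<open>F/\<oo>\<close> that is induced on \<^const>\<open>type_module\<close> by a form \<open>B\<close> on
  vectors over \<open>F\<close>: its value is the coset \<open>B a b + \<oo>\<close> for arbitrary representatives \<open>a\<close>, \<open>b\<close>
  of the arguments.
\<close>

definition induced_pairing ::
    "('a::field \<Rightarrow> int) \<Rightarrow> nat \<Rightarrow> ((nat \<Rightarrow> 'a) \<Rightarrow> (nat \<Rightarrow> 'a) \<Rightarrow> 'a) \<Rightarrow>
     (nat \<Rightarrow> 'a set) \<Rightarrow> (nat \<Rightarrow> 'a set) \<Rightarrow> 'a set" where
  "induced_pairing v n B x y =
     {c. \<exists>a b. (\<forall>i<n. a i \<in> x i) \<and> (\<forall>i<n. b i \<in> y i) \<and> c - B a b \<in> pp v 0}"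

text \<open>
  In the alternating module each part occurs twice, at the positions \<open>2 i\<close> and \<open>2 i + 1\<close>, and the form
  is \<open>x^T A^-1 y\<close> for the block diagonal matrix \<open>A\<close> with blocks \<open>(0, c; -c, 0)\<close>, \<open>c = \<pi>^\<lambda>\<^sub>i\<close>, whose
  inverses are \<open>(0, -1/c; 1/c, 0)\<close>.
\<close>

definition double_parts :: "nat list \<Rightarrow> nat list" where
  "double_parts lam = concat (map (\<lambda>k. [k, k]) lam)"

definition alt_form :: "'a::field \<Rightarrow> nat list \<Rightarrow> (nat \<Rightarrow> 'a) \<Rightarrow> (nat \<Rightarrow> 'a) \<Rightarrow> 'a" where
  "alt_form \<pi> lam a b =
     (\<Sum>i<length lam. (a (2 * i + 1) * b (2 * i) - a (2 * i) * b (2 * i + 1)) / \<pi> ^ (lam ! i))"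

abbreviation alt_module :: "('a::field \<Rightarrow> int) \<Rightarrow> nat list \<Rightarrow> ('a, nat \<Rightarrow> 'a set) module" where
  "alt_module v lam \<equiv> type_module v (double_parts lam)"

definition alt_pairing ::
    "('a::field \<Rightarrow> int) \<Rightarrow> 'a \<Rightarrow> nat list \<Rightarrow> (nat \<Rightarrow> 'a set) \<Rightarrow> (nat \<Rightarrow> 'a set) \<Rightarrow> 'a set" where
  "alt_pairing v \<pi> lam = induced_pairing v (2 * length lam) (alt_form \<pi> lam)"

definition alt_auts ::
    "('a::field \<Rightarrow> int) \<Rightarrow> 'a \<Rightarrow> nat list \<Rightarrow> ((nat \<Rightarrow> 'a set) \<Rightarrow> (nat \<Rightarrow> 'a set)) set" where
  "alt_auts v \<pi> lam =
     {f \<in> module_auts (int_ring v) (alt_module v lam).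
        \<forall>x\<in>carrier (alt_module v lam). \<forall>y\<in>carrier (alt_module v lam).
          alt_pairing v \<pi> lam (f x) (f y) = alt_pairing v \<pi> lam x y}"

definition her_form ::
    "('a::field \<Rightarrow> 'a) \<Rightarrow> 'a \<Rightarrow> nat list \<Rightarrow> (nat \<Rightarrow> 'a) \<Rightarrow> (nat \<Rightarrow> 'a) \<Rightarrow> 'a" where
  "her_form \<sigma> \<pi> lam a b = (\<Sum>i<length lam. \<sigma> (a i) * b i / \<pi> ^ (lam ! i))"

definition her_pairing ::
    "('a::field \<Rightarrow> int) \<Rightarrow> ('a \<Rightarrow> 'a) \<Rightarrow> 'a \<Rightarrow> nat list \<Rightarrow>
     (nat \<Rightarrow> 'a set) \<Rightarrow> (nat \<Rightarrow> 'a set) \<Rightarrow> 'a set" where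
  "her_pairing v \<sigma> \<pi> lam = induced_pairing v (length lam) (her_form \<sigma> \<pi> lam)"

definition her_auts ::
    "('a::field \<Rightarrow> int) \<Rightarrow> ('a \<Rightarrow> 'a) \<Rightarrow> 'a \<Rightarrow> nat list \<Rightarrow>
     ((nat \<Rightarrow> 'a set) \<Rightarrow> (nat \<Rightarrow> 'a set)) set" where
  "her_auts v \<sigma> \<pi> lam =
     {f \<in> module_auts (int_ring v) (type_module v lam).
        \<forall>x\<in>carrier (type_module v lam). \<forall>y\<in>carrier (type_module v lam).
          her_pairing v \<sigma> \<pi> lam (f x) (f y) = her_pairing v \<sigma> \<pi> lam x y}"


section \<open>The three measures\<close>

text \<open>
  Infinite products over \<open>j \<ge> 1\<close> are indexed by \<open>j + 1\<close> with \<open>j \<ge> 0\<close>.  The number \<open>q\<close> is a parameter,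
  being the size of the residue field in the first two cases and its square root in the third.
\<close>

definition P_meas :: "('a::field \<Rightarrow> int) \<Rightarrow> nat \<Rightarrow> real \<Rightarrow> nat list \<Rightarrow> real" where
  "P_meas v q u lam =
     real q powr (- u * sum_list lam) / card (module_auts (int_ring v) (type_module v lam)) *
     (\<Prod>j. 1 - real q powr (- u - real (j + 1)))"

definition P_alt_meas :: "('a::field \<Rightarrow> int) \<Rightarrow> 'a \<Rightarrow> nat \<Rightarrow> real \<Rightarrow> nat list \<Rightarrow> real" where
  "P_alt_meas v \<pi> q u lam =
     real q powr (- 2 * u * sum_list lam) * card (carrier (alt_module v lam)) /
       card (alt_auts v \<pi> lam) *
     (\<Prod>j. 1 - real q powr (- 2 * u - 2 * real (j + 1) + 1))"

definition P_her_meas ::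
    "('a::field \<Rightarrow> int) \<Rightarrow> ('a \<Rightarrow> 'a) \<Rightarrow> 'a \<Rightarrow> nat \<Rightarrow> real \<Rightarrow> nat list \<Rightarrow> real" where
  "P_her_meas v \<sigma> \<pi> q u lam =
     real q powr (- u * sum_list lam) / card (her_auts v \<sigma> \<pi> lam) *
     (\<Prod>j. 1 - (-1) ^ j * real q powr (- u - real (j + 1)))"

end

theory Submission
  imports Defs "HOL-Computational_Algebra.Polynomial" "HOL-Library.Function_Algebras"
begin

text \<open>
  In the symmetrization defining \<open>P\<^sub>\<lambda>(x, x s, x s\<^sup>2, \<dots>; s)\<close> only the identity permutation contributes, which
  gives \<open>x^|\<lambda>| s^n(\<lambda>) / b\<^sub>\<lambda>(s)\<close>, and the kernel \<open>\<Pi>\<^sub>s\<close> telescopes to \<open>\<Prod>\<^sub>i 1 / (1 - x s^i)\<close>. What remains are the orders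
  of the three automorphism groups. An automorphism is determined by the images of the standard
  generators. With a pairing, these are the frames with the Gram matrix of the standard generators;
  without one, a basis is counted together with its dual basis, that is, as a frame for the pairing
  of the module with its dual. Choosing the first vectors of a frame splits off a
  cyclic or hyperbolic summand of maximal exponent, and the orders of the torsion submodules of the
  orthogonal complement are those of the module whose type has the first part removed. So the
  number of frames is a product over the parts of \<open>\<lambda>\<close>. In the Hermitian case the number of vectors of
  norm \<open>1 / \<pi>^k\<close> follows from the surjectivity of the norm on units and a recursion for the number
  of vectors whose scaled norm is not a unit.
\<close>

section \<open>Hall-Littlewood polynomials\<close>

text \<open>Three obstacles shape the details. \<open>HL_P_fin\<close> is described as the
  polynomial agreeing with a rational expression, so even its values at points with distinct
  coordinates require that this polynomial exists: the symmetrization must be shown divisible by the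
  Vandermonde product. The involution comes without continuity, so its compatibility with the
  valuation is extracted algebraically, from roots of arbitrarily high degree in 1 + \<pp>; its
  nontriviality on the residue field then follows from \<tau> \<pi> = \<pi>. The residue
  characteristic may be 2, so an integral element of trace 1 takes the place of 1/2.

  The deformation parameters have a common origin. For a largest part of multiplicity m, the vectors
  of exact maximal order have proportion 1 - Q^(-m), where Q is the order of the residue field;
  doubling all parts turns this into 1 - Q^(-2m). In the Hermitian case the vectors of unit norm
  have proportion (1 - 1/q) (1 - (-1/q)^m), by the classical count of zeros of a Hermitian form over
  a finite field. Up to the constant 1 - 1/q these factors multiply to
  \<open>b_part\<close>.\<close>

lemma poly_fun_line:
  assumes "poly_fun n f"
  shows "\<exists>p. \<forall>t. f (\<lambda>i. x i + t * d i) = poly p t"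
  using assms
proof induction
  case (const c)
  show ?case by (rule exI[of _ "[:c:]"]) simp
next
  case (var i)
  show ?case by (rule exI[of _ "[:x i, d i:]"]) simp
next
  case (add f g)
  then obtain p p' where "\<forall>t. f (\<lambda>i. x i + t * d i) = poly p t" "\<forall>t. g (\<lambda>i. x i + t * d i) = poly p' t"
    by blast
  then show ?case by (intro exI[of _ "p + p'"]) simp
next
  case (mult f g)
  then obtain p p' where "\<forall>t. f (\<lambda>i. x i + t * d i) = poly p t" "\<forall>t. g (\<lambda>i. x i + t * d i) = poly p' t"
    by blast
  then show ?case by (intro exI[of _ "p * p'"]) simp
qed

text \<open>Polynomial functions have no zero divisors: on the line from \<open>x\<close> to
  \<open>x0\<close> both become polynomials in one variable, and the second is nonzero because its
  value at 1 is \<open>g x0\<close>. This serves as the identity principle in later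
  cancellations.\<close>

lemma poly_fun_mult_eq_0:
  assumes f: "poly_fun n f" and g: "poly_fun n g"
    and fg: "\<And>x. f x * g x = 0" and g0: "g x0 \<noteq> 0"
  shows "f x = 0"
proof -
  obtain p where p: "\<And>t. f (\<lambda>i. x i + t * (x0 i - x i)) = poly p t"
    using poly_fun_line[OF f, of x "\<lambda>i. x0 i - x i"] by blast
  obtain r where r: "\<And>t. g (\<lambda>i. x i + t * (x0 i - x i)) = poly r t"
    using poly_fun_line[OF g, of x "\<lambda>i. x0 i - x i"] by blast
  have "poly (p * r) t = 0" for t
    using fg[of "\<lambda>i. x i + t * (x0 i - x i)"] by (simp add: p r)
  then have "p * r = 0"
    using poly_all_0_iff_0 by blast
  moreover have "r \<noteq> 0"
    using g0 r[of 1] by auto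
  ultimately have "p = 0" by simp
  then show ?thesis
    using p[of 0] by simp
qed

lemma poly_fun_uminus: "poly_fun n f \<Longrightarrow> poly_fun n (\<lambda>x. - f x)"
  using poly_fun.mult[OF poly_fun.const[of n "-1"], of f] by simp

lemma poly_fun_diff: "poly_fun n f \<Longrightarrow> poly_fun n g \<Longrightarrow> poly_fun n (\<lambda>x. f x - g x)"
  using poly_fun.add[OF _ poly_fun_uminus, of n f g] by simp

lemma poly_fun_sum: "(\<And>a. a \<in> A \<Longrightarrow> poly_fun n (f a)) \<Longrightarrow> poly_fun n (\<lambda>x. \<Sum>a\<in>A. f a x)"
  by (induction A rule: infinite_finite_induct) (auto intro: poly_fun.intros)

lemma poly_fun_prod: "(\<And>a. a \<in> A \<Longrightarrow> poly_fun n (f a)) \<Longrightarrow> poly_fun n (\<lambda>x. \<Prod>a\<in>A. f a x)"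
  by (induction A rule: infinite_finite_induct) (auto intro: poly_fun.intros)

lemma poly_fun_power: "poly_fun n f \<Longrightarrow> poly_fun n (\<lambda>x. f x ^ k)"
  by (induction k) (auto intro: poly_fun.intros)

lemma poly_fun_subst:
  assumes "poly_fun n f" "\<And>i. i < n \<Longrightarrow> poly_fun n (\<lambda>x. g x i)"
  shows "poly_fun n (\<lambda>x. f (g x))"
  using assms by induction (auto intro: poly_fun.intros)

lemma poly_fun_upd:
  assumes "poly_fun n f" "l < n"
  shows "poly_fun n (\<lambda>x. f (x(k := x l)))"
proof (rule poly_fun_subst[OF assms(1)])
  show "poly_fun n (\<lambda>x. (x(k := x l)) i)" if "i < n" for i
    using that assms(2) by (cases "i = k") (auto intro: poly_fun.intros)
qed

text \<open>The factor theorem for the variables \<open>x i\<close> and \<open>x j\<close>. The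
  quotient is built along the generation of \<open>f\<close>, with the product rule of divided
  differences in the case of a product.\<close>

lemma poly_fun_divided_difference:
  assumes "poly_fun n f" "i < n" "j < n"
  shows "\<exists>r. poly_fun n r \<and> (\<forall>x. f x - f (x(i := x j)) = (x i - x j) * r x)"
  using assms(1)
proof induction
  case (const c)
  show ?case by (rule exI[of _ "\<lambda>x. 0"]) (auto intro: poly_fun.intros)
next
  case (var k)
  show ?case
  proof (cases "k = i")
    case True
    then show ?thesis by (intro exI[of _ "\<lambda>x. 1"]) (auto intro: poly_fun.intros)
  next
    case False
    then show ?thesis by (intro exI[of _ "\<lambda>x. 0"]) (auto intro: poly_fun.intros)
  qed
next
  case (add f g)
  then obtain r r' where "poly_fun n r" "\<And>x. f x - f (x(i := x j)) = (x i - x j) * r x"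
    "poly_fun n r'" "\<And>x. g x - g (x(i := x j)) = (x i - x j) * r' x"
    by blast
  then show ?case
    by (intro exI[of _ "\<lambda>x. r x + r' x"])
      (auto intro: poly_fun.intros simp only: distrib_left add_diff_add)
next
  case (mult f g)
  then obtain r r' where r: "poly_fun n r" "\<And>x. f x - f (x(i := x j)) = (x i - x j) * r x"
    "poly_fun n r'" "\<And>x. g x - g (x(i := x j)) = (x i - x j) * r' x"
    by blast
  have "f x * g x - f (x(i := x j)) * g (x(i := x j)) =
      (x i - x j) * (r x * g x + f (x(i := x j)) * r' x)" for x
  proof -
    have "f x * g x - f (x(i := x j)) * g (x(i := x j)) =
        (f x - f (x(i := x j))) * g x + f (x(i := x j)) * (g x - g (x(i := x j)))"
      by (simp add: algebra_simps)
    then show ?thesis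
      unfolding r by (simp add: algebra_simps)
  qed
  moreover have "poly_fun n (\<lambda>x. r x * g x + f (x(i := x j)) * r' x)"
    using r mult.hyps assms(3) by (auto intro!: poly_fun.intros poly_fun_upd)
  ultimately show ?case by blast
qed

section \<open>Divisibility by the Vandermonde product, and its sign under permutations\<close>

definition ipairs :: "nat \<Rightarrow> (nat \<times> nat) set" where
  "ipairs n = {(i, j). i < j \<and> j < n}"

lemma finite_ipairs [simp]: "finite (ipairs n)"
  by (rule finite_subset[of _ "{..<n} \<times> {..<n}"]) (auto simp: ipairs_def)

lemma poly_fun_div_prod_diff:
  assumes "finite S" "S \<subseteq> ipairs n" "poly_fun n f"
    and "\<And>i j x. (i, j) \<in> S \<Longrightarrow> x i = x j \<Longrightarrow> f x = 0"
  shows "\<exists>r. poly_fun n r \<and> (\<forall>x. f x = (\<Prod>(i, j)\<in>S. x i - x j) * r x)"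
  using assms
proof (induction S arbitrary: f rule: finite_induct)
  case empty
  then show ?case by auto
next
  case (insert p S)
  obtain i j where p: "p = (i, j)" by fastforce
  have ij: "i < j" "j < n" using insert.prems(1) by (auto simp: p ipairs_def)
  have "i < n" using ij by simp
  then obtain r where r: "poly_fun n r" "\<And>x. f x - f (x(i := x j)) = (x i - x j) * r x"
    using poly_fun_divided_difference[OF insert.prems(2) _ ij(2)] by blast
  have "f (x(i := x j)) = 0" for x
    by (rule insert.prems(3)[of i j]) (use ij p in auto)
  with r have fr: "f x = (x i - x j) * r x" for x
    by (metis diff_zero)
  \<comment> \<open>The quotient still vanishes on the other diagonals: on \<open>x k = x l\<close>
    its product with \<open>x i - x j\<close> is zero, and that factor is not identically zero
    there.\<close>
  have "r x = 0" if kl: "(k, l) \<in> S" and x: "x k = x l" for k l x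
  proof -
    have kl': "k < l" "l < n" using kl insert.prems(1) by (auto simp: ipairs_def)
    have ne: "(k, l) \<noteq> (i, j)" using kl insert.hyps p by auto
    let ?g = "\<lambda>x :: nat \<Rightarrow> real. (x(k := x l)) i - (x(k := x l)) j"
    have z: "r (y(k := y l)) * ?g y = 0" for y
    proof -
      have "f (y(k := y l)) = 0"
        by (rule insert.prems(3)[of k l]) (use kl kl' in auto)
      then show ?thesis
        using fr[of "y(k := y l)"] by (simp only: mult.commute)
    qed
    have pr: "poly_fun n (\<lambda>x. r (x(k := x l)))"
      using r(1) kl' by (intro poly_fun_upd)
    have pg: "poly_fun n ?g"
      using ij kl' \<open>i < n\<close>
      by (intro poly_fun_diff poly_fun_upd[OF poly_fun.var])
    \<comment> \<open>The point with coordinates 0, 1, 2, ..., moved onto the diagonal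
      \<open>x k = x l\<close>, still separates \<open>i\<close> and \<open>j\<close>, since the two
      pairs differ.\<close>
    have g0: "?g real \<noteq> 0"
      using ne ij kl' by auto
    have "r (x(k := x l)) = 0"
      by (rule poly_fun_mult_eq_0[where f = "\<lambda>x. r (x(k := x l))" and g = ?g, OF pr pg z g0])
    moreover have "x(k := x l) = x" using x by auto
    ultimately show ?thesis by simp
  qed
  then obtain r' where r': "poly_fun n r'" "\<And>x. r x = (\<Prod>(i, j)\<in>S. x i - x j) * r' x"
    using insert.IH[OF _ r(1)] insert.prems(1) by blast
  have "f x = (\<Prod>(i, j)\<in>insert p S. x i - x j) * r' x" for x
    using insert.hyps by (simp add: fr r'(2) p)
  with r'(1) show ?case by blast
qed

definition vdm :: "nat \<Rightarrow> (nat \<Rightarrow> real) \<Rightarrow> real" where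
  "vdm n x = (\<Prod>(i, j)\<in>ipairs n. x i - x j)"

text \<open>The sign of a permutation, as -1 to the number of inversions; in this form it can be
  compared with the Vandermonde product factor by factor.\<close>

definition vdm_sign :: "nat \<Rightarrow> (nat \<Rightarrow> nat) \<Rightarrow> real" where
  "vdm_sign n w = (\<Prod>(i, j)\<in>ipairs n. if w i < w j then 1 else - 1)"

lemma vdm_sign_cases: "vdm_sign n w = 1 \<or> vdm_sign n w = - 1"
proof -
  have "(\<Prod>(i, j)\<in>S. if w i < w j then 1 else - 1 :: real) \<in> {1, -1}" if "finite S" for S
    using that by (induction S rule: finite_induct) (auto split: if_splits)
  then show ?thesis by (auto simp: vdm_sign_def)
qed

lemma vdm_permute:
  assumes w: "w permutes {..<n}"
  shows "vdm n (x \<circ> w) = vdm_sign n w * vdm n x"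
proof -
  \<comment> \<open>Sorting the image pair permutes the index pairs; each inversion reverses one
    factor.\<close>
  let ?h = "\<lambda>(i, j). (min (w i) (w j), max (w i) (w j))"
  have wlt: "w i < n \<longleftrightarrow> i < n" for i
    using permutes_in_image[OF w, of i] by simp
  have weq: "w i = w j \<longleftrightarrow> i = j" for i j
    using permutes_inj[OF w] by (auto dest: injD)
  have inj: "inj_on ?h (ipairs n)"
  proof (rule inj_onI, clarify)
    fix i j k l
    assume *: "(i, j) \<in> ipairs n" "(k, l) \<in> ipairs n"
      and "min (w i) (w j) = min (w k) (w l)" "max (w i) (w j) = max (w k) (w l)"
    then have "{w i, w j} = {w k, w l}"
      by (auto simp: min_def max_def split: if_splits)
    then have "{i, j} = {k, l}"
      by (auto simp: doubleton_eq_iff weq)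
    then show "i = k \<and> j = l"
      using * by (auto simp: doubleton_eq_iff ipairs_def)
  qed
  have "?h p \<in> ipairs n" if "p \<in> ipairs n" for p
  proof -
    obtain i j where p: "p = (i, j)" by fastforce
    then have "w i \<noteq> w j" "w i < n" "w j < n"
      using that by (auto simp: ipairs_def weq wlt)
    then show ?thesis
      by (auto simp: p ipairs_def min_def max_def)
  qed
  then have "?h ` ipairs n \<subseteq> ipairs n" by (rule image_subsetI)
  then have "bij_betw ?h (ipairs n) (ipairs n)"
    using inj endo_inj_surj[OF finite_ipairs] by (intro bij_betw_imageI) auto
  then have "vdm n x = (\<Prod>p\<in>ipairs n. case ?h p of (i, j) \<Rightarrow> x i - x j)"
    unfolding vdm_def by (rule prod.reindex_bij_betw[symmetric])
  moreover have "vdm n (x \<circ> w) =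
      (\<Prod>p\<in>ipairs n. (case p of (i, j) \<Rightarrow> if w i < w j then 1 else - 1) *
        (case ?h p of (i, j) \<Rightarrow> x i - x j))"
    unfolding vdm_def by (rule prod.cong) (auto simp: min_def max_def)
  ultimately show ?thesis
    by (simp add: prod.distrib vdm_sign_def)
qed

lemma vdm_neq_0_iff: "vdm n x \<noteq> 0 \<longleftrightarrow> inj_on x {..<n}"
proof
  assume *: "vdm n x \<noteq> 0"
  show "inj_on x {..<n}"
  proof (rule linorder_inj_onI)
    fix i j assume "i < j" "i \<in> {..<n}" "j \<in> {..<n}"
    then have "(i, j) \<in> ipairs n" by (auto simp: ipairs_def)
    then show "x i \<noteq> x j"
      using * by (auto simp: vdm_def)
  qed auto
next
  assume "inj_on x {..<n}"
  then have "x i - x j \<noteq> 0" if "(i, j) \<in> ipairs n" for i j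
    using that by (auto simp: ipairs_def inj_on_def)
  then show "vdm n x \<noteq> 0"
    by (auto simp: vdm_def)
qed

text \<open>The swap t changes the sign of the factor \<open>x a - x b\<close>. For the remaining
  product W this gives W(x o t) = - e W(x), with e the sign, first off the diagonal and then
  everywhere. A point on the diagonal is fixed by the swap; one where W does not vanish forces e =
  -1.\<close>

lemma vdm_sign_transpose:
  assumes ab: "a < b" "b < n"
  shows "vdm_sign n (Transposition.transpose a b) = - 1"
proof -
  let ?t = "Transposition.transpose a b" and ?e = "vdm_sign n (Transposition.transpose a b)"
  let ?W = "\<lambda>x :: nat \<Rightarrow> real. \<Prod>(i, j)\<in>ipairs n - {(a, b)}. x i - x j"
  have t: "?t permutes {..<n}"
    using ab by (intro permutes_swap_id) auto
  have V: "vdm n x = (x a - x b) * ?W x" for x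
    using prod.remove[OF finite_ipairs, of "(a, b)" n "\<lambda>(i, j). x i - x j"] ab
    by (simp add: vdm_def ipairs_def)
  have W: "(?W (x \<circ> ?t) + ?e * ?W x) * (x a - x b) = 0" for x
  proof -
    have "(x b - x a) * ?W (x \<circ> ?t) = ?e * ((x a - x b) * ?W x)"
      using vdm_permute[OF t, of x] unfolding V by (simp only: o_apply transpose_apply_first transpose_apply_second)
    moreover have "(p + e * r) * d = 0" if "- d * p = e * (d * r)" for p e r d :: real
    proof -
      have "(p + e * r) * d = e * (d * r) - (- d * p)" by (simp add: algebra_simps)
      with that show ?thesis by simp
    qed
    ultimately show ?thesis
      by (metis minus_diff_eq)
  qed
  have "poly_fun n ?W"
    by (rule poly_fun_prod) (auto intro!: poly_fun_diff poly_fun.var simp: ipairs_def)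
  moreover have "poly_fun n (\<lambda>x. ?W (x \<circ> ?t))"
  proof (rule poly_fun_subst[OF \<open>poly_fun n ?W\<close>])
    show "poly_fun n (\<lambda>x. (x \<circ> ?t) i)" if "i < n" for i
      using poly_fun.var[of "?t i" n] permutes_in_image[OF t, of i] that by simp
  qed
  ultimately have pW: "poly_fun n (\<lambda>x. ?W (x \<circ> ?t) + ?e * ?W x)"
    by (intro poly_fun.add poly_fun.mult poly_fun.const)
  have pd: "poly_fun n (\<lambda>x. x a - x b)"
    using ab by (auto intro!: poly_fun_diff poly_fun.var)
  have d0: "real a - real b \<noteq> 0" using ab by simp
  have *: "?W (x \<circ> ?t) + ?e * ?W x = 0" for x
    by (rule poly_fun_mult_eq_0[where f = "\<lambda>x. ?W (x \<circ> ?t) + ?e * ?W x" and g = "\<lambda>x. x a - x b",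
          OF pW pd W d0])
  let ?x = "\<lambda>i. real (if i = b then a else i)"
  have "?x \<circ> ?t = ?x"
    by (auto simp: Transposition.transpose_def fun_eq_iff)
  then have "(1 + ?e) * ?W ?x = 0"
    using *[of ?x] by (simp only: distrib_right mult_1)
  moreover have "?W ?x \<noteq> 0"
    unfolding prod_zero_iff[OF finite_Diff[OF finite_ipairs]]
    using ab by (auto simp: ipairs_def split: if_splits)
  ultimately show ?thesis by simp
qed

text \<open>Over the common denominator, the Vandermonde product, the numerator \<open>G\<close> is
  an alternating sum. Where two coordinates agree, composing with their transposition pairs terms
  that cancel, so \<open>G\<close> vanishes there and is divisible by the product.\<close>

lemma hl_numerator_poly_fun:
  assumes "length lam \<le> n"
  shows "\<exists>r. poly_fun n r \<and> (\<forall>x. inj_on x {..<n} \<longrightarrow> r x =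
     (\<Sum>w | w permutes {..<n}.
        (\<Prod>i<length lam. x (w i) ^ (lam ! i)) *
        (\<Prod>(i, j)\<in>ipairs n. (x (w i) - s * x (w j)) / (x (w i) - x (w j)))))"
proof -
  define g where "g w x = (\<Prod>i<length lam. x (w i) ^ (lam ! i)) *
      (\<Prod>(i, j)\<in>ipairs n. x (w i) - s * x (w j))" for w :: "nat \<Rightarrow> nat" and x :: "nat \<Rightarrow> real"
  define G where "G x = (\<Sum>w | w permutes {..<n}. vdm_sign n w * g w x)" for x
  have "poly_fun n (g w)" if w: "w permutes {..<n}" for w
  proof -
    have x: "poly_fun n (\<lambda>x. x (w i))" if "i < n" for i
      using that permutes_in_image[OF w, of i] by (intro poly_fun.var) simp
    have "poly_fun n (\<lambda>x. \<Prod>i<length lam. x (w i) ^ (lam ! i))"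
      using assms x by (intro poly_fun_prod poly_fun_power) simp
    moreover have "poly_fun n (\<lambda>x. case p of (i, j) \<Rightarrow> x (w i) - s * x (w j))"
      if "p \<in> ipairs n" for p
      using that by (auto simp: ipairs_def intro!: poly_fun_diff poly_fun.mult[OF poly_fun.const] x)
    ultimately show ?thesis
      unfolding g_def by (intro poly_fun.mult poly_fun_prod[of "ipairs n"])
  qed
  then have "poly_fun n G"
    unfolding G_def by (intro poly_fun_sum poly_fun.mult[OF poly_fun.const]) simp
  moreover have "G x = 0" if ab: "(a, b) \<in> ipairs n" and x: "x a = x b" for a b x
  proof -
    let ?t = "Transposition.transpose a b"
    have ab: "a < b" "b < n" using ab by (auto simp: ipairs_def)
    have t: "?t permutes {..<n}"
      using ab by (intro permutes_swap_id) auto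
    \<comment> \<open>Read off by evaluating the Vandermonde product at the permuted point 0, 1, 2,
      ... in two ways.\<close>
    have "vdm_sign n (?t \<circ> w) = - vdm_sign n w" if w: "w permutes {..<n}" for w
    proof -
      have "vdm n (real \<circ> (?t \<circ> w)) = vdm_sign n (?t \<circ> w) * vdm n real"
        by (rule vdm_permute) (rule permutes_compose[OF w t])
      moreover have "vdm n ((real \<circ> ?t) \<circ> w) = vdm_sign n w * (- 1 * vdm n real)"
        using vdm_permute[OF w] vdm_permute[OF t] vdm_sign_transpose[OF ab] by metis
      moreover have "vdm n real \<noteq> 0" by (simp add: vdm_neq_0_iff)
      ultimately show ?thesis
        by (metis comp_assoc mult_cancel_right mult_minus_left mult_minus_right mult_1)
    qed
    moreover have "g (?t \<circ> w) x = g w x" for w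
    proof -
      have "x (?t i) = x i" for i using x by (auto simp: Transposition.transpose_def)
      then show ?thesis by (simp add: g_def)
    qed
    ultimately have "(\<Sum>w | w permutes {..<n}. vdm_sign n (?t \<circ> w) * g (?t \<circ> w) x) = - G x"
      unfolding G_def sum_negf[symmetric] by (intro sum.cong) auto
    then show ?thesis
      using setum_permutations_compose_left[OF t, of "\<lambda>w. vdm_sign n w * g w x"]
      by (simp add: G_def)
  qed
  ultimately obtain r where r: "poly_fun n r" "\<And>x. G x = vdm n x * r x"
    using poly_fun_div_prod_diff[of "ipairs n" n G] unfolding vdm_def by auto
  have "r x = (\<Sum>w | w permutes {..<n}.
        (\<Prod>i<length lam. x (w i) ^ (lam ! i)) *
        (\<Prod>(i, j)\<in>ipairs n. (x (w i) - s * x (w j)) / (x (w i) - x (w j))))"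
    if x: "inj_on x {..<n}" for x
  proof -
    have V: "vdm n x \<noteq> 0" using x vdm_neq_0_iff by blast
    have "r x = (\<Sum>w | w permutes {..<n}. vdm_sign n w * g w x / vdm n x)"
      using r(2)[of x] V by (simp add: G_def sum_divide_distrib[symmetric] field_simps)
    also have "\<dots> = (\<Sum>w | w permutes {..<n}. g w x / vdm n (x \<circ> w))"
    proof (intro sum.cong refl)
      fix w assume "w \<in> {w. w permutes {..<n}}"
      then show "vdm_sign n w * g w x / vdm n x = g w x / vdm n (x \<circ> w)"
        using vdm_sign_cases[of n w] vdm_permute[of w n x] by auto
    qed
    also have "\<dots> = (\<Sum>w | w permutes {..<n}.
        (\<Prod>i<length lam. x (w i) ^ (lam ! i)) *
        (\<Prod>(i, j)\<in>ipairs n. (x (w i) - s * x (w j)) / (x (w i) - x (w j))))"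
      by (intro sum.cong refl)
        (simp add: g_def vdm_def prod_dividef case_prod_unfold)
    finally show ?thesis .
  qed
  with r(1) show ?thesis by blast
qed

text \<open>Two candidates agree off the diagonals, so their difference times the Vandermonde
  product vanishes everywhere; hence exactly one function meets the description in
  \<open>HL_P_fin\<close>.\<close>

lemma HL_P_fin_eq_hl_sym:
  assumes "length lam \<le> n" and x: "inj_on x {..<n}"
  shows "HL_P_fin n lam s x = hl_sym n lam s x"
proof -
  let ?P = "\<lambda>p. poly_fun n p \<and> (\<forall>x. inj_on x {..<n} \<longrightarrow> p x = hl_sym n lam s x)"
  obtain r where r: "poly_fun n r" "\<And>x. inj_on x {..<n} \<Longrightarrow> r x =
      (\<Sum>w | w permutes {..<n}. (\<Prod>i<length lam. x (w i) ^ (lam ! i)) *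
        (\<Prod>(i, j)\<in>ipairs n. (x (w i) - s * x (w j)) / (x (w i) - x (w j))))"
    using hl_numerator_poly_fun[OF assms(1), of s] by blast
  have ex: "?P (\<lambda>x. r x * inverse (hl_v_part n lam s))"
    using r by (auto intro: poly_fun.intros simp: hl_sym_def ipairs_def divide_inverse)
  have "p = p'" if "?P p" "?P p'" for p p'
  proof
    fix x
    have "poly_fun n (\<lambda>x. p x - p' x)" "poly_fun n (vdm n)"
      using that unfolding vdm_def[abs_def]
      by (auto intro!: poly_fun_diff poly_fun_prod poly_fun.var simp: ipairs_def split: prod.splits)
    moreover have "(p x - p' x) * vdm n x = 0" for x
      using that vdm_neq_0_iff[of n x] by auto
    moreover have "vdm n real \<noteq> 0" by (simp add: vdm_neq_0_iff)
    ultimately have "p x - p' x = 0"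
      by (rule poly_fun_mult_eq_0[of n "\<lambda>x. p x - p' x" "vdm n"])
    then show "p x = p' x" by simp
  qed
  with ex have "?P (THE p. ?P p)"
    by (intro theI'[of ?P]) blast
  with assms show ?thesis
    by (simp add: HL_P_fin_def)
qed




section \<open>Principal specialization: values at geometric sequences\<close>

lemma permutes_not_id_Suc:
  fixes w :: "nat \<Rightarrow> nat"
  assumes w: "w permutes {..<n}" and "w \<noteq> id"
  shows "\<exists>i j. i < j \<and> j < n \<and> w i = Suc (w j)"
proof (rule ccontr)
  assume *: "\<not> ?thesis"
  \<comment> \<open>If every k + 1 stood after k, the inverse permutation would be increasing on 0,
    ..., n - 1 and hence the identity.\<close>
  define p where "p = Hilbert_Choice.inv w"
  have p: "p permutes {..<n}"
    unfolding p_def using w by (rule permutes_inv)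
  have wp: "w (p k) = k" for k
    unfolding p_def using w by (rule permutes_inverses)
  have plt: "p k < n \<longleftrightarrow> k < n" for k
    using permutes_in_image[OF p, of k] by simp
  have step: "p k < p (Suc k)" if "Suc k < n" for k
  proof (rule ccontr)
    assume "\<not> p k < p (Suc k)"
    moreover have "p k \<noteq> p (Suc k)" by (metis wp n_not_Suc_n)
    ultimately have "p (Suc k) < p k" by simp
    moreover have "p k < n" using that plt by simp
    ultimately show False using * wp by metis
  qed
  have ge: "k \<le> p k" if "k < n" for k
    using that
  proof (induction k)
    case (Suc k)
    then show ?case using step[of k] by simp
  qed simp
  have le: "p k + m < n" if "k + m < n" for k m
    using that
  proof (induction m arbitrary: k)
    case 0
    then show ?case using plt by simp
  next
    case (Suc m)
    then have "p (Suc k) + m < n" by simp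
    moreover have "p k < p (Suc k)" using Suc.prems by (intro step) simp
    ultimately show ?case by simp
  qed
  have "p k = k" for k
  proof (cases "k < n")
    case True
    then have "p k + (n - 1 - k) < n" by (intro le) simp
    with ge[OF True] True show ?thesis by simp
  next
    case False
    then show ?thesis using p by (simp add: permutes_def)
  qed
  then have "w = id" using wp by (metis eq_id_iff)
  with \<open>w \<noteq> id\<close> show False by simp
qed

lemma ipairs_Suc: "ipairs (Suc n) = ipairs n \<union> (\<lambda>i. (i, n)) ` {..<n}"
  by (auto simp: ipairs_def less_Suc_eq)

locale hl_base =
  fixes s :: real
  assumes s0: "s \<noteq> 0" and s1: "\<bar>s\<bar> < 1"
begin

lemma one_minus_power_neq_0: "1 - s ^ Suc k \<noteq> 0"
proof -
  have "\<bar>s ^ Suc k\<bar> < 1"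
    using s1 by (subst power_abs) (rule power_Suc_less_one, auto simp: s0)
  then show ?thesis by auto
qed

lemma power_eq_iff: "s ^ i = s ^ j \<longleftrightarrow> i = j"
proof -
  have "s ^ i \<noteq> s ^ j" if "i < j" for i j
  proof
    assume "s ^ i = s ^ j"
    moreover have "s ^ j = s ^ i * s ^ Suc (j - i - 1)"
      using that by (simp flip: power_add power_Suc)
    ultimately show False
      using one_minus_power_neq_0[of "j - i - 1"] s0 by simp
  qed
  then show ?thesis
    by (metis nat_neq_iff)
qed

lemma one_minus_neq_0: "1 - s \<noteq> 0"
  using s1 by auto

lemma sum_powers: "(\<Sum>j<n. s ^ j) = (1 - s ^ n) / (1 - s)"
  using one_minus_neq_0 one_diff_power_eq[of s n] by simp

text \<open>The factor belonging to the identity permutation. The pairs \<open>(i, n)\<close> of a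
  new variable contribute a product that telescopes to 1 + s + ... + s^n, the new factor of
  \<open>hl_v\<close>.\<close>

lemma prod_ipairs_geometric:
  "(\<Prod>(i, j)\<in>ipairs n. (s ^ i - s ^ Suc j) / (s ^ i - s ^ j)) = hl_v n s"
proof (induction n)
  case 0
  have "ipairs 0 = {}" by (auto simp: ipairs_def)
  then show ?case by (simp add: hl_v_def)
next
  case (Suc n)
  have "(\<Prod>i<n. (s ^ i - s ^ Suc n) / (s ^ i - s ^ n)) = (\<Prod>i<n. (1 - s ^ Suc (n - i)) / (1 - s ^ (n - i)))"
  proof (rule prod.cong)
    fix i assume "i \<in> {..<n}"
    then have "s ^ n = s ^ i * s ^ (n - i)" by (simp flip: power_add)
    then have "s ^ i - s ^ Suc n = s ^ i * (1 - s ^ Suc (n - i))" "s ^ i - s ^ n = s ^ i * (1 - s ^ (n - i))"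
      by (simp_all add: algebra_simps)
    then show "(s ^ i - s ^ Suc n) / (s ^ i - s ^ n) = (1 - s ^ Suc (n - i)) / (1 - s ^ (n - i))"
      using s0 by simp
  qed simp
  also have "\<dots> = (\<Prod>i<n. (1 - s ^ Suc (Suc i)) / (1 - s ^ Suc i))"
    by (subst prod.nat_diff_reindex[symmetric]) (auto intro!: prod.cong simp: Suc_diff_Suc)
  also have "\<dots> = (1 - s ^ Suc n) / (1 - s)"
  proof -
    have "(\<Prod>i<n. (1 - s ^ Suc (Suc i)) / (1 - s ^ Suc i)) = (1 - s ^ Suc n) / (1 - s ^ Suc 0)"
      by (rule prod_lessThan_telescope) (use one_minus_power_neq_0 in auto)
    then show ?thesis by simp
  qed
  also have "\<dots> = (\<Sum>j<Suc n. s ^ j)"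
    by (rule sum_powers[symmetric])
  finally have *: "(\<Prod>i<n. (s ^ i - s ^ Suc n) / (s ^ i - s ^ n)) = (\<Sum>j<Suc n. s ^ j)" .
  have "(\<Prod>(i, j)\<in>ipairs (Suc n). (s ^ i - s ^ Suc j) / (s ^ i - s ^ j)) =
      (\<Prod>(i, j)\<in>ipairs n. (s ^ i - s ^ Suc j) / (s ^ i - s ^ j)) *
      (\<Prod>(i, j)\<in>(\<lambda>i. (i, n)) ` {..<n}. (s ^ i - s ^ Suc j) / (s ^ i - s ^ j))"
    unfolding ipairs_Suc
    by (rule prod.union_disjoint[OF finite_ipairs finite_imageI]) (auto simp: ipairs_def)
  also have "\<dots> = hl_v n s * (\<Sum>j<Suc n. s ^ j)"
  proof -
    have "(\<Prod>(i, j)\<in>(\<lambda>i. (i, n)) ` {..<n}. (s ^ i - s ^ Suc j) / (s ^ i - s ^ j)) = (\<Sum>j<Suc n. s ^ j)"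
      unfolding *[symmetric] by (subst prod.reindex) (auto simp: inj_on_def)
    then show ?thesis by (simp only: Suc.IH)
  qed
  also have "\<dots> = hl_v (Suc n) s"
    by (simp add: hl_v_def)
  finally show ?case .
qed

lemma hl_v_qpoch: "hl_v m s = qpoch s s m / (1 - s) ^ m"
proof (induction m)
  case 0
  show ?case by (simp add: hl_v_def qpoch_def)
next
  case (Suc m)
  have "hl_v (Suc m) s = hl_v m s * (\<Sum>j<Suc m. s ^ j)"
    by (simp add: hl_v_def)
  also have "(\<Sum>j<Suc m. s ^ j) = (1 - s ^ Suc m) / (1 - s)"
    by (rule sum_powers)
  finally show ?case
    by (simp add: Suc.IH qpoch_def)
qed

lemma qpoch_neq_0: "qpoch s s m \<noteq> 0"
  using one_minus_power_neq_0 by (auto simp: qpoch_def)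

lemma qpoch_add: "qpoch s s (m + l) = qpoch s s m * (\<Prod>i<l. 1 - s ^ (m + Suc i))"
  by (induction l) (simp_all add: qpoch_def)

lemma b_part_neq_0: "b_part lam s \<noteq> 0"
  by (auto simp: b_part_def qpoch_neq_0)

text \<open>Writing the number of variables as \<open>m + length lam\<close> makes \<open>m\<close>
  the number of zero parts and avoids truncated subtraction.\<close>

lemma hl_v_part_qpoch:
  "hl_v_part (m + length lam) lam s = qpoch s s m * b_part lam s / (1 - s) ^ (m + length lam)"
proof -
  have "(\<Prod>i\<in>set lam. hl_v (count_list lam i) s) = b_part lam s / (1 - s) ^ length lam"
    by (simp add: hl_v_qpoch b_part_def prod_dividef power_sum[symmetric] sum_count_set)
  then show ?thesis
    by (simp add: hl_v_part_def hl_v_qpoch power_add)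
qed

lemma hl_sym_geometric:
  assumes x: "x \<noteq> 0" and n: "length lam \<le> n"
  shows "hl_sym n lam s (\<lambda>i. x * s ^ i) = x ^ sum_list lam * s ^ n_part lam * hl_v n s / hl_v_part n lam s"
proof -
  let ?g = "\<lambda>w :: nat \<Rightarrow> nat. (\<Prod>i<length lam. (x * s ^ w i) ^ (lam ! i)) *
      (\<Prod>(i, j)\<in>ipairs n. (x * s ^ w i - s * (x * s ^ w j)) / (x * s ^ w i - x * s ^ w j))"
  have "?g w = 0" if w: "w permutes {..<n}" "w \<noteq> id" for w
  proof -
    obtain i j where "i < j" "j < n" "w i = Suc (w j)"
      using permutes_not_id_Suc[OF w] by blast
    then have "(i, j) \<in> ipairs n" "x * s ^ w i - s * (x * s ^ w j) = 0"
      by (auto simp: ipairs_def)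
    then have "(\<Prod>(i, j)\<in>ipairs n. (x * s ^ w i - s * (x * s ^ w j)) / (x * s ^ w i - x * s ^ w j)) = 0"
      by (intro prod_zero[OF finite_ipairs] bexI[of _ "(i, j)"]) simp_all
    then show ?thesis by (simp only: mult_zero_right)
  qed
  then have "(\<Sum>w | w permutes {..<n}. ?g w) = (\<Sum>w\<in>{id}. ?g w)"
    by (intro sum.mono_neutral_right) (auto simp: permutes_id finite_permutations)
  also have "\<dots> = ?g id" by simp
  also have "(\<Prod>i<length lam. (x * s ^ id i) ^ (lam ! i)) = x ^ sum_list lam * s ^ n_part lam"
    by (simp add: power_mult_distrib prod.distrib power_sum[symmetric] power_mult[symmetric]
        n_part_def sum_list_sum_nth atLeast0LessThan)
  also have "(\<Prod>(i, j)\<in>ipairs n. (x * s ^ id i - s * (x * s ^ id j)) / (x * s ^ id i - x * s ^ id j)) =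
      (\<Prod>(i, j)\<in>ipairs n. (s ^ i - s ^ Suc j) / (s ^ i - s ^ j))"
  proof (intro prod.cong refl)
    fix p :: "nat \<times> nat"
    have "(x * s ^ i - s * (x * s ^ j)) / (x * s ^ i - x * s ^ j) = (s ^ i - s ^ Suc j) / (s ^ i - s ^ j)" for i j
    proof -
      have "x * s ^ i - s * (x * s ^ j) = x * (s ^ i - s ^ Suc j)" "x * s ^ i - x * s ^ j = x * (s ^ i - s ^ j)"
        by (simp_all add: algebra_simps)
      then show ?thesis using x by simp
    qed
    then show "(case p of (i, j) \<Rightarrow> (x * s ^ id i - s * (x * s ^ id j)) / (x * s ^ id i - x * s ^ id j)) =
        (case p of (i, j) \<Rightarrow> (s ^ i - s ^ Suc j) / (s ^ i - s ^ j))"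
      by (simp add: case_prod_unfold)
  qed
  finally show ?thesis
    by (simp only: hl_sym_def prod_ipairs_geometric flip: ipairs_def)
qed

text \<open>Compared with the limit, only the quotient of \<open>qpoch s s (m + length lam)\<close>
  by \<open>qpoch s s m\<close> remains; its factors tend to 1 as \<open>m\<close> grows.\<close>

lemma HL_P_fin_geometric:
  assumes x: "x \<noteq> 0"
  shows "HL_P_fin (m + length lam) lam s (\<lambda>i. x * s ^ i) =
    x ^ sum_list lam * s ^ n_part lam / b_part lam s * (\<Prod>i<length lam. 1 - s ^ (m + Suc i))"
proof -
  have "inj_on (\<lambda>i. x * s ^ i) {..<m + length lam}"
    using x by (auto simp: inj_on_def power_eq_iff)
  then have "HL_P_fin (m + length lam) lam s (\<lambda>i. x * s ^ i) =
      x ^ sum_list lam * s ^ n_part lam * hl_v (m + length lam) s / hl_v_part (m + length lam) lam s"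
    using hl_sym_geometric[OF x] by (simp add: HL_P_fin_eq_hl_sym)
  then show ?thesis
    using one_minus_neq_0 qpoch_neq_0[of m]
    by (simp add: hl_v_part_qpoch hl_v_qpoch[of "m + _"] qpoch_add)
qed

text \<open>Principal specialization: among all permutations in the symmetrization only the identity
  contributes, since every other one puts some \<open>k + 1\<close> before \<open>k\<close>.\<close>

lemma HL_P_geometric:
  assumes x: "x \<noteq> 0"
  shows "HL_P lam s (\<lambda>i. x * s ^ i) = x ^ sum_list lam * s ^ n_part lam / b_part lam s"
proof -
  have "(\<lambda>m. s ^ (m + Suc i)) \<longlonglongrightarrow> 0" for i
    using s1 by (intro LIMSEQ_ignore_initial_segment LIMSEQ_abs_realpow_zero2)
  then have "(\<lambda>m. x ^ sum_list lam * s ^ n_part lam / b_part lam s * (\<Prod>i<length lam. 1 - s ^ (m + Suc i)))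
      \<longlonglongrightarrow> x ^ sum_list lam * s ^ n_part lam / b_part lam s * (\<Prod>i<length lam. 1 - 0)"
    by (intro tendsto_intros)
  then have "(\<lambda>m. HL_P_fin (m + length lam) lam s (\<lambda>i. x * s ^ i))
      \<longlonglongrightarrow> x ^ sum_list lam * s ^ n_part lam / b_part lam s"
    by (simp add: HL_P_fin_geometric[OF x])
  then have "(\<lambda>n. HL_P_fin n lam s (\<lambda>i. x * s ^ i)) \<longlonglongrightarrow> x ^ sum_list lam * s ^ n_part lam / b_part lam s"
    by (rule LIMSEQ_offset)
  then show ?thesis
    unfolding HL_P_def by (rule limI)
qed

section \<open>The kernel at geometric sequences\<close>

lemma convergent_prod_one_minus_geometric: "convergent_prod (\<lambda>j. 1 - z * s ^ j)"
proof -
  have "summable (\<lambda>j. norm (1 - z * s ^ j - 1))"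
    using s1 by (simp add: abs_mult power_abs summable_mult summable_geometric)
  then show ?thesis
    by (intro abs_convergent_prod_imp_convergent_prod summable_imp_abs_convergent_prod)
qed

text \<open>The numerator at j is the denominator at j + 1, so the partial products telescope.
  Starting at \<open>M\<close> allows a vanishing denominator to be left behind.\<close>

lemma raw_has_prod_kernel_row:
  assumes "\<And>j. j \<ge> M \<Longrightarrow> z * s ^ j \<noteq> 1"
  shows "raw_has_prod (\<lambda>j. (1 - s * z * s ^ j) / (1 - z * s ^ j)) M (1 / (1 - z * s ^ M))"
proof -
  have "(\<Prod>i\<le>n. (1 - s * z * s ^ (i + M)) / (1 - z * s ^ (i + M))) =
      (1 - z * s ^ (Suc n + M)) / (1 - z * s ^ M)" for n
  proof -
    have "(\<Prod>i\<le>n. (1 - z * s ^ (Suc i + M)) / (1 - z * s ^ (i + M))) = (1 - z * s ^ (Suc n + M)) / (1 - z * s ^ (0 + M))"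
      unfolding lessThan_Suc_atMost[symmetric]
      by (rule prod_lessThan_telescope) (use assms in auto)
    then show ?thesis by (simp add: mult_ac)
  qed
  moreover have "(\<lambda>n. (1 - z * s ^ (n + Suc M)) / (1 - z * s ^ M)) \<longlonglongrightarrow> (1 - z * 0) / (1 - z * s ^ M)"
    using s1 assms
    by (intro tendsto_intros LIMSEQ_ignore_initial_segment LIMSEQ_abs_realpow_zero2) auto
  ultimately show ?thesis
    using assms by (simp add: raw_has_prod_def)
qed

text \<open>If a denominator vanishes, its term is 0 as a division by zero. The powers of
  \<open>s\<close> being distinct, all later denominators are nonzero, so the product still
  converges, to 0.\<close>

lemma kernel_row:
  "(\<Prod>j. (1 - s * z * s ^ j) / (1 - z * s ^ j)) = (if \<exists>j. z * s ^ j = 1 then 0 else 1 / (1 - z))"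
proof (cases "\<exists>j. z * s ^ j = 1")
  case True
  then obtain j where j: "z * s ^ j = 1" by blast
  have "z * s ^ i \<noteq> 1" if "i \<ge> Suc j" for i
  proof
    assume "z * s ^ i = 1"
    with j have "z * s ^ i = z * s ^ j" "z \<noteq> 0" by auto
    with that show False by (simp add: power_eq_iff)
  qed
  then have "raw_has_prod (\<lambda>j. (1 - s * z * s ^ j) / (1 - z * s ^ j)) (Suc j) (1 / (1 - z * s ^ Suc j))"
    by (rule raw_has_prod_kernel_row)
  then have "(\<lambda>j. (1 - s * z * s ^ j) / (1 - z * s ^ j)) has_prod 0"
    unfolding has_prod_def using j by auto
  then show ?thesis
    using True has_prod_unique by fastforce
next
  case False
  then have "(\<lambda>j. (1 - s * z * s ^ j) / (1 - z * s ^ j)) has_prod (1 / (1 - z))"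
    using raw_has_prod_kernel_row[of 0 z] by (simp add: has_prod_def)
  then show ?thesis
    using False has_prod_unique by fastforce
qed

text \<open>Row i of the kernel is \<open>kernel_row\<close> at \<open>x * s ^ i\<close>. If
  \<open>x * s ^ j = 1\<close> for some j, both sides are 0: the kernel has the zero row j, so the
  quotient is a division by zero, and the right side has the zero factor j.\<close>

lemma divide_HL_Pi_geometric:
  "c / HL_Pi s (\<lambda>i. x * s ^ i) (\<lambda>j. s ^ j) = c * (\<Prod>j. 1 - x * s ^ j)"
proof -
  let ?r = "\<lambda>i. if \<exists>j. x * s ^ (i + j) = 1 then 0 else 1 / (1 - x * s ^ i)"
  have Pi: "HL_Pi s (\<lambda>i. x * s ^ i) (\<lambda>j. s ^ j) = (\<Prod>i. ?r i)"
    using kernel_row[of "x * s ^ _"] by (simp only: HL_Pi_def power_add mult.assoc)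
  show ?thesis
  proof (cases "\<exists>j. x * s ^ j = 1")
    case False
    then have "?r = (\<lambda>i. inverse (1 - x * s ^ i))"
      by (auto simp: inverse_eq_divide)
    then show ?thesis
      using prodinf_inverse[OF convergent_prod_one_minus_geometric[of x]] Pi
      by (simp add: divide_inverse)
  next
    case True
    then obtain j where j: "x * s ^ j = 1" by blast
    have 0: "(\<Prod>j. 1 - x * s ^ j) = 0"
      using convergent_prod_has_prod[OF convergent_prod_one_minus_geometric[of x]] j
      by (auto simp: has_prod_eq_0_iff image_iff intro!: exI[of _ j])
    have ne: "x * s ^ i \<noteq> 1" if "i \<ge> Suc j" for i
    proof
      assume "x * s ^ i = 1"
      with j have "x * s ^ i = x * s ^ j" "x \<noteq> 0" by auto
      with that show False by (simp add: power_eq_iff)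
    qed
    \<comment> \<open>A zero factor yields the value 0 only for a convergent product; convergence is
      checked on the rows after j.\<close>
    have "convergent_prod (\<lambda>i. inverse (1 - x * s ^ Suc j * s ^ i))"
      unfolding convergent_prod_inverse_iff by (rule convergent_prod_one_minus_geometric)
    then have "convergent_prod (\<lambda>i. ?r (i + Suc j))"
    proof (rule back_subst[of convergent_prod], intro ext)
      fix i
      have "x * s ^ (i + Suc j + k) \<noteq> 1" for k by (rule ne) simp
      then show "inverse (1 - x * s ^ Suc j * s ^ i) = ?r (i + Suc j)"
        by (simp add: inverse_eq_divide power_add mult_ac)
    qed
    then have "convergent_prod ?r"
      using convergent_prod_iff_shift by blast
    then have r: "?r has_prod (\<Prod>i. ?r i)"
      by (rule convergent_prod_has_prod)
    have "\<exists>k. x * s ^ (j + k) = 1"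
      by (rule exI[of _ 0]) (simp add: j)
    then have "0 = ?r j" by simp
    then have "0 \<in> range ?r" by (rule range_eqI)
    then have "(\<Prod>i. ?r i) = 0"
      using has_prod_eq_0_iff[OF r] by simp
    with 0 Pi show ?thesis by simp
  qed
qed

text \<open>In \<open>HL_Q\<close> the factor \<open>b_part\<close> cancels the denominator of the
  specialization with first term 1, leaving \<open>s ^ n_part lam\<close>; the \<open>b_part\<close>
  from \<open>HL_P\<close> survives.\<close>

lemma HL_measure_geometric:
  assumes "x \<noteq> 0"
  shows "HL_P lam s (\<lambda>i. x * s ^ i) * HL_Q lam s (\<lambda>j. s ^ j) / HL_Pi s (\<lambda>i. x * s ^ i) (\<lambda>j. s ^ j) =
    x ^ sum_list lam * s ^ (2 * n_part lam) / b_part lam s * (\<Prod>j. 1 - x * s ^ j)"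
proof -
  have "HL_Q lam s (\<lambda>j. s ^ j) = s ^ n_part lam"
    using HL_P_geometric[of 1 lam] b_part_neq_0 by (simp add: HL_Q_def)
  then show ?thesis
    unfolding divide_HL_Pi_geometric HL_P_geometric[OF assms]
    by (simp add: mult_2 power_add)
qed

end

section \<open>Counting modulo a subgroup\<close>

definition add_subgroup :: "'g::ab_group_add set \<Rightarrow> bool" where
  "add_subgroup Y \<longleftrightarrow> 0 \<in> Y \<and> (\<forall>x\<in>Y. \<forall>y\<in>Y. x - y \<in> Y)"

definition rep :: "'g::ab_group_add set \<Rightarrow> 'g \<Rightarrow> 'g" where
  "rep Y x = (SOME z. z - x \<in> Y)"

definition reps :: "'g::ab_group_add set \<Rightarrow> 'g set" where
  "reps Y = range (rep Y)"

text \<open>For a union \<open>S\<close> of cosets of \<open>Y\<close> this is the number of these cosets.\<close>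

definition cnt :: "'g::ab_group_add set \<Rightarrow> 'g set \<Rightarrow> nat" where
  "cnt Y S = card (S \<inter> reps Y)"

definition saturated :: "'g::ab_group_add set \<Rightarrow> 'g set \<Rightarrow> bool" where
  "saturated Y S \<longleftrightarrow> (\<forall>x\<in>S. \<forall>y. y - x \<in> Y \<longrightarrow> y \<in> S)"

lemma saturatedD: "saturated Y S \<Longrightarrow> x \<in> S \<Longrightarrow> y - x \<in> Y \<Longrightarrow> y \<in> S"
  by (auto simp: saturated_def)

lemma add_subgroup_0: "add_subgroup Y \<Longrightarrow> 0 \<in> Y"
  and add_subgroup_diff: "add_subgroup Y \<Longrightarrow> x \<in> Y \<Longrightarrow> y \<in> Y \<Longrightarrow> x - y \<in> Y"
  by (auto simp: add_subgroup_def)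

lemma add_subgroup_uminus: "add_subgroup Y \<Longrightarrow> x \<in> Y \<Longrightarrow> - x \<in> Y"
  using add_subgroup_diff[of Y 0 x] add_subgroup_0[of Y] by simp

lemma add_subgroup_add: "add_subgroup Y \<Longrightarrow> x \<in> Y \<Longrightarrow> y \<in> Y \<Longrightarrow> x + y \<in> Y"
  using add_subgroup_diff[of Y x "- y"] add_subgroup_uminus[of Y y] by simp

lemma add_subgroup_sum:
  "add_subgroup Y \<Longrightarrow> (\<And>i. i \<in> A \<Longrightarrow> f i \<in> Y) \<Longrightarrow> (\<Sum>i\<in>A. f i) \<in> Y"
  by (induction A rule: infinite_finite_induct) (auto simp: add_subgroup_0 add_subgroup_add)

lemma add_subgroup_comm: "add_subgroup Y \<Longrightarrow> x - y \<in> Y \<Longrightarrow> y - x \<in> Y"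
  using add_subgroup_uminus[of Y "x - y"] by simp

lemma add_subgroup_trans: "add_subgroup Y \<Longrightarrow> x - y \<in> Y \<Longrightarrow> y - z \<in> Y \<Longrightarrow> x - z \<in> Y"
  using add_subgroup_add[of Y "x - y" "y - z"] by simp

lemma add_subgroup_mem_cong: "add_subgroup Y \<Longrightarrow> x - y \<in> Y \<Longrightarrow> x \<in> Y \<longleftrightarrow> y \<in> Y"
  using add_subgroup_add[of Y "x - y" y] add_subgroup_diff[of Y x "x - y"] by auto

lemma saturated_subgroup:
  "add_subgroup S \<Longrightarrow> Y \<subseteq> S \<Longrightarrow> saturated Y S"
  by (metis add_subgroup_mem_cong saturated_def subset_eq)

lemma rep_diff: "add_subgroup Y \<Longrightarrow> rep Y x - x \<in> Y"
  unfolding rep_def by (rule someI[of _ x]) (simp add: add_subgroup_0)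

text \<open>Congruent elements define the same predicate under the choice in \<open>rep\<close>, so
  the representative depends on the coset only.\<close>

lemma rep_eq_iff:
  assumes Y: "add_subgroup Y"
  shows "rep Y x = rep Y y \<longleftrightarrow> x - y \<in> Y"
proof
  assume "rep Y x = rep Y y"
  then show "x - y \<in> Y"
    using add_subgroup_diff[OF Y rep_diff[OF Y, of y] rep_diff[OF Y, of x]] by simp
next
  assume *: "x - y \<in> Y"
  have "(z - x \<in> Y) = (z - y \<in> Y)" for z
    by (rule add_subgroup_mem_cong[OF Y]) (simp add: add_subgroup_comm[OF Y *])
  then show "rep Y x = rep Y y"
    by (simp add: rep_def)
qed

lemma rep_in_reps [simp]: "rep Y x \<in> reps Y"
  by (simp add: reps_def)

lemma rep_reps: "add_subgroup Y \<Longrightarrow> x \<in> reps Y \<Longrightarrow> rep Y x = x"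
  by (auto simp: reps_def rep_eq_iff rep_diff)

lemma reps_eq:
  assumes Y: "add_subgroup Y" and "x \<in> reps Y" "y \<in> reps Y" "x - y \<in> Y"
  shows "x = y"
proof -
  have "rep Y x = rep Y y" using assms by (simp only: rep_eq_iff)
  then show ?thesis using assms by (simp only: rep_reps)
qed

lemma rep_mem_iff:
  assumes Y: "add_subgroup Y" and S: "saturated Y S"
  shows "rep Y x \<in> S \<longleftrightarrow> x \<in> S"
proof
  assume "rep Y x \<in> S"
  then show "x \<in> S" by (rule saturatedD[OF S _ add_subgroup_comm[OF Y rep_diff[OF Y]]])
next
  assume "x \<in> S"
  then show "rep Y x \<in> S" by (rule saturatedD[OF S _ rep_diff[OF Y]])
qed

lemma cnt_self:
  assumes Y: "add_subgroup Y"
  shows "cnt Y Y = 1"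
proof -
  have 0: "rep Y 0 \<in> Y" using rep_diff[OF Y, of 0] by simp
  moreover have "x = rep Y 0" if "x \<in> Y" "x \<in> reps Y" for x
    by (rule reps_eq[OF Y that(2) rep_in_reps add_subgroup_diff[OF Y that(1) 0]])
  ultimately have "Y \<inter> reps Y = {rep Y 0}" by (blast intro: rep_in_reps)
  then show ?thesis by (simp add: cnt_def)
qed

lemma saturated_eqI:
  assumes "add_subgroup Y" "saturated Y S" "saturated Y T" "S \<inter> reps Y = T \<inter> reps Y"
  shows "S = T"
proof -
  have "x \<in> S \<longleftrightarrow> x \<in> T" for x
    using rep_mem_iff[OF assms(1,2), of x] rep_mem_iff[OF assms(1,3), of x] assms(4) rep_in_reps[of Y x]
    by blast
  then show ?thesis by blast
qed

text \<open>The equivalence \<open>inj\<close> says at once that \<open>f\<close> is well defined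
  and injective on cosets. Translations, which are not additive, are thereby covered.\<close>

lemma bij_betw_reps:
  assumes Y: "add_subgroup Y" and Z: "add_subgroup Z" and S: "saturated Y S" and T: "saturated Z T"
    and f: "\<And>x. x \<in> S \<Longrightarrow> f x \<in> T"
    and inj: "\<And>x y. x \<in> S \<Longrightarrow> y \<in> S \<Longrightarrow> f x - f y \<in> Z \<longleftrightarrow> x - y \<in> Y"
    and surj: "\<And>c. c \<in> T \<Longrightarrow> \<exists>x\<in>S. f x - c \<in> Z"
  shows "bij_betw (\<lambda>x. rep Z (f x)) (S \<inter> reps Y) (T \<inter> reps Z)"
proof (rule bij_betwI')
  fix x y assume "x \<in> S \<inter> reps Y" "y \<in> S \<inter> reps Y"
  then show "rep Z (f x) = rep Z (f y) \<longleftrightarrow> x = y"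
    using inj[of x y] reps_eq[OF Y, of x y] add_subgroup_0[OF Y]
    by (auto simp: rep_eq_iff[OF Z])
next
  fix x assume "x \<in> S \<inter> reps Y"
  then show "rep Z (f x) \<in> T \<inter> reps Z"
    using f rep_mem_iff[OF Z T] rep_in_reps by auto
next
  fix c assume c: "c \<in> T \<inter> reps Z"
  then obtain x where x: "x \<in> S" "f x - c \<in> Z" using surj by auto
  have "rep Y x \<in> S" using x rep_mem_iff[OF Y S] by simp
  moreover have "f (rep Y x) - f x \<in> Z"
    using inj[OF \<open>rep Y x \<in> S\<close> x(1)] rep_diff[OF Y] by simp
  then have "f (rep Y x) - c \<in> Z"
    using x(2) add_subgroup_trans[OF Z] by blast
  then have "rep Z (f (rep Y x)) = c"
    using rep_eq_iff[OF Z, of "f (rep Y x)" c] rep_reps[OF Z, of c] c by simp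
  ultimately show "\<exists>x\<in>S \<inter> reps Y. c = rep Z (f x)"
    by (intro bexI[of _ "rep Y x"]) auto
qed

lemma cnt_cong:
  assumes "add_subgroup Y" "add_subgroup Z" "saturated Y S" "saturated Z T"
    and "\<And>x. x \<in> S \<Longrightarrow> f x \<in> T"
    and "\<And>x y. x \<in> S \<Longrightarrow> y \<in> S \<Longrightarrow> f x - f y \<in> Z \<longleftrightarrow> x - y \<in> Y"
    and "\<And>c. c \<in> T \<Longrightarrow> \<exists>x\<in>S. f x - c \<in> Z"
  shows "cnt Y S = cnt Z T"
  unfolding cnt_def using bij_betw_reps[OF assms] by (rule bij_betw_same_card)

lemma cnt_translate:
  assumes Y: "add_subgroup Y" and S: "saturated Y S" and T: "saturated Y T" and ST: "\<And>x. x \<in> S \<longleftrightarrow> a + x \<in> T"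
  shows "cnt Y S = cnt Y T"
proof (rule cnt_cong[OF Y Y S T, of "\<lambda>x. a + x"])
  show "\<exists>x\<in>S. a + x - c \<in> Y" if "c \<in> T" for c
    using that ST[of "c - a"] add_subgroup_0[OF Y] by (intro bexI[of _ "c - a"]) auto
qed (use ST in auto)

text \<open>The homomorphism theorem as a bijection: with a chosen preimage \<open>s c\<close>
  modulo \<open>Z\<close> for each value c, the pair of a kernel element x and a value c goes to the
  coset of x + s c.\<close>

lemma bij_betw_reps_hom:
  assumes Y: "add_subgroup Y" and Z: "add_subgroup Z" and S: "add_subgroup S" "Y \<subseteq> S" and T: "add_subgroup T" "Z \<subseteq> T"
    and f: "\<And>x. x \<in> S \<Longrightarrow> f x \<in> T"
    and diff: "\<And>x y. x \<in> S \<Longrightarrow> y \<in> S \<Longrightarrow> f (x - y) = f x - f y"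
    and fY: "\<And>x. x \<in> Y \<Longrightarrow> f x \<in> Z"
    and surj: "\<And>c. c \<in> T \<Longrightarrow> \<exists>x\<in>S. f x - c \<in> Z"
  shows "\<exists>h. bij_betw h (({x\<in>S. f x \<in> Z} \<inter> reps Y) \<times> (T \<inter> reps Z)) (S \<inter> reps Y)"
proof -
  obtain s where s: "\<And>c. c \<in> T \<Longrightarrow> s c \<in> S \<and> f (s c) - c \<in> Z"
    using surj by metis
  note Sadd = add_subgroup_add[OF S(1)]
  have satS: "saturated Y S" using S by (rule saturated_subgroup)
  have satT: "saturated Z T" using T by (rule saturated_subgroup)
  have add: "f (x + y) = f x + f y" if "x \<in> S" "y \<in> S" for x y
    using diff[of "x + y" y] Sadd[of x y] that by (simp add: algebra_simps)
  define h where "h p = rep Y (fst p + s (snd p))" for p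
  have "bij_betw h (({x\<in>S. f x \<in> Z} \<inter> reps Y) \<times> (T \<inter> reps Z)) (S \<inter> reps Y)"
  proof (rule bij_betw_imageI)
    show "inj_on h (({x\<in>S. f x \<in> Z} \<inter> reps Y) \<times> (T \<inter> reps Z))"
    proof (rule inj_onI, clarsimp)
      fix x c y d
      assume xy: "h (x, c) = h (y, d)" "x \<in> S" "f x \<in> Z" "x \<in> reps Y" "y \<in> S" "f y \<in> Z" "y \<in> reps Y"
        and cd: "c \<in> T" "c \<in> reps Z" "d \<in> T" "d \<in> reps Z"
      have *: "x + s c - (y + s d) \<in> Y"
        using xy(1) by (simp add: h_def rep_eq_iff[OF Y])
      have "f (x + s c) - f (y + s d) \<in> Z"
        using fY[OF *] diff[of "x + s c" "y + s d"] xy cd s by (simp add: Sadd)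
      then have "f x + f (s c) - (f y + f (s d)) \<in> Z"
        using xy cd s by (simp add: add)
      then have "f (s c) - f (s d) \<in> Z"
        using add_subgroup_diff[OF Z _ add_subgroup_diff[OF Z xy(3,6)]] by fastforce
      moreover have "f (s c) - c \<in> Z" "f (s d) - d \<in> Z"
        using s cd by auto
      ultimately have "(f (s c) - f (s d)) - (f (s c) - c) + (f (s d) - d) \<in> Z"
        using add_subgroup_add[OF Z add_subgroup_diff[OF Z]] by blast
      then have "c - d \<in> Z" by simp
      then have "c = d" using cd reps_eq[OF Z] by blast
      then have "x - y \<in> Y" using * by simp
      then show "x = y \<and> c = d" using reps_eq[OF Y xy(4,7)] \<open>c = d\<close> by simp
    qed
    have "x \<in> h ` (({x\<in>S. f x \<in> Z} \<inter> reps Y) \<times> (T \<inter> reps Z))" if x: "x \<in> S" "x \<in> reps Y" for x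
    proof -
      define c where "c = rep Z (f x)"
      have c: "c \<in> T" "c - f x \<in> Z" "c \<in> reps Z"
        using f[OF x(1)] rep_mem_iff[OF Z satT] rep_diff[OF Z] rep_in_reps
        by (auto simp: c_def)
      define k where "k = rep Y (x - s c)"
      have sc: "s c \<in> S" "f (s c) - c \<in> Z" using s c by auto
      have xs: "x - s c \<in> S" using x sc S by (auto intro: add_subgroup_diff)
      have kd: "k - (x - s c) \<in> Y" by (simp add: k_def rep_diff[OF Y])
      have kS: "k \<in> S" "k \<in> reps Y"
        using xs rep_mem_iff[OF Y satS] by (auto simp: k_def)
      have "f (x - s c) \<in> Z"
        using diff[OF x(1) sc(1)] add_subgroup_uminus[OF Z add_subgroup_add[OF Z c(2) sc(2)]] by simp
      moreover have "f k - f (x - s c) \<in> Z"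
        using fY[OF kd] diff[OF kS(1) xs] by simp
      ultimately have "f k \<in> Z"
        using add_subgroup_mem_cong[OF Z] by blast
      moreover have "h (k, c) = rep Y x"
        using kd by (simp add: h_def rep_eq_iff[OF Y] algebra_simps)
      ultimately show ?thesis
        using kS c x by (intro image_eqI[of _ _ "(k, c)"]) (auto simp: rep_reps[OF Y])
    qed
    moreover have "h ` (({x\<in>S. f x \<in> Z} \<inter> reps Y) \<times> (T \<inter> reps Z)) \<subseteq> S \<inter> reps Y"
      using s Sadd rep_mem_iff[OF Y satS] by (auto simp: h_def)
    ultimately show "h ` (({x\<in>S. f x \<in> Z} \<inter> reps Y) \<times> (T \<inter> reps Z)) = S \<inter> reps Y"
      by blast
  qed
  then show ?thesis by blast
qed

lemma cnt_hom:
  assumes "add_subgroup Y" "add_subgroup Z" "add_subgroup S" "Y \<subseteq> S" "add_subgroup T" "Z \<subseteq> T"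
    and "\<And>x. x \<in> S \<Longrightarrow> f x \<in> T"
    and "\<And>x y. x \<in> S \<Longrightarrow> y \<in> S \<Longrightarrow> f (x - y) = f x - f y"
    and "\<And>x. x \<in> Y \<Longrightarrow> f x \<in> Z"
    and "\<And>c. c \<in> T \<Longrightarrow> \<exists>x\<in>S. f x - c \<in> Z"
  shows "cnt Y S = cnt Y {x\<in>S. f x \<in> Z} * cnt Z T"
proof -
  obtain h where "bij_betw h (({x\<in>S. f x \<in> Z} \<inter> reps Y) \<times> (T \<inter> reps Z)) (S \<inter> reps Y)"
    using bij_betw_reps_hom[OF assms] by blast
  from bij_betw_same_card[OF this] show ?thesis
    by (simp add: cnt_def card_cartesian_product)
qed

text \<open>A nonempty fibre is the translate of the kernel by the given preimage
  \<open>a\<close>.\<close>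

lemma cnt_fiber:
  assumes Y: "add_subgroup Y" and Z: "add_subgroup Z" and S: "add_subgroup S" "Y \<subseteq> S"
    and diff: "\<And>x y. x \<in> S \<Longrightarrow> y \<in> S \<Longrightarrow> f (x - y) = f x - f y"
    and fY: "\<And>x. x \<in> Y \<Longrightarrow> f x \<in> Z"
    and a: "a \<in> S" "f a - c \<in> Z"
  shows "cnt Y {x\<in>S. f x - c \<in> Z} = cnt Y {x\<in>S. f x \<in> Z}"
proof -
  have satS: "saturated Y S" using S by (rule saturated_subgroup)
  have sat: "saturated Y {x\<in>S. f x - c \<in> Z}" for c
    unfolding saturated_def
  proof clarsimp
    fix x y assume x: "x \<in> S" "f x - c \<in> Z" and yx: "y - x \<in> Y"
    then have y: "y \<in> S" using satS saturatedD by blast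
    have "(f y - f x) + (f x - c) \<in> Z"
      using fY[OF yx] diff[OF y x(1)] x(2) by (intro add_subgroup_add[OF Z]) auto
    with y show "y \<in> S \<and> f y - c \<in> Z" by simp
  qed
  have "(x \<in> S \<and> f x - 0 \<in> Z) \<longleftrightarrow> (a + x \<in> S \<and> f (a + x) - c \<in> Z)" for x
  proof -
    have "a + x \<in> S \<longleftrightarrow> x \<in> S"
      using add_subgroup_add[OF S(1) a(1), of x] add_subgroup_diff[OF S(1) _ a(1), of "a + x"] by auto
    moreover have "f (a + x) - c \<in> Z \<longleftrightarrow> f x \<in> Z" if "x \<in> S"
    proof (rule add_subgroup_mem_cong[OF Z])
      have "f (a + x) = f a + f x"
        using diff[of "a + x" x] that \<open>a + x \<in> S \<longleftrightarrow> x \<in> S\<close> by (simp add: algebra_simps)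
      with a(2) show "f (a + x) - c - f x \<in> Z" by (simp add: algebra_simps)
    qed
    ultimately show ?thesis by auto
  qed
  then have "cnt Y {x\<in>S. f x - 0 \<in> Z} = cnt Y {x\<in>S. f x - c \<in> Z}"
    by (intro cnt_translate[OF Y sat sat, where a = a]) simp
  then show ?thesis by simp
qed

lemma card_eq_sum_fibers:
  assumes "finite A" "finite B" "f ` A \<subseteq> B"
  shows "card A = (\<Sum>b\<in>B. card {a\<in>A. f a = b})"
proof -
  have "A = (\<Union>b\<in>B. {a\<in>A. f a = b})" using assms by auto
  then have "card A = card (\<Union>b\<in>B. {a\<in>A. f a = b})" by simp
  also have "\<dots> = (\<Sum>b\<in>B. card {a\<in>A. f a = b})"
    by (rule card_UN_disjoint) (use assms in auto)
  finally show ?thesis .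
qed


section \<open>Valuation ideals\<close>

locale uniformized_field = nonarch_local_field v for v :: "'a::field \<Rightarrow> int" +
  fixes \<pi> :: 'a
  assumes pi_neq_0 [simp]: "\<pi> \<noteq> 0" and v_pi: "v \<pi> = 1"
begin

definition ipow :: "nat \<Rightarrow> 'a set" where
  "ipow k = pp v (int k)"

definition Q :: nat where
  "Q = card (carrier (residue_field v))"

lemma v_one: "v 1 = 0"
  using v_mult[of 1 1] by simp

lemma v_minus_one: "v (- 1) = 0"
  using v_mult[of "- 1" "- 1"] v_one by simp

lemma v_uminus: "v (- x) = v x"
  using v_mult[of "- 1" x] v_minus_one by (cases "x = 0") auto

lemma v_inverse: "x \<noteq> 0 \<Longrightarrow> v (inverse x) = - v x"
  using v_mult[of x "inverse x"] v_one by simp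

lemma v_power: "x \<noteq> 0 \<Longrightarrow> v (x ^ k) = int k * v x"
  by (induction k) (auto simp: v_one v_mult algebra_simps)

lemma v_pi_power: "v (\<pi> ^ k) = int k"
  by (simp add: v_power v_pi)

lemma ipow_0 [simp]: "0 \<in> ipow k"
  by (simp add: ipow_def pp_def)

lemma ipow_add: "x \<in> ipow k \<Longrightarrow> y \<in> ipow k \<Longrightarrow> x + y \<in> ipow k"
  using v_add[of x y] by (cases "x = 0 \<or> y = 0 \<or> x + y = 0") (auto simp: ipow_def pp_def)

lemma ipow_uminus [simp]: "- x \<in> ipow k \<longleftrightarrow> x \<in> ipow k"
  by (simp add: ipow_def pp_def v_uminus)

lemma ipow_diff: "x \<in> ipow k \<Longrightarrow> y \<in> ipow k \<Longrightarrow> x - y \<in> ipow k"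
  using ipow_add[of x k "- y"] by simp

lemma subgroup_ipow [simp]: "add_subgroup (ipow k)"
  by (simp add: add_subgroup_def ipow_diff)

lemmas ipow_sum = add_subgroup_sum[OF subgroup_ipow]
  and ipow_comm = add_subgroup_comm[OF subgroup_ipow]
  and ipow_trans = add_subgroup_trans[OF subgroup_ipow]
  and ipow_cong = add_subgroup_mem_cong[OF subgroup_ipow]

lemma ipow_mult: "x \<in> ipow j \<Longrightarrow> y \<in> ipow k \<Longrightarrow> x * y \<in> ipow (j + k)"
  by (cases "x = 0 \<or> y = 0") (auto simp: ipow_def pp_def v_mult)

lemma ipow_multl: "x \<in> ipow 0 \<Longrightarrow> y \<in> ipow k \<Longrightarrow> x * y \<in> ipow k"
  using ipow_mult[of x 0 y k] by simp

lemma ipow_multr: "x \<in> ipow k \<Longrightarrow> y \<in> ipow 0 \<Longrightarrow> x * y \<in> ipow k"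
  using ipow_mult[of x k y 0] by simp

lemma ipow_mono: "j \<le> k \<Longrightarrow> x \<in> ipow k \<Longrightarrow> x \<in> ipow j"
  by (auto simp: ipow_def pp_def)

lemma ipow_1 [simp]: "1 \<in> ipow 0"
  by (simp add: ipow_def pp_def v_one)

lemma one_notin_ipow [simp]: "0 < k \<Longrightarrow> 1 \<notin> ipow k"
  by (simp add: ipow_def pp_def v_one)

lemma pi_power_ipow [simp]: "\<pi> ^ k \<in> ipow k"
  by (simp add: ipow_def pp_def v_pi_power)

lemma pi_mult_ipow_iff [simp]: "\<pi> ^ k * x \<in> ipow (k + j) \<longleftrightarrow> x \<in> ipow j"
  by (cases "x = 0") (auto simp: ipow_def pp_def v_mult v_pi_power)

lemma ipow_iff: "x \<in> ipow k \<longleftrightarrow> (\<exists>y\<in>ipow 0. x = \<pi> ^ k * y)"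
proof
  assume "x \<in> ipow k"
  then have "\<pi> ^ k * (x / \<pi> ^ k) \<in> ipow (k + 0)" by simp
  then have "x / \<pi> ^ k \<in> ipow 0" by (simp only: pi_mult_ipow_iff)
  then show "\<exists>y\<in>ipow 0. x = \<pi> ^ k * y" by (intro bexI[of _ "x / \<pi> ^ k"]) auto
qed (use pi_mult_ipow_iff[of k _ 0] in auto)

lemma div_pi_ipow_iff: "x / \<pi> ^ k \<in> ipow 0 \<longleftrightarrow> x \<in> ipow k"
  using pi_mult_ipow_iff[of k "x / \<pi> ^ k" 0] by simp

lemma ipow_power: "x \<in> ipow 0 \<Longrightarrow> x ^ n \<in> ipow 0"
  by (induction n) (auto intro: ipow_multl)

lemma unit_neq_0: "x \<notin> ipow k \<Longrightarrow> x \<noteq> 0"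
  by auto

lemma unit_iff: "x \<in> ipow 0 \<and> x \<notin> ipow 1 \<longleftrightarrow> x \<noteq> 0 \<and> v x = 0"
  by (auto simp: ipow_def pp_def)

lemma unit_inverse: "x \<in> ipow 0 \<Longrightarrow> x \<notin> ipow 1 \<Longrightarrow> inverse x \<in> ipow 0"
  using unit_iff[of x] v_inverse[of x] by (simp add: ipow_def pp_def)

lemma unit_inverse': "x \<in> ipow 0 \<Longrightarrow> x \<notin> ipow 1 \<Longrightarrow> inverse x \<notin> ipow 1"
  using unit_iff[of x] v_inverse[of x] by (simp add: ipow_def pp_def)

lemma unit_mult_ipow_iff: "x \<in> ipow 0 \<Longrightarrow> x \<notin> ipow 1 \<Longrightarrow> x * y \<in> ipow k \<longleftrightarrow> y \<in> ipow k"
  using unit_iff[of x] v_mult[of x y] by (cases "y = 0") (auto simp: ipow_def pp_def)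

lemma unit_cong: "x - y \<in> ipow 1 \<Longrightarrow> x \<in> ipow 1 \<longleftrightarrow> y \<in> ipow 1"
  by (rule ipow_cong)

lemma ipow_Inter: "(\<And>k. x \<in> ipow k) \<Longrightarrow> x = 0"
  by (rule ccontr, drule meta_spec[of _ "nat (v x + 1)"]) (auto simp: ipow_def pp_def split: if_splits)

lemma exists_pi_power_mult: "\<exists>k. \<pi> ^ k * x \<in> ipow 0"
  by (cases "x = 0", simp, rule exI[of _ "nat (- v x)"]) (auto simp: ipow_def pp_def v_mult v_pi_power)

lemma carrier_int_ring: "carrier (int_ring v) = ipow 0"
  by (simp add: int_ring_def ipow_def)

lemma int_ring_coset: "pp v k +>\<^bsub>int_ring v\<^esub> a = {z. z - a \<in> pp v k}"
proof -
  have "z \<in> pp v k +>\<^bsub>int_ring v\<^esub> a \<longleftrightarrow> z - a \<in> pp v k" for z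
    by (auto simp: a_r_coset_def r_coset_def int_ring_def intro: bexI[of _ "z - a"])
  then show ?thesis by auto
qed

lemma coset_eq_iff: "{z. z - a \<in> ipow k} = {z. z - b \<in> ipow k} \<longleftrightarrow> a - b \<in> ipow k"
proof
  assume "{z. z - a \<in> ipow k} = {z. z - b \<in> ipow k}"
  moreover have "a \<in> {z. z - a \<in> ipow k}" by simp
  ultimately show "a - b \<in> ipow k" by simp
next
  assume "a - b \<in> ipow k"
  then show "{z. z - a \<in> ipow k} = {z. z - b \<in> ipow k}"
    using ipow_trans ipow_comm by blast
qed

lemma carrier_cyc: "carrier (cyc v k) = (\<lambda>a. {z. z - a \<in> ipow k}) ` ipow 0"
  by (auto simp: cyc_def FactRing_def A_RCOSETS_def' carrier_int_ring int_ring_coset ipow_def)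

text \<open>Links the residue field, whose elements are cosets, to the counting of
  representatives.\<close>

lemma card_cosets:
  assumes Y: "add_subgroup Y" and S: "saturated Y S"
  shows "card ((\<lambda>a. {z. z - a \<in> Y}) ` S) = cnt Y S"
proof -
  have eq: "{z. z - a \<in> Y} = {z. z - b \<in> Y}" if ab: "a - b \<in> Y" for a b
    using add_subgroup_trans[OF Y _ ab] add_subgroup_trans[OF Y _ add_subgroup_comm[OF Y ab]] by blast
  have inj: "inj_on (\<lambda>a. {z. z - a \<in> Y}) (S \<inter> reps Y)"
  proof (rule inj_onI)
    fix a b assume ab: "a \<in> S \<inter> reps Y" "b \<in> S \<inter> reps Y" "{z. z - a \<in> Y} = {z. z - b \<in> Y}"
    have "a \<in> {z. z - a \<in> Y}" by (simp add: add_subgroup_0[OF Y])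
    then have "a - b \<in> Y" unfolding ab(3) by simp
    with ab show "a = b" using reps_eq[OF Y] by blast
  qed
  have "(\<lambda>a. {z. z - a \<in> Y}) ` S = (\<lambda>a. {z. z - a \<in> Y}) ` (S \<inter> reps Y)"
  proof (intro subset_antisym image_subsetI)
    fix a assume "a \<in> S"
    then have "rep Y a \<in> S \<inter> reps Y" by (simp add: rep_mem_iff[OF Y S])
    moreover have "{z. z - a \<in> Y} = {z. z - rep Y a \<in> Y}"
      by (rule eq) (rule add_subgroup_comm[OF Y rep_diff[OF Y]])
    ultimately show "{z. z - a \<in> Y} \<in> (\<lambda>a. {z. z - a \<in> Y}) ` (S \<inter> reps Y)"
      by (rule rev_image_eqI)
  qed blast
  then show ?thesis
    by (simp add: card_image[OF inj] cnt_def)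
qed

lemma saturated_ipow: "j \<le> k \<Longrightarrow> saturated (ipow k) (ipow j)"
  by (rule saturated_subgroup) (auto intro: ipow_mono)

lemma cnt_residue: "cnt (ipow 1) (ipow 0) = Q"
  using card_cosets[OF subgroup_ipow saturated_ipow, of 0 1] carrier_cyc[of 1]
  by (simp add: Q_def cyc_def)

lemma Q_ge_2: "2 \<le> Q"
proof -
  let ?f = "\<lambda>a. {z. z - a \<in> ipow 1}"
  have fin: "finite (?f ` ipow 0)"
    using finite_residue_field carrier_cyc[of 1] by (simp add: cyc_def)
  have "?f 0 \<noteq> ?f 1"
    unfolding coset_eq_iff by simp
  then have "2 = card {?f 0, ?f 1}" using card_2_iff by metis
  also have "{?f 0, ?f 1} \<subseteq> ?f ` ipow 0" by (blast intro: ipow_0 ipow_1)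
  then have "card {?f 0, ?f 1} \<le> card (?f ` ipow 0)" by (rule card_mono[OF fin])
  finally show ?thesis
    using carrier_cyc[of 1] by (simp add: Q_def cyc_def)
qed

lemma cnt_ipow_shift: "cnt (ipow (i + k)) (ipow i) = cnt (ipow k) (ipow 0)"
proof (rule cnt_cong[symmetric, where f = "\<lambda>x. \<pi> ^ i * x"])
  show "\<pi> ^ i * x \<in> ipow i" if "x \<in> ipow 0" for x
    using that pi_mult_ipow_iff[of i x 0] by simp
  show "\<pi> ^ i * x - \<pi> ^ i * y \<in> ipow (i + k) \<longleftrightarrow> x - y \<in> ipow k" for x y
    by (simp flip: right_diff_distrib)
  show "\<exists>x\<in>ipow 0. \<pi> ^ i * x - c \<in> ipow (i + k)" if "c \<in> ipow i" for c
  proof -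
    obtain y where "y \<in> ipow 0" "c = \<pi> ^ i * y" using \<open>c \<in> ipow i\<close> ipow_iff by blast
    then show ?thesis by (intro bexI[of _ y]) auto
  qed
qed (auto intro: saturated_ipow)

text \<open>Along \<oo>, \<pp>, \<pp>^(k+1): the first step has index \<open>Q\<close>, and
  multiplication by \<pi> identifies the second with \<oo> modulo \<pp>^k.\<close>

lemma cnt_ipow_0: "cnt (ipow k) (ipow 0) = Q ^ k"
proof (induction k)
  case 0
  show ?case by (simp add: cnt_self)
next
  case (Suc k)
  have "cnt (ipow (Suc k)) (ipow 0) = cnt (ipow (Suc k)) {x \<in> ipow 0. x \<in> ipow 1} * cnt (ipow 1) (ipow 0)"
    by (rule cnt_hom) (auto intro: ipow_mono[of _ "Suc k"] ipow_mono[of 0 1] intro!: bexI)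
  moreover have "{x \<in> ipow 0. x \<in> ipow 1} = ipow 1"
    by (auto intro: ipow_mono[of 0 1])
  ultimately show ?case
    using cnt_ipow_shift[of 1 k] cnt_residue Suc by simp
qed

lemma cnt_ipow: "i \<le> k \<Longrightarrow> cnt (ipow k) (ipow i) = Q ^ (k - i)"
  using cnt_ipow_shift[of i "k - i"] cnt_ipow_0 by simp

lemma finite_ipow_reps: "finite (ipow 0 \<inter> reps (ipow k))"
proof -
  have "cnt (ipow k) (ipow 0) > 0" using Q_ge_2 by (simp add: cnt_ipow_0)
  then show ?thesis by (simp add: cnt_def card_gt_0_iff)
qed

lemma prod_cong_ipow:
  assumes "finite A" "\<And>a. a \<in> A \<Longrightarrow> f a \<in> ipow 0" "\<And>a. a \<in> A \<Longrightarrow> g a \<in> ipow 0"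
    and "\<And>a. a \<in> A \<Longrightarrow> f a - g a \<in> ipow k"
  shows "(\<Prod>a\<in>A. f a) - (\<Prod>a\<in>A. g a) \<in> ipow k \<and> (\<Prod>a\<in>A. f a) \<in> ipow 0 \<and> (\<Prod>a\<in>A. g a) \<in> ipow 0"
  using assms
proof (induction A rule: finite_induct)
  case (insert a A)
  have "f a * prod f A - g a * prod g A = (f a - g a) * prod f A + g a * (prod f A - prod g A)"
    by (simp add: algebra_simps)
  moreover have "\<dots> \<in> ipow k"
    using insert by (intro ipow_add ipow_multr ipow_multl) auto
  ultimately show ?case
    using insert by (auto intro: ipow_multl)
qed simp

text \<open>Multiplication by a unit permutes the nonzero residue classes.\<close>

lemma fermat_residue:
  assumes x: "x \<in> ipow 0"
  shows "x ^ Q - x \<in> ipow 1"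
proof (cases "x \<in> ipow 1")
  case True
  have "x ^ Q = x * x ^ (Q - 1)"
    using Q_ge_2 by (simp flip: power_Suc)
  then have "x ^ Q \<in> ipow 1"
    using True x by (auto intro: ipow_multr ipow_power)
  with True show ?thesis by (rule ipow_diff[rotated])
next
  case False
  define U where "U = ipow 0 - ipow 1"
  have sat: "saturated (ipow 1) U"
    unfolding saturated_def U_def
    using saturated_ipow[of 0 1] ipow_cong[of _ _ 1] by (auto simp: saturated_def)
  let ?U = "U \<inter> reps (ipow 1)"
  have finU: "finite ?U"
    by (rule finite_subset[OF _ finite_ipow_reps[of 1]]) (auto simp: U_def)
  let ?h = "\<lambda>a. rep (ipow 1) (x * a)"
  have bij: "bij_betw ?h ?U ?U"
  proof (rule bij_betw_reps[OF subgroup_ipow subgroup_ipow sat sat])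
    show "x * a \<in> U" if "a \<in> U" for a
      using that x False by (auto simp: U_def unit_mult_ipow_iff intro: ipow_multl)
    show "x * a - x * b \<in> ipow 1 \<longleftrightarrow> a - b \<in> ipow 1" for a b
      using x False by (simp add: unit_mult_ipow_iff flip: right_diff_distrib)
    show "\<exists>a\<in>U. x * a - c \<in> ipow 1" if "c \<in> U" for c
      using that x False unit_inverse[OF x False] unit_inverse'[OF x False] unit_neq_0[OF False]
      by (intro bexI[of _ "inverse x * c"])
        (auto simp: U_def unit_mult_ipow_iff mult.assoc[symmetric] intro: ipow_multl)
  qed
  have h: "?h a - x * a \<in> ipow 1" for a
    by (rule rep_diff) simp
  have hU: "?h a \<in> U" if "a \<in> ?U" for a
    using bij that by (auto simp: bij_betw_def)
  have "(\<Prod>a\<in>?U. ?h a) - (\<Prod>a\<in>?U. x * a) \<in> ipow 1"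
    using prod_cong_ipow[OF finU, of ?h "\<lambda>a. x * a" 1] h hU x
    by (auto simp: U_def intro: ipow_multl)
  moreover have "(\<Prod>a\<in>?U. ?h a) = \<Prod>?U"
    using bij by (rule prod.reindex_bij_betw)
  moreover have "card ?U = Q - 1"
  proof -
    have "ipow 0 \<inter> reps (ipow 1) = ?U \<union> (ipow 1 \<inter> reps (ipow 1))"
      by (auto simp: U_def intro: ipow_mono[of 0 1])
    moreover have "?U \<inter> (ipow 1 \<inter> reps (ipow 1)) = {}" by (auto simp: U_def)
    ultimately have "Q = card ?U + cnt (ipow 1) (ipow 1)"
      using cnt_residue card_Un_disjoint[OF finU finite_subset[OF _ finite_ipow_reps[of 1]], of "ipow 1 \<inter> reps (ipow 1)"]
      by (auto simp: cnt_def intro: ipow_mono[of 0 1])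
    then show ?thesis by (simp add: cnt_self)
  qed
  ultimately have "\<Prod>?U * (1 - x ^ (Q - 1)) \<in> ipow 1"
    by (simp add: prod.distrib algebra_simps)
  moreover have "\<Prod>?U \<in> ipow 0 \<and> \<Prod>?U \<notin> ipow 1"
  proof -
    have "\<Prod>A \<in> ipow 0 \<and> \<Prod>A \<notin> ipow 1" if "finite A" "A \<subseteq> U" for A
      using that
    proof (induction A rule: finite_induct)
      case (insert a A)
      then show ?case by (auto simp: U_def unit_mult_ipow_iff intro: ipow_multl)
    qed simp
    then show ?thesis using finU by blast
  qed
  ultimately have "1 - x ^ (Q - 1) \<in> ipow 1"
    using unit_mult_ipow_iff by blast
  then have "x * (1 - x ^ (Q - 1)) \<in> ipow 1"
    by (rule ipow_multl[OF x])
  moreover have "x ^ Q = x * x ^ (Q - 1)"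
    using Q_ge_2 by (simp flip: power_Suc)
  ultimately show ?thesis
    using ipow_uminus[of "x - x ^ Q" 1] by (simp add: right_diff_distrib)
qed

section \<open>Powers with exponent Q, and roots in 1 + \<pp>\<close>

lemma of_nat_Q_ipow: "of_nat Q \<in> ipow 1"
proof -
  \<comment> \<open>Adding 1 permutes the residue classes; comparing the two sums over all of them
    puts Q times 1 into \<pp>.\<close>
  let ?R = "ipow 0 \<inter> reps (ipow 1)" and ?h = "\<lambda>a. rep (ipow 1) (a + 1)"
  have bij: "bij_betw ?h ?R ?R"
  proof (rule bij_betw_reps[OF subgroup_ipow subgroup_ipow saturated_ipow saturated_ipow])
    show "\<exists>a\<in>ipow 0. a + 1 - c \<in> ipow 1" if "c \<in> ipow 0" for c
      using that by (intro bexI[of _ "c - 1"]) (auto intro: ipow_diff)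
  qed (auto intro: ipow_add)
  have "(\<Sum>a\<in>?R. ?h a - (a + 1)) \<in> ipow 1"
    by (intro ipow_sum) (rule rep_diff, simp)
  moreover have "(\<Sum>a\<in>?R. ?h a) = \<Sum>?R"
    using bij by (rule sum.reindex_bij_betw)
  moreover have "card ?R = Q"
    using cnt_residue by (simp add: cnt_def)
  ultimately have "- of_nat Q \<in> ipow 1"
    by (simp add: sum_subtractf sum.distrib)
  then show ?thesis by simp
qed

lemma power_cong_ipow:
  assumes "x \<in> ipow 0" "y \<in> ipow 0" "x - y \<in> ipow k"
  shows "x ^ n - y ^ n \<in> ipow k"
  unfolding power_diff_sumr2
  using assms by (intro ipow_multr ipow_sum ipow_multl ipow_power) auto

text \<open>Besides \<open>x - y\<close>, the difference of the powers has the cofactor \<Sum>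
  y^(Q-1-i) x^i. It is congruent to Q y^(Q-1) modulo \<pp>, hence lies in \<pp> and supplies one
  more power of \<pi>.\<close>

lemma power_Q_cong:
  assumes x: "x \<in> ipow 0" and y: "y \<in> ipow 0" and xy: "x - y \<in> ipow (Suc k)"
  shows "x ^ Q - y ^ Q \<in> ipow (Suc (Suc k))"
proof -
  have xy1: "x - y \<in> ipow 1" using xy by (rule ipow_mono[rotated]) simp
  have "y ^ (Q - Suc i) * x ^ i - y ^ (Q - 1) \<in> ipow 1" if "i < Q" for i
  proof -
    have "y ^ (Q - Suc i) * x ^ i - y ^ (Q - Suc i) * y ^ i \<in> ipow 1"
      unfolding right_diff_distrib[symmetric]
      using x y xy1 by (intro ipow_multl ipow_power power_cong_ipow)
    moreover have "y ^ (Q - Suc i) * y ^ i = y ^ (Q - 1)"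
      using that by (simp flip: power_add)
    ultimately show ?thesis by simp
  qed
  then have "(\<Sum>i<Q. y ^ (Q - Suc i) * x ^ i - y ^ (Q - 1)) \<in> ipow 1"
    by (intro ipow_sum) auto
  then have "(\<Sum>i<Q. y ^ (Q - Suc i) * x ^ i) - of_nat Q * y ^ (Q - 1) \<in> ipow 1"
    by (simp add: sum_subtractf)
  moreover have "of_nat Q * y ^ (Q - 1) \<in> ipow 1"
    using of_nat_Q_ipow y by (intro ipow_multr ipow_power)
  ultimately have "(\<Sum>i<Q. y ^ (Q - Suc i) * x ^ i) \<in> ipow 1"
    using ipow_cong by blast
  then show ?thesis
    unfolding power_diff_sumr2 using ipow_mult[OF xy, of _ 1] by simp
qed

lemma one_plus_power_Q:
  assumes "b - 1 \<in> ipow 1"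
  shows "b ^ (Q ^ n) - 1 \<in> ipow (Suc n)"
proof (induction n)
  case 0
  show ?case using assms by simp
next
  case (Suc n)
  have "b \<in> ipow 0"
    using ipow_cong[of b 1 0] ipow_mono[OF _ assms, of 0] by simp
  then have "(b ^ (Q ^ n)) ^ Q - 1 ^ Q \<in> ipow (Suc (Suc n))"
    using Suc by (intro power_Q_cong ipow_power) auto
  then show ?case
    by (simp add: power_mult[symmetric] mult.commute)
qed

text \<open>By the ultrametric inequality, bounds on consecutive differences already give a Cauchy
  sequence.\<close>

lemma ipow_Cauchy_limit:
  assumes X: "\<And>n. X (Suc n) - X n \<in> ipow n"
  obtains L where "\<And>k. \<exists>N. \<forall>n\<ge>N. X n - L \<in> ipow k"
proof -
  have step: "X (N + d) - X N \<in> ipow N" for N d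
  proof (induction d)
    case (Suc d)
    have "X (Suc (N + d)) - X (N + d) \<in> ipow N"
      by (rule ipow_mono[OF _ X]) simp
    then show ?case using Suc ipow_trans[of "X (Suc (N + d))"] by simp
  qed simp
  have pp: "x \<in> pp v k" if "x \<in> ipow (nat k)" for x k
    using that by (auto simp: ipow_def pp_def split: if_splits)
  have "\<exists>N. \<forall>m\<ge>N. \<forall>n\<ge>N. X m - X n \<in> pp v k" for k
  proof (intro exI[of _ "nat k"] allI impI pp)
    fix m n assume "nat k \<le> m" "nat k \<le> n"
    then have "X m - X (nat k) \<in> ipow (nat k)" "X n - X (nat k) \<in> ipow (nat k)"
      using step[of "nat k" "m - nat k"] step[of "nat k" "n - nat k"] by auto
    then show "X m - X n \<in> ipow (nat k)"
      using ipow_diff by fastforce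
  qed
  then obtain L where L: "\<forall>k. \<exists>N. \<forall>n\<ge>N. X n - L \<in> pp v k"
    using v_complete[of X] by blast
  show ?thesis
    by (rule that[of L]) (use L in \<open>simp add: ipow_def\<close>)
qed

text \<open>The root is the limit of \<open>b^(1 + Q^k + Q^(2k) + \<dots>)\<close>.\<close>

lemma one_plus_root:
  assumes b: "b - 1 \<in> ipow 1" and k: "0 < k"
  shows "\<exists>L. L \<noteq> 0 \<and> b * L ^ (Q ^ k) = L"
proof -
  define X where "X j = (\<Prod>i<j. b ^ (Q ^ (k * i)))" for j
  have b0: "b \<in> ipow 0"
    using ipow_cong[of b 1 0] ipow_mono[OF _ b, of 0] by simp
  have X0: "X j \<in> ipow 0" for j
    unfolding X_def by (induction j) (auto intro: ipow_multl ipow_power b0)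
  have X1: "X j - 1 \<in> ipow 1" for j
    unfolding X_def
  proof (induction j)
    case (Suc j)
    have "b ^ Q ^ (k * j) - 1 \<in> ipow 1"
      using one_plus_power_Q[OF b, of "k * j"] by (rule ipow_mono[rotated]) simp
    then have "(\<Prod>i<j. b ^ Q ^ (k * i)) * (b ^ Q ^ (k * j) - 1) \<in> ipow 1"
      using X0[of j] by (intro ipow_multl) (auto simp: X_def)
    then show ?case
      using ipow_add[OF Suc] by (fastforce simp: algebra_simps)
  qed simp
  have "X (Suc j) - X j \<in> ipow j" for j
  proof -
    have "X j * (b ^ Q ^ (k * j) - 1) \<in> ipow (Suc (k * j))"
      by (intro ipow_multl X0 one_plus_power_Q b)
    then have "X j * (b ^ Q ^ (k * j) - 1) \<in> ipow j"
      by (rule ipow_mono[rotated]) (use k in \<open>cases k; simp\<close>)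
    then show ?thesis by (simp add: X_def algebra_simps)
  qed
  then obtain L where L: "\<And>m. \<exists>N. \<forall>n\<ge>N. X n - L \<in> ipow m"
    using ipow_Cauchy_limit by blast
  have L1: "L - 1 \<in> ipow 1"
  proof -
    obtain n where "X n - L \<in> ipow 1" using L[of 1] by blast
    then show ?thesis using X1[of n] ipow_comm ipow_trans by blast
  qed
  then have L0: "L \<in> ipow 0"
    using ipow_cong[of L 1 0] ipow_mono[OF _ L1, of 0] by simp
  \<comment> \<open>Raising to the power Q^k moves every exponent Q^(k i) to the next one. In the
    limit b L^(Q^k) = L, so 1 / L is a (Q^k - 1)-th root of \<open>b\<close>.\<close>
  have bX: "b * X j ^ (Q ^ k) = X (Suc j)" for j
  proof -
    have "X (Suc j) = b * (\<Prod>i<j. b ^ (Q ^ (k * Suc i)))"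
      unfolding X_def by (subst prod.lessThan_Suc_shift) simp
    also have "(\<Prod>i<j. b ^ (Q ^ (k * Suc i))) = X j ^ (Q ^ k)"
      unfolding X_def prod_power_distrib
      by (intro prod.cong refl) (simp add: power_add mult.commute flip: power_mult)
    finally show ?thesis by simp
  qed
  have "b * L ^ (Q ^ k) - L \<in> ipow m" for m
  proof -
    obtain N where N: "\<forall>n\<ge>N. X n - L \<in> ipow m" using L[of m] by blast
    have "b * (L ^ (Q ^ k) - X N ^ (Q ^ k)) \<in> ipow m"
      using N by (intro ipow_multl b0 power_cong_ipow L0 X0 ipow_comm[of "X N"]) simp
    moreover have "X (Suc N) - L \<in> ipow m" using N by simp
    ultimately have "b * (L ^ (Q ^ k) - X N ^ (Q ^ k)) + (X (Suc N) - L) \<in> ipow m"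
      by (rule ipow_add)
    then show ?thesis by (simp add: bX[symmetric] algebra_simps)
  qed
  then have "b * L ^ (Q ^ k) - L = 0" by (rule ipow_Inter)
  moreover have "L \<noteq> 0" using L1 by auto
  ultimately show ?thesis by auto
qed

end

section \<open>Involutions of a local field\<close>

locale field_with_involution = uniformized_field v \<pi> for v :: "'a::field \<Rightarrow> int" and \<pi> +
  fixes \<tau> :: "'a \<Rightarrow> 'a"
  assumes tau_add: "\<tau> (x + y) = \<tau> x + \<tau> y" and tau_mult: "\<tau> (x * y) = \<tau> x * \<tau> y"
    and tau_tau [simp]: "\<tau> (\<tau> x) = x" and tau_pi [simp]: "\<tau> \<pi> = \<pi>"
begin

lemma tau_0 [simp]: "\<tau> 0 = 0"
proof -
  have "\<tau> 0 + \<tau> 0 = \<tau> 0 + 0" by (simp flip: tau_add)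
  then show ?thesis by (rule add_left_imp_eq)
qed

lemma tau_uminus: "\<tau> (- x) = - \<tau> x"
  using tau_add[of x "- x"] by (simp add: eq_neg_iff_add_eq_0 add.commute)

lemma tau_diff: "\<tau> (x - y) = \<tau> x - \<tau> y"
  using tau_add[of x "- y"] tau_uminus[of y] by simp

lemma tau_eq_0_iff [simp]: "\<tau> x = 0 \<longleftrightarrow> x = 0"
  by (metis tau_0 tau_tau)

lemma tau_1 [simp]: "\<tau> 1 = 1"
proof -
  have "\<tau> 1 * \<tau> 1 = \<tau> 1" using tau_mult[of 1 1] by simp
  moreover have "\<tau> 1 \<noteq> 0" by simp
  ultimately show ?thesis by (metis mult_cancel_left2)
qed

lemma tau_power: "\<tau> (x ^ n) = \<tau> x ^ n"
  by (induction n) (simp_all add: tau_mult)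

lemma tau_inverse: "\<tau> (inverse x) = inverse (\<tau> x)"
proof (cases "x = 0")
  case False
  then have "\<tau> x * \<tau> (inverse x) = 1" by (simp flip: tau_mult)
  then show ?thesis by (metis inverse_unique)
qed simp

lemma tau_divide: "\<tau> (x / y) = \<tau> x / \<tau> y"
  by (simp add: divide_inverse tau_mult tau_inverse)

text \<open>An element \<open>b\<close> of \<open>1 + \<pp>\<close> has \<open>(Q^k - 1)\<close>-th roots for all \<open>k\<close>, hence so has \<open>\<tau> b\<close>, so that
  the valuation of \<open>\<tau> b\<close> vanishes.\<close>

lemma v_tau_one_plus:
  assumes b: "b - 1 \<in> ipow 1"
  shows "v (\<tau> b) = 0"
proof -
  have b0: "b \<noteq> 0" using b by auto
  \<comment> \<open>With this k, Q^k - 1 exceeds the absolute value of v(\<tau> b), which it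
    divides; so the latter is 0.\<close>
  define k where "k = nat \<bar>v (\<tau> b)\<bar> + 1"
  obtain L where L: "L \<noteq> 0" "b * L ^ (Q ^ k) = L"
    using one_plus_root[OF b, of k] by (auto simp: k_def)
  have "\<tau> b * \<tau> L ^ (Q ^ k) = \<tau> L"
    using arg_cong[OF L(2), of \<tau>] by (simp add: tau_mult tau_power)
  then have "v (\<tau> b * \<tau> L ^ (Q ^ k)) = v (\<tau> L)" by simp
  then have eq: "v (\<tau> b) = v (\<tau> L) * (1 - int (Q ^ k))"
    using b0 L(1) by (simp add: v_mult v_power algebra_simps)
  have "k < 2 ^ k" by simp
  also have "(2::nat) ^ k \<le> Q ^ k" using Q_ge_2 by (rule power_mono) simp
  finally have "int k < int (Q ^ k)" by simp
  show ?thesis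
  proof (rule ccontr)
    assume "v (\<tau> b) \<noteq> 0"
    then have "v (\<tau> L) \<noteq> 0" using eq by auto
    then have "1 \<le> \<bar>v (\<tau> L)\<bar>" by simp
    then have "1 * \<bar>1 - int (Q ^ k)\<bar> \<le> \<bar>v (\<tau> L)\<bar> * \<bar>1 - int (Q ^ k)\<bar>"
      by (rule mult_right_mono) simp
    then have "\<bar>1 - int (Q ^ k)\<bar> \<le> \<bar>v (\<tau> b)\<bar>"
      unfolding eq abs_mult by simp
    then show False
      using \<open>int k < int (Q ^ k)\<close> unfolding k_def by simp
  qed
qed

lemma tau_ipow_0:
  assumes x: "x \<in> ipow 0"
  shows "\<tau> x \<in> ipow 0"
proof (rule ccontr)
  assume n: "\<tau> x \<notin> ipow 0"
  then have x0: "\<tau> x \<noteq> 0" and neg: "v (\<tau> x) \<le> - 1"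
    by (auto simp: ipow_def pp_def)
  \<comment> \<open>The factor \<pi> puts \<open>a\<close> into \<pp>, while the square keeps
    v(\<tau> a) = 1 + 2 v(\<tau> x) negative if v(\<tau> x) is; then 1 + \<tau> a could not have
    valuation 0.\<close>
  define a where "a = \<pi> * x ^ 2"
  have "a \<in> ipow (1 + 0)"
    unfolding a_def using pi_power_ipow[of 1] x by (intro ipow_mult ipow_power) auto
  then have "v (\<tau> (1 + a)) = 0"
    by (intro v_tau_one_plus) simp
  then have "1 + \<tau> a \<in> ipow 0"
    by (simp add: tau_add ipow_def pp_def)
  then have "\<tau> a \<in> ipow 0"
    using ipow_diff[OF _ ipow_1, of "1 + \<tau> a"] by simp
  moreover have "v (\<tau> a) = 1 + 2 * v (\<tau> x)"
    using x0 by (simp add: a_def tau_mult tau_power v_mult v_pi v_power)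
  ultimately show False
    using neg x0 by (simp add: a_def ipow_def pp_def tau_mult tau_power)
qed

lemma tau_ipow_iff [simp]: "\<tau> x \<in> ipow k \<longleftrightarrow> x \<in> ipow k"
proof -
  have "\<tau> x \<in> ipow k" if x: "x \<in> ipow k" for x
  proof -
    obtain y where "y \<in> ipow 0" "x = \<pi> ^ k * y" using x ipow_iff by blast
    then show ?thesis
      using ipow_iff[of "\<tau> x" k] tau_ipow_0 by (auto simp: tau_mult tau_power)
  qed
  from this[of x] this[of "\<tau> x"] show ?thesis by auto
qed

text \<open>If \<open>\<tau>\<close> is trivial modulo \<open>\<pp>\<close>, then \<open>x = x^Q + \<pi> y\<close> shows inductively that it is trivial modulo
  all powers of \<open>\<pp>\<close>.\<close>

lemma tau_nontrivial_residue:
  assumes "\<tau> \<noteq> id"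
  shows "\<exists>z\<in>ipow 0. z - \<tau> z \<notin> ipow 1"
proof (rule ccontr)
  assume "\<not> ?thesis"
  then have triv: "z - \<tau> z \<in> ipow 1" if "z \<in> ipow 0" for z using that by blast
  have "\<forall>x\<in>ipow 0. x - \<tau> x \<in> ipow (Suc k)" for k
  proof (induction k)
    case 0
    then show ?case using triv by simp
  next
    case (Suc k)
    show ?case
    proof
      fix x assume x: "x \<in> ipow 0"
      obtain y where y: "y \<in> ipow 0" "x ^ Q - x = \<pi> * y"
        using fermat_residue[OF x] ipow_iff[of _ 1] by auto
      have "x ^ Q - \<tau> x ^ Q \<in> ipow (Suc (Suc k))"
        using x Suc by (intro power_Q_cong) auto
      moreover have "\<pi> ^ 1 * (y - \<tau> y) \<in> ipow (1 + Suc k)"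
        unfolding pi_mult_ipow_iff using Suc y by blast
      moreover have "x - \<tau> x = (x ^ Q - \<tau> x ^ Q) - \<pi> ^ 1 * (y - \<tau> y)"
      proof -
        have "\<tau> (x ^ Q - x) = \<pi> * \<tau> y" by (simp add: y(2) tau_mult)
        then have "\<tau> x = \<tau> x ^ Q - \<pi> * \<tau> y" by (simp add: tau_diff tau_power algebra_simps)
        moreover have "x = x ^ Q - \<pi> * y" using y(2) by (simp add: algebra_simps)
        ultimately show ?thesis by (simp only: right_diff_distrib power_one_right) (metis (no_types) add_diff_eq diff_add_eq diff_diff_eq2)
      qed
      ultimately show "x - \<tau> x \<in> ipow (Suc (Suc k))"
        using ipow_diff by simp
    qed
  qed
  then have "x - \<tau> x \<in> ipow k" if "x \<in> ipow 0" for x k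
    using that ipow_mono[of k "Suc k"] by auto
  then have fix0: "\<tau> x = x" if "x \<in> ipow 0" for x
    using that ipow_Inter[of "x - \<tau> x"] by auto
  have "\<tau> x = x" for x
  proof -
    obtain k where "\<pi> ^ k * x \<in> ipow 0" using exists_pi_power_mult by blast
    then have "\<tau> (\<pi> ^ k * x) = \<pi> ^ k * x" by (rule fix0)
    then show ?thesis by (simp add: tau_mult tau_power)
  qed
  with assms show False by (auto simp: fun_eq_iff)
qed

end

declare One_nat_def [simp del]
declare Suc_eq_plus1 [symmetric, simp] Suc_eq_plus1_left [symmetric, simp]

text \<open>Each coset of \<open>Z\<close> splits into as many cosets of \<open>Y\<close> as
  \<open>Z\<close> itself. Here \<open>S\<close> is merely a union of cosets, because norm fibres
  are to be counted this way.\<close>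

lemma cnt_refine:
  assumes Y: "add_subgroup Y" and Z: "add_subgroup Z" and YZ: "Y \<subseteq> Z" and S: "saturated Z S"
    and fin: "finite (S \<inter> reps Y)" "finite (S \<inter> reps Z)"
  shows "cnt Y S = cnt Z S * cnt Y Z"
proof -
  have satS: "saturated Y S" using S YZ by (auto simp: saturated_def)
  have fib: "card {x \<in> S \<inter> reps Y. rep Z x = c} = cnt Y Z" if c: "c \<in> S \<inter> reps Z" for c
  proof -
    have sat: "saturated Y {x. x - c \<in> Z}" for c
      unfolding saturated_def using add_subgroup_trans[OF Z] YZ by blast
    have "{x \<in> S \<inter> reps Y. rep Z x = c} = {x. x - c \<in> Z} \<inter> reps Y"
    proof -
      have "rep Z x = c \<longleftrightarrow> x - c \<in> Z" for x
        using rep_eq_iff[OF Z, of x c] rep_reps[OF Z, of c] c by simp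
      moreover have "x \<in> S" if "x - c \<in> Z" for x
        using saturatedD[OF S _ that] c by simp
      ultimately show ?thesis by auto
    qed
    moreover have "cnt Y {x. x - 0 \<in> Z} = cnt Y {x. x - c \<in> Z}"
      by (rule cnt_translate[OF Y sat sat, where a = c]) simp
    ultimately show ?thesis by (simp add: cnt_def)
  qed
  have "cnt Y S = (\<Sum>c\<in>S \<inter> reps Z. card {x \<in> S \<inter> reps Y. rep Z x = c})"
    unfolding cnt_def using fin
    by (intro card_eq_sum_fibers) (auto simp: rep_mem_iff[OF Z S])
  also have "\<dots> = (\<Sum>c\<in>S \<inter> reps Z. cnt Y Z)"
    by (intro sum.cong refl fib)
  finally show ?thesis by (simp add: cnt_def)
qed

context uniformized_field
begin

lemma finite_reps_subset: "S \<subseteq> ipow 0 \<Longrightarrow> finite (S \<inter> reps (ipow k))"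
  by (rule finite_subset[OF _ finite_ipow_reps[of k]]) auto

lemma cnt_units: "0 < k \<Longrightarrow> cnt (ipow k) (ipow 0 - ipow 1) = Q ^ k - Q ^ (k - 1)"
proof -
  assume k: "0 < k"
  have "(ipow 0 - ipow 1) \<inter> reps (ipow k) = (ipow 0 \<inter> reps (ipow k)) - (ipow 1 \<inter> reps (ipow k))"
    by auto
  moreover have "ipow 1 \<inter> reps (ipow k) \<subseteq> ipow 0 \<inter> reps (ipow k)"
    using ipow_mono[of 0 1] by auto
  ultimately show ?thesis
    using card_Diff_subset[of "ipow 1 \<inter> reps (ipow k)" "ipow 0 \<inter> reps (ipow k)"]
      finite_subset[OF _ finite_ipow_reps[of k]] cnt_ipow_0[of k] cnt_ipow[of 1 k] k
    by (simp add: cnt_def)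
qed

lemma cnt_unit_mult:
  assumes u: "u \<in> ipow 0" "u \<notin> ipow 1" and S: "saturated (ipow k) S" and T: "saturated (ipow k) T"
    and ST: "\<And>x. x \<in> S \<longleftrightarrow> u * x \<in> T"
  shows "cnt (ipow k) S = cnt (ipow k) T"
proof (rule cnt_cong[OF subgroup_ipow subgroup_ipow S T, where f = "\<lambda>x. u * x"])
  show "u * x - u * y \<in> ipow k \<longleftrightarrow> x - y \<in> ipow k" for x y
    using u by (simp add: unit_mult_ipow_iff flip: right_diff_distrib)
  show "\<exists>x\<in>S. u * x - c \<in> ipow k" if "c \<in> T" for c
    using that ST[of "inverse u * c"] unit_neq_0[OF u(2)]
    by (intro bexI[of _ "inverse u * c"]) (auto simp: mult.assoc[symmetric])
qed (use ST in auto)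

end

section \<open>Traces and norms modulo powers of \<pp>\<close>

locale hermitian_field = field_with_involution +
  fixes q :: nat
  assumes tau_nontrivial: "\<tau> \<noteq> id" and Q_eq: "Q = q ^ 2"
begin

lemma q_ge_2: "2 \<le> q"
proof (rule ccontr)
  assume "\<not> 2 \<le> q"
  then have "q ^ 2 \<le> 1 ^ 2" by (intro power_mono) auto
  then show False using Q_ge_2 unfolding Q_eq by simp
qed

lemma skew_unit: "\<exists>d\<in>ipow 0. d \<notin> ipow 1 \<and> \<tau> d = - d"
proof -
  obtain z where "z \<in> ipow 0" "z - \<tau> z \<notin> ipow 1"
    using tau_nontrivial_residue[OF tau_nontrivial] by blast
  then show ?thesis
    by (intro bexI[of _ "z - \<tau> z"]) (auto simp: tau_diff intro: ipow_diff)
qed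

text \<open>A substitute for 1/2 in every residue characteristic. If 2 lies in \<pp>, the trace of z
  agrees modulo \<pp> with the unit z - \<tau> z; otherwise 1 has the unit trace 2. Dividing by the
  trace, which \<tau> fixes, normalizes it to 1.\<close>

lemma trace_one: "\<exists>c\<in>ipow 0. c + \<tau> c = 1"
proof -
  obtain z where z: "z \<in> ipow 0" "z - \<tau> z \<notin> ipow 1"
    using tau_nontrivial_residue[OF tau_nontrivial] by blast
  have "\<exists>c\<in>ipow 0. c + \<tau> c \<notin> ipow 1"
  proof (cases "2 \<in> ipow 1")
    case True
    then have "2 * \<tau> z \<in> ipow 1" by (rule ipow_multr) (simp add: z)
    moreover have "(z + \<tau> z) - (z - \<tau> z) = 2 * \<tau> z" by simp
    ultimately have "(z + \<tau> z) - (z - \<tau> z) \<in> ipow 1" by (simp only:)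
    then have "z + \<tau> z \<notin> ipow 1" using z(2) unit_cong[of "z + \<tau> z" "z - \<tau> z"] by simp
    with z(1) show ?thesis by blast
  next
    case False
    then show ?thesis by (intro bexI[of _ 1]) auto
  qed
  then obtain c where c: "c \<in> ipow 0" "c + \<tau> c \<notin> ipow 1" by blast
  let ?t = "c + \<tau> c"
  have t: "?t \<in> ipow 0" "\<tau> ?t = ?t" "?t \<noteq> 0"
    using c unit_neq_0[OF c(2)] by (auto simp: tau_add add.commute intro: ipow_add)
  have "inverse ?t * c + \<tau> (inverse ?t * c) = inverse ?t * ?t"
    using t(2) by (simp add: tau_mult tau_inverse distrib_left)
  also have "\<dots> = 1" using t(3) by simp
  finally show ?thesis
    using c t by (intro bexI[of _ "inverse ?t * c"]) (auto intro: ipow_multl unit_inverse)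
qed

text \<open>Stands for the integers of the fixed field modulo \<pp>^k, without a choice of
  \<tau>-invariant representatives.\<close>

definition tau_fixed :: "nat \<Rightarrow> 'a set" where
  "tau_fixed k = {c \<in> ipow 0. c - \<tau> c \<in> ipow k}"

lemma subgroup_tau_fixed: "add_subgroup (tau_fixed k)"
  unfolding add_subgroup_def
proof (intro conjI ballI)
  fix x y assume "x \<in> tau_fixed k" "y \<in> tau_fixed k"
  then have "x - y \<in> ipow 0" "(x - \<tau> x) - (y - \<tau> y) \<in> ipow k"
    by (auto simp: tau_fixed_def intro: ipow_diff)
  then show "x - y \<in> tau_fixed k"
    by (simp add: tau_fixed_def tau_diff algebra_simps)
qed (simp add: tau_fixed_def)

lemma ipow_subset_tau_fixed: "ipow k \<subseteq> tau_fixed k"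
  using ipow_mono[of 0 k] by (auto simp: tau_fixed_def intro: ipow_diff)

lemma saturated_tau_fixed: "saturated (ipow k) (tau_fixed k)"
  by (intro saturated_subgroup subgroup_tau_fixed ipow_subset_tau_fixed)

text \<open>The map x - \<tau> x sends \<oo> onto the elements that are skew modulo \<pp>^k, with
  kernel \<open>tau_fixed k\<close>; multiplication by a skew unit identifies fixed with skew
  elements. So the square of the count is Q^k = (q^k)^2.\<close>

lemma cnt_tau_fixed: "cnt (ipow k) (tau_fixed k) = q ^ k"
proof -
  let ?A = "{y \<in> ipow 0. y + \<tau> y \<in> ipow k}"
  obtain d where d: "d \<in> ipow 0" "d \<notin> ipow 1" "\<tau> d = - d" using skew_unit by blast
  obtain c0 where c0: "c0 \<in> ipow 0" "c0 + \<tau> c0 = 1" using trace_one by blast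
  have subA: "add_subgroup ?A"
    unfolding add_subgroup_def
  proof (intro conjI ballI)
    fix x y assume "x \<in> ?A" "y \<in> ?A"
    then have "x - y \<in> ipow 0" "(x + \<tau> x) - (y + \<tau> y) \<in> ipow k"
      by (auto intro: ipow_diff)
    then show "x - y \<in> ?A" by (simp add: tau_diff algebra_simps)
  qed simp
  have YA: "ipow k \<subseteq> ?A"
    using ipow_mono[of 0 k] by (auto intro: ipow_add)
  have "cnt (ipow k) (ipow 0) = cnt (ipow k) {x \<in> ipow 0. x - \<tau> x \<in> ipow k} * cnt (ipow k) ?A"
  proof (rule cnt_hom[OF subgroup_ipow subgroup_ipow subgroup_ipow _ subA YA])
    show "x - \<tau> x \<in> ?A" if "x \<in> ipow 0" for x
      using that by (simp add: tau_diff ipow_diff)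
    \<comment> \<open>A skew y is attained at c0 y, because c0 has trace 1.\<close>
    show "\<exists>x\<in>ipow 0. x - \<tau> x - y \<in> ipow k" if y: "y \<in> ?A" for y
    proof (intro bexI)
      have "c0 * y - \<tau> (c0 * y) - y = c0 * y - \<tau> c0 * \<tau> y - (c0 + \<tau> c0) * y"
        using c0(2) by (simp add: tau_mult)
      also have "\<dots> = - (\<tau> c0 * (y + \<tau> y))" by (simp add: algebra_simps)
      also have "\<dots> \<in> ipow k" using y c0 by (simp add: ipow_multl)
      finally show "c0 * y - \<tau> (c0 * y) - y \<in> ipow k" .
      show "c0 * y \<in> ipow 0" using y c0 by (simp add: ipow_multl)
    qed
  qed (auto simp: tau_diff intro: ipow_mono[of 0 k] ipow_diff)
  moreover have "cnt (ipow k) (tau_fixed k) = cnt (ipow k) ?A"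
  proof (rule cnt_unit_mult[OF d(1,2)])
    show "x \<in> tau_fixed k \<longleftrightarrow> d * x \<in> ?A" for x
    proof -
      have "d * x + \<tau> (d * x) = d * (x - \<tau> x)" by (simp add: tau_mult d(3) algebra_simps)
      then show ?thesis using d by (simp add: tau_fixed_def unit_mult_ipow_iff)
    qed
  qed (intro saturated_tau_fixed saturated_subgroup[OF subA YA])+
  ultimately have "(cnt (ipow k) (tau_fixed k)) ^ 2 = (q ^ k) ^ 2"
    using cnt_ipow_0[of k] Q_eq
    by (simp add: tau_fixed_def power2_eq_square power_mult_distrib)
  then show ?thesis by (simp add: power2_eq_iff_nonneg)
qed

definition tau_fixed_units :: "nat \<Rightarrow> 'a set" where
  "tau_fixed_units k = tau_fixed k - ipow 1"

lemma saturated_tau_fixed_units: "0 < k \<Longrightarrow> saturated (ipow k) (tau_fixed_units k)"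
proof -
  assume k: "0 < k"
  note saturated_tau_fixed[of k]
  moreover have "x \<in> ipow 1 \<longleftrightarrow> y \<in> ipow 1" if "y - x \<in> ipow k" for x y
    using that ipow_mono[of 1 k "y - x"] k unit_cong by (auto simp: Suc_le_eq)
  ultimately show ?thesis
    by (auto simp: tau_fixed_units_def saturated_def)
qed

lemma cnt_tau_fixed_units:
  assumes k: "0 < k"
  shows "cnt (ipow k) (tau_fixed_units k) = q ^ k - q ^ (k - 1)"
proof -
  obtain l where l: "k = Suc l" using k by (cases k) auto
  \<comment> \<open>As \<tau> \<pi> = \<pi>, the non-units fixed modulo \<pp>^k are \<pi> times the
    elements fixed modulo \<pp>^(k-1).\<close>
  have "cnt (ipow l) (tau_fixed l) = cnt (ipow k) (tau_fixed k \<inter> ipow 1)"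
  proof (rule cnt_cong[where f = "\<lambda>x. \<pi> ^ 1 * x"])
    show "saturated (ipow l) (tau_fixed l)"
      by (rule saturated_tau_fixed)
    note saturated_tau_fixed[of k]
    moreover have "saturated (ipow k) (ipow 1)" using k by (intro saturated_ipow) simp
    ultimately show "saturated (ipow k) (tau_fixed k \<inter> ipow 1)"
      unfolding saturated_def by blast
    have iff: "\<pi> ^ 1 * x \<in> tau_fixed k \<inter> ipow 1 \<longleftrightarrow> x \<in> tau_fixed l" for x
    proof -
      have "\<pi> ^ 1 * x - \<tau> (\<pi> ^ 1 * x) = \<pi> ^ 1 * (x - \<tau> x)"
        by (simp add: tau_mult algebra_simps)
      moreover have "\<pi> ^ 1 * (x - \<tau> x) \<in> ipow (Suc l) \<longleftrightarrow> x - \<tau> x \<in> ipow l"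
        using pi_mult_ipow_iff[of 1 _ l] by simp
      moreover have "\<pi> ^ 1 * x \<in> ipow (1 + 0) \<longleftrightarrow> x \<in> ipow 0"
        by (rule pi_mult_ipow_iff)
      ultimately show ?thesis
        using ipow_mono[of 0 1 "\<pi> ^ 1 * x"] by (auto simp: tau_fixed_def l)
    qed
    show "\<pi> ^ 1 * x \<in> tau_fixed k \<inter> ipow 1" if "x \<in> tau_fixed l" for x
      using that iff by blast
    show "\<pi> ^ 1 * x - \<pi> ^ 1 * y \<in> ipow k \<longleftrightarrow> x - y \<in> ipow l" for x y
      using pi_mult_ipow_iff[of 1 "x - y" l] by (simp add: l right_diff_distrib)
    show "\<exists>x\<in>tau_fixed l. \<pi> ^ 1 * x - c \<in> ipow k" if c: "c \<in> tau_fixed k \<inter> ipow 1" for c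
    proof -
      obtain x where "c = \<pi> ^ 1 * x" using c ipow_iff[of c 1] by blast
      then show ?thesis using c iff by (intro bexI[of _ x]) auto
    qed
  qed auto
  moreover have "tau_fixed_units k \<inter> reps (ipow k) =
      tau_fixed k \<inter> reps (ipow k) - tau_fixed k \<inter> ipow 1 \<inter> reps (ipow k)"
    by (auto simp: tau_fixed_units_def)
  moreover have "card (tau_fixed k \<inter> reps (ipow k) - tau_fixed k \<inter> ipow 1 \<inter> reps (ipow k)) =
      card (tau_fixed k \<inter> reps (ipow k)) - card (tau_fixed k \<inter> ipow 1 \<inter> reps (ipow k))"
    by (intro card_Diff_subset finite_reps_subset) (auto simp: tau_fixed_def)
  ultimately show ?thesis
    using cnt_tau_fixed[of k] cnt_tau_fixed[of l] by (simp add: cnt_def l)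
qed

lemma norm_cong:
  assumes "a \<in> ipow 0" "b \<in> ipow 0" "a - b \<in> ipow k"
  shows "a * \<tau> a - b * \<tau> b \<in> ipow k"
proof -
  have "a * \<tau> a - b * \<tau> b = (a - b) * \<tau> a + b * \<tau> (a - b)"
    by (simp add: tau_diff algebra_simps)
  also have "\<dots> \<in> ipow k"
    using assms by (intro ipow_add ipow_multl ipow_multr) auto
  finally show ?thesis .
qed

lemma norm_unit_iff: "a \<in> ipow 0 \<Longrightarrow> a * \<tau> a \<in> ipow 1 \<longleftrightarrow> a \<in> ipow 1"
  using unit_mult_ipow_iff[of a "\<tau> a" 1] ipow_multr[of a 1 "\<tau> a"] by (cases "a \<in> ipow 1") auto

definition norm_fiber :: "'a \<Rightarrow> 'a set" where
  "norm_fiber c = {a \<in> ipow 0. a * \<tau> a - c \<in> ipow 1}"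

lemma saturated_norm_fiber: "saturated (ipow 1) (norm_fiber c)"
  unfolding saturated_def norm_fiber_def
proof clarify
  fix a b assume a: "a \<in> ipow 0" "a * \<tau> a - c \<in> ipow 1" and ba: "b - a \<in> ipow 1"
  have b: "b \<in> ipow 0"
    using saturatedD[OF saturated_ipow[of 0 1] a(1) ba] by simp
  with a ba show "b \<in> ipow 0 \<and> b * \<tau> b - c \<in> ipow 1"
    using ipow_trans[OF norm_cong[of b a 1], of c] by blast
qed

lemma norm_fiber_unit: "c \<notin> ipow 1 \<Longrightarrow> a \<in> norm_fiber c \<Longrightarrow> a \<in> ipow 0 \<and> a \<notin> ipow 1"
  using unit_cong[of "a * \<tau> a" c] norm_unit_iff[of a] by (auto simp: norm_fiber_def)

text \<open>Hilbert 90 on the residue field, with the resolvent w = z + u \<tau> z. If it were never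
  a unit, z = 1 would give u = -1 modulo \<pp>, and then \<tau> would be trivial there.\<close>

lemma hilbert_90:
  assumes u: "u \<in> norm_fiber 1"
  shows "\<exists>w\<in>ipow 0. w \<notin> ipow 1 \<and> w - u * \<tau> w \<in> ipow 1"
proof -
  have u0: "u \<in> ipow 0" and u1: "u * \<tau> u - 1 \<in> ipow 1" using u by (auto simp: norm_fiber_def)
  have "\<exists>z\<in>ipow 0. z + u * \<tau> z \<notin> ipow 1"
  proof (rule ccontr)
    assume "\<not> ?thesis"
    then have *: "z + u * \<tau> z \<in> ipow 1" if "z \<in> ipow 0" for z using that by blast
    have u': "1 + u \<in> ipow 1" using *[of 1] by simp
    have "z - \<tau> z \<in> ipow 1" if z: "z \<in> ipow 0" for z
    proof -
      have "(z + u * \<tau> z) - (1 + u) * \<tau> z \<in> ipow 1"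
        using *[OF z] u' z by (intro ipow_diff ipow_multr) auto
      then show ?thesis by (simp add: algebra_simps)
    qed
    then show False using tau_nontrivial_residue[OF tau_nontrivial] by blast
  qed
  then obtain z where z: "z \<in> ipow 0" "z + u * \<tau> z \<notin> ipow 1" by blast
  let ?w = "z + u * \<tau> z"
  have "?w - u * \<tau> ?w = - ((u * \<tau> u - 1) * z)"
    by (simp add: tau_add tau_mult algebra_simps)
  also have "\<dots> \<in> ipow 1" using u1 z by (simp add: ipow_multr)
  finally have "?w - u * \<tau> ?w \<in> ipow 1" .
  moreover have "?w \<in> ipow 0" using z u0 by (intro ipow_add ipow_multl) auto
  ultimately show ?thesis using z(2) by blast
qed

text \<open>The map a / \<tau> a from the q^2 - 1 unit classes to the norm-one classes has as fibres
  the multiples of the q - 1 fixed unit classes by a \<open>w\<close> from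
  \<open>hilbert_90\<close>.\<close>

lemma cnt_norm_one: "cnt (ipow 1) (norm_fiber 1) = q + 1"
proof -
  let ?R = "reps (ipow 1)" and ?A = "ipow 0 - ipow 1"
  let ?f = "\<lambda>a. rep (ipow 1) (a * inverse (\<tau> a))"
  have finA: "finite (?A \<inter> ?R)" and finN: "finite (norm_fiber 1 \<inter> ?R)"
    by (rule finite_reps_subset, auto simp: norm_fiber_def)+
  have mem: "a * inverse (\<tau> a) \<in> norm_fiber 1" if a: "a \<in> ?A" for a
  proof -
    have "a \<noteq> 0" using a by auto
    then have "a * inverse (\<tau> a) * \<tau> (a * inverse (\<tau> a)) = 1"
      by (simp add: tau_divide field_simps)
    moreover have "a * inverse (\<tau> a) \<in> ipow 0"
      using a by (intro ipow_multl unit_inverse) auto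
    ultimately show ?thesis by (simp add: norm_fiber_def)
  qed
  have fib: "card {a \<in> ?A \<inter> ?R. ?f a = u} = q - 1" if u: "u \<in> norm_fiber 1 \<inter> ?R" for u
  proof -
    obtain w where w: "w \<in> ipow 0" "w \<notin> ipow 1" "w - u * \<tau> w \<in> ipow 1"
      using hilbert_90 u by blast
    have u0: "u \<in> ipow 0" "u \<notin> ipow 1"
      using u norm_fiber_unit[of 1 u] by auto
    have iff: "?f a = u \<longleftrightarrow> a - u * \<tau> a \<in> ipow 1" if a: "a \<in> ?A" for a
    proof -
      have "?f a = u \<longleftrightarrow> a * inverse (\<tau> a) - u \<in> ipow 1"
        using rep_eq_iff[of "ipow 1" "a * inverse (\<tau> a)" u] rep_reps[of "ipow 1" u] u by simp
      also have "\<dots> \<longleftrightarrow> \<tau> a * (a * inverse (\<tau> a) - u) \<in> ipow 1"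
        using a by (intro unit_mult_ipow_iff[symmetric]) auto
      also have "\<tau> a * (a * inverse (\<tau> a) - u) = a - u * \<tau> a"
      proof -
        have "\<tau> a \<noteq> 0" using a by auto
        then show ?thesis by (simp add: field_simps)
      qed
      finally show ?thesis .
    qed
    have "cnt (ipow 1) (tau_fixed_units 1) = cnt (ipow 1) {a \<in> ?A. a - u * \<tau> a \<in> ipow 1}"
    proof (rule cnt_unit_mult[OF w(1,2) saturated_tau_fixed_units])
      show "saturated (ipow 1) {a \<in> ?A. a - u * \<tau> a \<in> ipow 1}"
        unfolding saturated_def
      proof clarify
        fix a b assume a: "a \<in> ipow 0" "a \<notin> ipow 1" "a - u * \<tau> a \<in> ipow 1" and ba: "b - a \<in> ipow 1"
        have "u * \<tau> (b - a) \<in> ipow 1"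
          by (rule ipow_multl[OF u0(1)]) (simp only: tau_ipow_iff ba)
        then have "(b - a) - u * \<tau> (b - a) + (a - u * \<tau> a) \<in> ipow 1"
          by (intro ipow_add[OF ipow_diff[OF ba] a(3)])
        moreover have "(b - a) - u * \<tau> (b - a) + (a - u * \<tau> a) = b - u * \<tau> b"
          by (simp add: tau_diff algebra_simps)
        ultimately show "b \<in> ?A \<and> b - u * \<tau> b \<in> ipow 1"
          using a ba saturatedD[OF saturated_ipow[of 0 1] a(1) ba] unit_cong[OF ba] by auto
      qed
      show "x \<in> tau_fixed_units 1 \<longleftrightarrow> w * x \<in> {a \<in> ?A. a - u * \<tau> a \<in> ipow 1}" for x
      proof -
        have "w * x - u * \<tau> (w * x) - w * (x - \<tau> x) = (w - u * \<tau> w) * \<tau> x"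
          by (simp add: tau_mult algebra_simps)
        then have "w * x - u * \<tau> (w * x) \<in> ipow 1 \<longleftrightarrow> w * (x - \<tau> x) \<in> ipow 1" if "x \<in> ipow 0"
          using that w(3) by (intro ipow_cong) (simp add: ipow_multr)
        then show ?thesis
          using w by (auto simp: tau_fixed_units_def tau_fixed_def unit_mult_ipow_iff)
      qed
    qed simp
    moreover have "{a \<in> ?A \<inter> ?R. ?f a = u} = {a \<in> ?A. a - u * \<tau> a \<in> ipow 1} \<inter> ?R"
      using iff by auto
    ultimately show ?thesis
      using cnt_tau_fixed_units[of 1] by (simp add: cnt_def)
  qed
  have "card (?A \<inter> ?R) = (\<Sum>u\<in>norm_fiber 1 \<inter> ?R. card {a \<in> ?A \<inter> ?R. ?f a = u})"
    using finA finN mem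
    by (intro card_eq_sum_fibers) (auto simp: rep_mem_iff[OF subgroup_ipow saturated_norm_fiber])
  also have "\<dots> = cnt (ipow 1) (norm_fiber 1) * (q - 1)"
    using fib by (simp add: cnt_def)
  finally have "q ^ 2 - 1 = cnt (ipow 1) (norm_fiber 1) * (q - 1)"
    using cnt_units[of 1] by (simp add: cnt_def Q_eq)
  moreover have "q ^ 2 - 1 = (q + 1) * (q - 1)"
    by (simp add: algebra_simps power2_eq_square)
  ultimately have "cnt (ipow 1) (norm_fiber 1) * (q - 1) = (q + 1) * (q - 1)"
    by (simp only:)
  moreover have "q - 1 \<noteq> 0" using q_ge_2 by simp
  ultimately show ?thesis by (simp only: mult_cancel2 simp_thms)
qed

text \<open>A nonempty fibre is a multiple of the fibre over 1.\<close>

lemma cnt_norm_fiber_cases: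
  assumes c: "c \<in> ipow 0" "c \<notin> ipow 1"
  shows "norm_fiber c = {} \<or> cnt (ipow 1) (norm_fiber c) = q + 1"
proof (cases "norm_fiber c = {}")
  case False
  then obtain a where a: "a \<in> norm_fiber c" by blast
  then have a0: "a \<in> ipow 0" "a \<notin> ipow 1" using norm_fiber_unit[OF c(2)] by auto
  have "cnt (ipow 1) (norm_fiber 1) = cnt (ipow 1) (norm_fiber c)"
  proof (rule cnt_unit_mult[OF a0 saturated_norm_fiber saturated_norm_fiber])
    show "x \<in> norm_fiber 1 \<longleftrightarrow> a * x \<in> norm_fiber c" for x
    proof -
      have "a * x * \<tau> (a * x) - c - c * (x * \<tau> x - 1) = (a * \<tau> a - c) * (x * \<tau> x)"
        by (simp add: tau_mult algebra_simps)
      then have "a * x * \<tau> (a * x) - c \<in> ipow 1 \<longleftrightarrow> c * (x * \<tau> x - 1) \<in> ipow 1" if "x \<in> ipow 0"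
        using that a by (intro ipow_cong) (auto simp: norm_fiber_def intro!: ipow_multr)
      then show ?thesis
        using a0 c by (auto simp: norm_fiber_def unit_mult_ipow_iff)
    qed
  qed
  then show ?thesis using cnt_norm_one by simp
qed simp

text \<open>The q^2 - 1 unit classes are distributed over q - 1 norm fibres of at most q + 1
  elements each, so every fibre is full.\<close>

lemma cnt_norm_fiber:
  assumes c: "c \<in> tau_fixed_units 1"
  shows "cnt (ipow 1) (norm_fiber c) = q + 1"
proof -
  let ?R = "reps (ipow 1)" and ?A = "ipow 0 - ipow 1" and ?T = "tau_fixed_units 1"
  let ?f = "\<lambda>a. rep (ipow 1) (a * \<tau> a)"
  have satT: "saturated (ipow 1) ?T" by (rule saturated_tau_fixed_units) simp
  have finA: "finite (?A \<inter> ?R)" and finT: "finite (?T \<inter> ?R)"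
    by (rule finite_reps_subset, auto simp: tau_fixed_units_def tau_fixed_def)+
  have unitT: "d \<in> ipow 0 \<and> d \<notin> ipow 1" if "d \<in> ?T" for d
    using that by (auto simp: tau_fixed_units_def tau_fixed_def)
  have mem: "a * \<tau> a \<in> ?T" if a: "a \<in> ?A" for a
    using a norm_unit_iff[of a] ipow_multl[of a "\<tau> a" 0]
    by (auto simp: tau_fixed_units_def tau_fixed_def tau_mult mult.commute)
  have fib: "{a \<in> ?A \<inter> ?R. ?f a = d} = norm_fiber d \<inter> ?R" if d: "d \<in> ?T \<inter> ?R" for d
  proof -
    have "?f a = d \<longleftrightarrow> a * \<tau> a - d \<in> ipow 1" for a
      using rep_eq_iff[of "ipow 1" "a * \<tau> a" d] rep_reps[of "ipow 1" d] d by simp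
    then have "{a \<in> ?A \<inter> ?R. ?f a = d} = {a \<in> ?A \<inter> ?R. a * \<tau> a - d \<in> ipow 1}"
      by (simp only:)
    moreover have "d \<notin> ipow 1" using unitT d by blast
    then have "a \<in> ?A \<and> a * \<tau> a - d \<in> ipow 1 \<longleftrightarrow> a \<in> norm_fiber d" for a
      using norm_fiber_unit[of d a] unfolding norm_fiber_def by blast
    ultimately show ?thesis by blast
  qed
  have card_le: "cnt (ipow 1) (norm_fiber d) \<le> q + 1" if "d \<in> ?T" for d
    using cnt_norm_fiber_cases[of d] unitT[OF that] by (auto simp: cnt_def)
  have "card (?A \<inter> ?R) = (\<Sum>d\<in>?T \<inter> ?R. card {a \<in> ?A \<inter> ?R. ?f a = d})"
    using finA finT mem
    by (intro card_eq_sum_fibers) (auto simp: rep_mem_iff[OF subgroup_ipow satT])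
  also have "\<dots> = (\<Sum>d\<in>?T \<inter> ?R. cnt (ipow 1) (norm_fiber d))"
    using fib by (simp add: cnt_def)
  finally have sum: "(\<Sum>d\<in>?T \<inter> ?R. cnt (ipow 1) (norm_fiber d)) = q ^ 2 - 1"
    using cnt_units[of 1] by (simp add: cnt_def Q_eq)
  have full: "cnt (ipow 1) (norm_fiber d) = q + 1" if d: "d \<in> ?T \<inter> ?R" for d
  proof (rule ccontr)
    assume "cnt (ipow 1) (norm_fiber d) \<noteq> q + 1"
    then have "cnt (ipow 1) (norm_fiber d) < q + 1" using card_le[of d] d by auto
    then have "(\<Sum>d\<in>?T \<inter> ?R. cnt (ipow 1) (norm_fiber d)) < (\<Sum>d\<in>?T \<inter> ?R. q + 1)"
      using d card_le finT by (intro sum_strict_mono_ex1) auto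
    also have "\<dots> = (q - 1) * (q + 1)"
      using cnt_tau_fixed_units[of 1] by (simp add: cnt_def)
    also have "\<dots> = q ^ 2 - 1"
      by (simp add: algebra_simps power2_eq_square)
    finally show False using sum by simp
  qed
  let ?d = "rep (ipow 1) c"
  have "norm_fiber c = norm_fiber ?d"
  proof -
    have "a * \<tau> a - c - (a * \<tau> a - ?d) \<in> ipow 1" for a
      using rep_diff[OF subgroup_ipow, of 1 c] by simp
    then have "a * \<tau> a - c \<in> ipow 1 \<longleftrightarrow> a * \<tau> a - ?d \<in> ipow 1" for a
      by (rule ipow_cong)
    then show ?thesis
      unfolding norm_fiber_def by simp
  qed
  moreover have "?d \<in> ?T \<inter> ?R"
    using c by (simp add: rep_mem_iff[OF subgroup_ipow satT])
  ultimately show ?thesis using full by simp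
qed

text \<open>Successive approximation. If a \<tau> a - c = \<pi>^k d, then d is fixed modulo \<pp>.
  Replacing a by a - \<pi>^k b lowers the norm, to first order, by \<pi>^k times the trace of b
  \<tau> a, which can be made congruent to d.\<close>

lemma norm_surj:
  assumes c: "c \<in> tau_fixed_units k" and k: "0 < k"
  shows "\<exists>a\<in>ipow 0. a \<notin> ipow 1 \<and> a * \<tau> a - c \<in> ipow k"
  using assms
proof (induction k)
  case 0
  then show ?case by simp
next
  case (Suc k)
  have c0: "c \<in> ipow 0" "c \<notin> ipow 1" "c - \<tau> c \<in> ipow (Suc k)"
    using Suc.prems by (auto simp: tau_fixed_units_def tau_fixed_def)
  show ?case
  proof (cases "k = 0")
    case True
    then have Suc_k: "Suc k = 1" by (simp only: One_nat_def)
    then have "cnt (ipow 1) (norm_fiber c) = q + 1"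
      using Suc.prems(1) cnt_norm_fiber by metis
    then have "norm_fiber c \<noteq> {}" by (auto simp: cnt_def)
    then obtain a where "a \<in> norm_fiber c" by blast
    then show ?thesis
      unfolding Suc_k using norm_fiber_unit[OF c0(2)] unfolding norm_fiber_def by blast
  next
    case False
    have "c \<in> tau_fixed_units k"
      using c0 ipow_mono[of k "Suc k"] by (auto simp: tau_fixed_units_def tau_fixed_def)
    then obtain a where a: "a \<in> ipow 0" "a \<notin> ipow 1" "a * \<tau> a - c \<in> ipow k"
      using Suc.IH False by auto
    then obtain d where d: "d \<in> ipow 0" "a * \<tau> a - c = \<pi> ^ k * d"
      using ipow_iff by blast
    obtain c1 where c1: "c1 \<in> ipow 0" "c1 + \<tau> c1 = 1" using trace_one by blast
    have dd: "d - \<tau> d \<in> ipow 1"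
    proof -
      have "\<pi> ^ k * (d - \<tau> d) = - (c - \<tau> c)"
      proof -
        have "\<tau> (a * \<tau> a - c) = \<pi> ^ k * \<tau> d" by (simp add: d(2) tau_mult tau_power)
        then have "\<pi> ^ k * \<tau> d = a * \<tau> a - \<tau> c" by (simp add: tau_diff tau_mult mult.commute)
        then show ?thesis by (simp add: right_diff_distrib flip: d(2))
      qed
      then have "\<pi> ^ k * (d - \<tau> d) \<in> ipow (k + 1)" using ipow_comm[OF c0(3)] by simp
      then show ?thesis unfolding pi_mult_ipow_iff .
    qed
    \<comment> \<open>Chosen so that b \<tau> a = c1 d; as c1 has trace 1 and d is fixed modulo
      \<pp>, this product has trace d modulo \<pp>.\<close>
    define b where "b = c1 * d * inverse (\<tau> a)"
    have ia: "inverse (\<tau> a) \<in> ipow 0" using a by (intro unit_inverse) auto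
    have b0: "b \<in> ipow 0" unfolding b_def using c1 d ia by (intro ipow_multl ipow_multr) auto
    let ?a = "a - \<pi> ^ k * b"
    have pib: "\<pi> ^ k * b \<in> ipow k" using b0 ipow_iff by blast
    have "a \<noteq> 0" using a by auto
    then have ba: "b * \<tau> a = c1 * d" "a * \<tau> b = \<tau> c1 * \<tau> d"
      by (simp_all add: b_def tau_mult tau_inverse)
    have "?a * \<tau> ?a - c = \<pi> ^ k * d - \<pi> ^ k * (b * \<tau> a + a * \<tau> b) + \<pi> ^ k * (\<pi> ^ k * (b * \<tau> b))"
      using d(2) by (simp add: tau_diff tau_mult tau_power algebra_simps)
    also have "\<dots> = \<pi> ^ k * (d - (c1 * d + \<tau> c1 * \<tau> d) + \<pi> ^ k * (b * \<tau> b))"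
      by (simp add: ba algebra_simps)
    also have "d - (c1 * d + \<tau> c1 * \<tau> d) = \<tau> c1 * (d - \<tau> d)"
    proof -
      have "d = (c1 + \<tau> c1) * d" using c1 by simp
      then show ?thesis by (simp add: algebra_simps)
    qed
    finally have eq: "?a * \<tau> ?a - c = \<pi> ^ k * (\<tau> c1 * (d - \<tau> d) + \<pi> ^ k * (b * \<tau> b))" .
    have "\<pi> ^ k * (b * \<tau> b) \<in> ipow k"
      using b0 by (intro ipow_multr ipow_multl) auto
    then have "\<pi> ^ k * (b * \<tau> b) \<in> ipow 1"
      by (rule ipow_mono[rotated]) (use False in simp)
    moreover have "\<tau> c1 * (d - \<tau> d) \<in> ipow 1"
      using c1 dd by (intro ipow_multl) auto
    ultimately have "\<tau> c1 * (d - \<tau> d) + \<pi> ^ k * (b * \<tau> b) \<in> ipow 1"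
      by (rule ipow_add[rotated])
    then have "?a * \<tau> ?a - c \<in> ipow (k + 1)"
      unfolding eq pi_mult_ipow_iff .
    moreover have "?a \<in> ipow 0" using a pib ipow_mono[of 0 k] by (auto intro: ipow_diff)
    moreover have "?a \<notin> ipow 1"
    proof -
      have "?a - a \<in> ipow 1" using pib ipow_mono[of 1 k] False by auto
      then show ?thesis using a(2) unit_cong[of ?a a] by simp
    qed
    ultimately show ?thesis by (intro bexI[of _ ?a]) auto
  qed
qed

end

section \<open>Lattices with a sesquilinear form\<close>

locale lattice = field_with_involution v \<pi> \<tau> + vs: vector_space scale
  for v :: "'a::field \<Rightarrow> int" and \<pi> \<tau> and scale :: "'a \<Rightarrow> 'g::ab_group_add \<Rightarrow> 'g" (infixr \<open>\<cdot>\<close> 75) +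
  fixes Y :: "'g set"
  assumes Y_subgroup: "add_subgroup Y" and Y_scale: "a \<in> ipow 0 \<Longrightarrow> x \<in> Y \<Longrightarrow> a \<cdot> x \<in> Y"
begin

text \<open>Submodules of \<open>V/Y\<close> are represented by their preimages in the vector space \<open>V\<close>, and elements of
  \<open>V/Y\<close> by vectors in \<^term>\<open>reps Y\<close>.\<close>

definition osub :: "'g set \<Rightarrow> bool" where
  "osub X \<longleftrightarrow> add_subgroup X \<and> Y \<subseteq> X \<and> (\<forall>a\<in>ipow 0. \<forall>x\<in>X. a \<cdot> x \<in> X)"

definition tor :: "nat \<Rightarrow> 'g set \<Rightarrow> 'g set" where
  "tor k X = {x \<in> X. \<pi> ^ k \<cdot> x \<in> Y}"

text \<open>The orders of the torsion submodules of \<open>X/Y\<close> are those of the module of type \<open>ls\<close>. They serve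
  as a substitute for the type of \<open>X/Y\<close>, so that no classification of modules is needed.\<close>

definition type_inv :: "'g set \<Rightarrow> nat list \<Rightarrow> bool" where
  "type_inv X ls \<longleftrightarrow> (\<forall>j. cnt Y (tor j X) = Q ^ sum_list (map (min j) ls)) \<and> (\<exists>K. tor K X = X)"

lemma osub_subgroup: "osub X \<Longrightarrow> add_subgroup X"
  and osub_Y: "osub X \<Longrightarrow> Y \<subseteq> X"
  and osub_scale: "osub X \<Longrightarrow> a \<in> ipow 0 \<Longrightarrow> x \<in> X \<Longrightarrow> a \<cdot> x \<in> X"
  by (auto simp: osub_def)

lemma osub_saturated: "osub X \<Longrightarrow> saturated Y X"
  by (intro saturated_subgroup osub_subgroup osub_Y)

lemma pi_power_ipow_0 [simp]: "\<pi> ^ k \<in> ipow 0"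
  by (rule ipow_mono[OF _ pi_power_ipow]) simp

lemma scale_commute: "a \<cdot> (b \<cdot> x) = b \<cdot> (a \<cdot> x)"
  by (simp add: mult.commute)

lemma osub_tor:
  assumes X: "osub X"
  shows "osub (tor k X)"
proof -
  have "x - y \<in> tor k X" if "x \<in> tor k X" "y \<in> tor k X" for x y
    using that add_subgroup_diff[OF osub_subgroup[OF X]] add_subgroup_diff[OF Y_subgroup]
    by (auto simp: tor_def vs.scale_right_diff_distrib)
  moreover have "a \<cdot> x \<in> tor k X" if "a \<in> ipow 0" "x \<in> tor k X" for a x
    using that osub_scale[OF X] Y_scale scale_commute[of "\<pi> ^ k" a x]
    by (auto simp: tor_def simp del: vs.scale_scale)
  moreover have "x \<in> tor k X" if "x \<in> Y" for x
    using that osub_Y[OF X] Y_scale[OF pi_power_ipow_0] by (auto simp: tor_def)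
  moreover have "0 \<in> Y" by (rule add_subgroup_0[OF Y_subgroup])
  ultimately show ?thesis
    unfolding osub_def add_subgroup_def by blast
qed

lemma tor_mono: "j \<le> k \<Longrightarrow> tor j X \<subseteq> tor k X"
proof
  fix x assume "j \<le> k" "x \<in> tor j X"
  then have "\<pi> ^ (k - j) \<cdot> (\<pi> ^ j \<cdot> x) \<in> Y"
    by (simp only: Y_scale[OF pi_power_ipow_0] tor_def mem_Collect_eq)
  then have "\<pi> ^ k \<cdot> x \<in> Y"
    using \<open>j \<le> k\<close> by (simp flip: power_add)
  with \<open>x \<in> tor j X\<close> show "x \<in> tor k X" by (simp add: tor_def)
qed

lemma tor_subset: "tor k X \<subseteq> X"
  by (auto simp: tor_def)

lemma cnt_pos_finite: "cnt Y S > 0 \<Longrightarrow> finite (S \<inter> reps Y)"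
  by (simp add: cnt_def card_gt_0_iff)

lemma Q_pos: "Q > 0"
  using Q_ge_2 by simp

lemma sum_list_map_min:
  fixes ls :: "nat list"
  assumes "\<And>l. l \<in> set ls \<Longrightarrow> l \<le> k"
  shows "sum_list (map (min k) ls) = sum_list ls"
  using assms map_idI[of ls "min k"] by (simp add: min_def le_antisym)

text \<open>All parts being at most k, the k-torsion has the same finite order as a larger torsion
  submodule that is already everything, so the inclusion is an equality.\<close>

lemma type_inv_tor_all:
  assumes X: "osub X" and inv: "type_inv X ls" and k: "\<And>l. l \<in> set ls \<Longrightarrow> l \<le> k"
  shows "tor k X = X"
proof -
  obtain K where K: "tor K X = X" using inv by (auto simp: type_inv_def)
  let ?M = "max k K"
  have M: "tor ?M X = X"
    using K tor_mono[of K ?M X] tor_subset[of ?M X] by auto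
  have "sum_list (map (min ?M) ls) = sum_list ls"
    by (rule sum_list_map_min) (use k in fastforce)
  then have "cnt Y (tor k X) = cnt Y (tor ?M X)"
    using inv sum_list_map_min[of ls k] k by (simp add: type_inv_def)
  moreover have "finite (tor ?M X \<inter> reps Y)"
    using inv Q_pos by (intro cnt_pos_finite) (simp add: type_inv_def)
  moreover have "tor k X \<inter> reps Y \<subseteq> tor ?M X \<inter> reps Y"
    using tor_mono[of k ?M X] by auto
  ultimately have "tor k X \<inter> reps Y = tor ?M X \<inter> reps Y"
    unfolding cnt_def by (intro card_subset_eq)
  then have "tor k X = tor ?M X"
    by (rule saturated_eqI[OF Y_subgroup osub_saturated[OF osub_tor[OF X]] osub_saturated[OF osub_tor[OF X]]])
  with M show ?thesis by simp
qed

lemma type_inv_cnt: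
  assumes "osub X" "type_inv X ls"
  shows "cnt Y X = Q ^ sum_list ls"
proof -
  let ?k = "sum_list ls"
  have le: "l \<le> ?k" if "l \<in> set ls" for l using that by (intro member_le_sum_list) auto
  then have "cnt Y X = cnt Y (tor ?k X)" using type_inv_tor_all[OF assms] by simp
  also have "\<dots> = Q ^ sum_list ls"
    using assms sum_list_map_min[of ls ?k] le by (simp add: type_inv_def)
  finally show ?thesis .
qed

lemma type_inv_finite: "osub X \<Longrightarrow> type_inv X ls \<Longrightarrow> finite (X \<inter> reps Y)"
  by (rule cnt_pos_finite) (simp add: type_inv_cnt Q_pos)

text \<open>\<open>\<phi>\<close> is a coordinate function that splits off a cyclic summand generated by \<open>e\<close>.\<close>

lemma cnt_tor_split:
  assumes X: "osub X"
    and diff: "\<And>x y. x \<in> X \<Longrightarrow> y \<in> X \<Longrightarrow> \<phi> (x - y) = \<phi> x - \<phi> y"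
    and pi: "\<And>x j. x \<in> X \<Longrightarrow> \<phi> (\<pi> ^ j \<cdot> x) = \<pi> ^ j * \<phi> x"
    and \<phi>Y: "\<And>x. x \<in> Y \<Longrightarrow> \<phi> x \<in> ipow k" and \<phi>X: "\<And>x. x \<in> X \<Longrightarrow> \<phi> x \<in> ipow 0"
    and e: "e \<in> X" "\<pi> ^ k \<cdot> e \<in> Y"
    and \<rho>: "\<And>c i. c \<in> ipow i \<Longrightarrow> \<rho> c \<in> ipow i" "\<And>c. c \<in> ipow 0 \<Longrightarrow> \<phi> (\<rho> c \<cdot> e) - c \<in> ipow k"
  shows "cnt Y (tor j X) = cnt Y (tor j {x \<in> X. \<phi> x \<in> ipow k}) * Q ^ min j k"
proof -
  \<comment> \<open>On the j-torsion the coordinate takes exactly the values in \<pp>^(k-j) modulo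
    \<pp>^k, with truncated subtraction for j > k. The value c is attained at \<rho> c times e; in
    the applications \<rho> is the identity or \<tau>, according to the linearity of the
    coordinate.\<close>
  have "cnt Y (tor j X) = cnt Y {x \<in> tor j X. \<phi> x \<in> ipow k} * cnt (ipow k) (ipow (k - j))"
  proof (rule cnt_hom[OF Y_subgroup subgroup_ipow _ _ subgroup_ipow])
    show "add_subgroup (tor j X)" "Y \<subseteq> tor j X"
      using osub_tor[OF X] by (auto simp: osub_def)
    show "ipow k \<subseteq> ipow (k - j)" by (auto intro: ipow_mono[of "k - j" k])
    show "\<phi> x \<in> ipow (k - j)" if x: "x \<in> tor j X" for x
    proof (cases "j \<le> k")
      case True
      have "\<pi> ^ j * \<phi> x \<in> ipow (j + (k - j))"
        using x \<phi>Y[of "\<pi> ^ j \<cdot> x"] pi[of x j] True by (simp add: tor_def)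
      then show ?thesis unfolding pi_mult_ipow_iff .
    qed (use x \<phi>X in \<open>simp add: tor_def\<close>)
    show "\<exists>x\<in>tor j X. \<phi> x - c \<in> ipow k" if c: "c \<in> ipow (k - j)" for c
    proof (intro bexI)
      have c0: "c \<in> ipow 0" using c by (rule ipow_mono[rotated]) simp
      show "\<phi> (\<rho> c \<cdot> e) - c \<in> ipow k" using c0 by (rule \<rho>)
      have "\<pi> ^ j * \<rho> c \<in> ipow (j + (k - j))" using \<rho>(1)[OF c] by (simp only: pi_mult_ipow_iff)
      then have "\<pi> ^ j * \<rho> c \<in> ipow k" by (rule ipow_mono[rotated]) simp
      then obtain b where b: "b \<in> ipow 0" "\<pi> ^ j * \<rho> c = \<pi> ^ k * b" using ipow_iff by blast
      have "\<pi> ^ j \<cdot> (\<rho> c \<cdot> e) = b \<cdot> (\<pi> ^ k \<cdot> e)"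
        by (simp only: vs.scale_scale b(2) mult.commute[of b])
      also have "\<dots> \<in> Y" using b(1) e(2) by (rule Y_scale)
      finally show "\<rho> c \<cdot> e \<in> tor j X"
        using osub_scale[OF X \<rho>(1)[OF c0] e(1)] by (simp add: tor_def)
    qed
  qed (use diff \<phi>Y in \<open>auto simp: tor_def\<close>)
  moreover have "{x \<in> tor j X. \<phi> x \<in> ipow k} = tor j {x \<in> X. \<phi> x \<in> ipow k}"
    by (auto simp: tor_def)
  moreover have "k - (k - j) = min j k" by simp
  ultimately show ?thesis by (simp add: cnt_ipow)
qed

text \<open>The factor \<open>Q ^ min j k\<close> is what the part k contributes to the order of the
  j-torsion, so it cancels for every j.\<close>

lemma type_inv_split:
  assumes X: "osub X"
    and "\<And>x y. x \<in> X \<Longrightarrow> y \<in> X \<Longrightarrow> \<phi> (x - y) = \<phi> x - \<phi> y"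
    and "\<And>x j. x \<in> X \<Longrightarrow> \<phi> (\<pi> ^ j \<cdot> x) = \<pi> ^ j * \<phi> x"
    and "\<And>x. x \<in> Y \<Longrightarrow> \<phi> x \<in> ipow k" and "\<And>x. x \<in> X \<Longrightarrow> \<phi> x \<in> ipow 0"
    and "e \<in> X" "\<pi> ^ k \<cdot> e \<in> Y"
    and "\<And>c i. c \<in> ipow i \<Longrightarrow> \<rho> c \<in> ipow i" "\<And>c. c \<in> ipow 0 \<Longrightarrow> \<phi> (\<rho> c \<cdot> e) - c \<in> ipow k"
    and inv: "type_inv X (k # ls)"
  shows "type_inv {x \<in> X. \<phi> x \<in> ipow k} ls"
proof -
  note split = cnt_tor_split[OF assms(1-9)]
  have "cnt Y (tor j {x \<in> X. \<phi> x \<in> ipow k}) = Q ^ sum_list (map (min j) ls)" for j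
    using split[of j] inv Q_pos by (simp add: type_inv_def power_add)
  moreover obtain K where "tor K X = X" using inv by (auto simp: type_inv_def)
  then have "tor K {x \<in> X. \<phi> x \<in> ipow k} = {x \<in> X. \<phi> x \<in> ipow k}"
    by (auto simp: tor_def)
  ultimately show ?thesis by (auto simp: type_inv_def)
qed

end

section \<open>Perfect pairings and dual vectors\<close>

locale sesquilinear = lattice +
  fixes B :: "'b \<Rightarrow> 'b \<Rightarrow> 'a"
  assumes B_add_left: "B (x + y) z = B x z + B y z" and B_add_right: "B z (x + y) = B z x + B z y"
    and B_scale_left: "B (a \<cdot> x) y = \<tau> a * B x y" and B_scale_right: "B x (a \<cdot> y) = a * B x y"
begin

lemma B_0_left [simp]: "B 0 x = 0" and B_0_right [simp]: "B x 0 = 0"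
  using B_scale_left[of 0 0 x] B_scale_right[of x 0 0] by auto

lemma B_uminus_left: "B (- x) y = - B x y"
  using B_add_left[of x "- x" y] by (simp add: eq_neg_iff_add_eq_0 add.commute)

lemma B_uminus_right: "B x (- y) = - B x y"
  using B_add_right[of x y "- y"] by (simp add: eq_neg_iff_add_eq_0 add.commute)

lemma B_diff_left: "B (x - y) z = B x z - B y z"
  using B_add_left[of x "- y" z] B_uminus_left[of y z] by simp

lemma B_diff_right: "B z (x - y) = B z x - B z y"
  using B_add_right[of z x "- y"] B_uminus_right[of z y] by simp

lemma B_sum_left: "B (\<Sum>i\<in>I. f i) y = (\<Sum>i\<in>I. B (f i) y)"
  by (induction I rule: infinite_finite_induct) (simp_all add: B_add_left)

lemma B_sum_right: "B y (\<Sum>i\<in>I. f i) = (\<Sum>i\<in>I. B y (f i))"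
  by (induction I rule: infinite_finite_induct) (simp_all add: B_add_right)

lemma B_pi_left: "B (\<pi> ^ k \<cdot> x) y = \<pi> ^ k * B x y"
  by (simp add: B_scale_left tau_power)

text \<open>The pairing \<open>X/Y \<times> X'/Y \<rightarrow> F/\<oo>\<close> induced by \<open>B\<close> is well defined and nondegenerate.\<close>

definition perf :: "'b set \<Rightarrow> 'b set \<Rightarrow> bool" where
  "perf X X' \<longleftrightarrow> osub X \<and> osub X' \<and>
     (\<forall>x\<in>Y. \<forall>y\<in>X'. B x y \<in> ipow 0) \<and> (\<forall>x\<in>X. \<forall>y\<in>Y. B x y \<in> ipow 0) \<and>
     (\<forall>x\<in>X. (\<forall>y\<in>X'. B x y \<in> ipow 0) \<longrightarrow> x \<in> Y) \<and>
     (\<forall>y\<in>X'. (\<forall>x\<in>X. B x y \<in> ipow 0) \<longrightarrow> y \<in> Y)"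

context
  fixes X X' :: "'b set"
  assumes perf: "perf X X'"
begin

lemma perf_osub: "osub X" "osub X'"
  using perf by (auto simp: perf_def)

lemma perf_Y_left: "x \<in> Y \<Longrightarrow> y \<in> X' \<Longrightarrow> B x y \<in> ipow 0"
  and perf_Y_right: "x \<in> X \<Longrightarrow> y \<in> Y \<Longrightarrow> B x y \<in> ipow 0"
  using perf by (auto simp: perf_def)

lemma perf_left: "x \<in> X \<Longrightarrow> (\<And>y. y \<in> X' \<Longrightarrow> B x y \<in> ipow 0) \<Longrightarrow> x \<in> Y"
  and perf_right: "y \<in> X' \<Longrightarrow> (\<And>x. x \<in> X \<Longrightarrow> B x y \<in> ipow 0) \<Longrightarrow> y \<in> Y"
  using perf by (auto simp: perf_def)

lemma pi_B_left: "\<pi> ^ k \<cdot> x \<in> Y \<Longrightarrow> y \<in> X' \<Longrightarrow> \<pi> ^ k * B x y \<in> ipow 0"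
  using perf_Y_left[of "\<pi> ^ k \<cdot> x" y] by (simp add: B_pi_left)

lemma pi_B_right: "x \<in> X \<Longrightarrow> \<pi> ^ k \<cdot> y \<in> Y \<Longrightarrow> \<pi> ^ k * B x y \<in> ipow 0"
  using perf_Y_right[of x "\<pi> ^ k \<cdot> y"] by (simp add: B_scale_right)

lemma B_cong:
  assumes "x - x' \<in> Y" "y - y' \<in> Y" "x \<in> X" "x' \<in> X" "y \<in> X'" "y' \<in> X'"
  shows "B x y - B x' y' \<in> ipow 0"
proof -
  have "B x y - B x' y' = B (x - x') y + B x' (y - y')"
    by (simp add: B_diff_left B_diff_right)
  also have "\<dots> \<in> ipow 0"
    using assms perf_Y_left perf_Y_right by (intro ipow_add) auto
  finally show ?thesis .
qed

context
  fixes k :: nat and e f :: 'b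
  assumes e: "e \<in> X" "\<pi> ^ k \<cdot> e \<in> Y" and f: "f \<in> X'" "\<pi> ^ k \<cdot> f \<in> Y"
    and ef: "B e f - 1 / \<pi> ^ k \<in> ipow 0"
begin

lemma pi_ef: "\<pi> ^ k * B e f - 1 \<in> ipow k"
proof -
  have "\<pi> ^ k * (B e f - 1 / \<pi> ^ k) \<in> ipow (k + 0)"
    using ef by (simp only: pi_mult_ipow_iff)
  then show ?thesis by (simp add: right_diff_distrib)
qed

lemma mem_ipow_k_iff: "\<pi> ^ k * c \<in> ipow k \<longleftrightarrow> c \<in> ipow 0"
  using pi_mult_ipow_iff[of k c 0] by simp

lemma perf_split_eq:
  "{x \<in> X. \<pi> ^ k * B x f \<in> ipow k} = {x \<in> X. B x f \<in> ipow 0}"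
  "{y \<in> X'. \<pi> ^ k * B e y \<in> ipow k} = {y \<in> X'. B e y \<in> ipow 0}"
  by (simp_all add: mem_ipow_k_iff)

text \<open>The coordinate along \<open>e\<close> is \<open>\<pi> ^ k * B x f\<close>. It is
  conjugate linear in x, so the value c is attained at \<tau> c times \<open>e\<close>.\<close>

lemma type_inv_split_left:
  assumes "type_inv X (k # ls)"
  shows "type_inv {x \<in> X. B x f \<in> ipow 0} ls"
  unfolding perf_split_eq(1)[symmetric]
proof (rule type_inv_split[where e = e and \<rho> = \<tau>])
  show "\<pi> ^ k * B (\<tau> c \<cdot> e) f - c \<in> ipow k" if "c \<in> ipow 0" for c
  proof -
    have "\<pi> ^ k * B (\<tau> c \<cdot> e) f - c = c * (\<pi> ^ k * B e f - 1)"
      by (simp add: B_scale_left algebra_simps)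
    then show ?thesis using that pi_ef by (simp add: ipow_multl)
  qed
qed (use assms e f perf_osub perf_Y_left pi_B_right in
    \<open>auto simp: B_diff_left B_pi_left right_diff_distrib mem_ipow_k_iff mult.left_commute\<close>)

lemma type_inv_split_right:
  assumes "type_inv X' (k # ls)"
  shows "type_inv {y \<in> X'. B e y \<in> ipow 0} ls"
  unfolding perf_split_eq(2)[symmetric]
proof (rule type_inv_split[where e = f and \<rho> = "\<lambda>c. c"])
  show "\<pi> ^ k * B e (c \<cdot> f) - c \<in> ipow k" if "c \<in> ipow 0" for c
  proof -
    have "\<pi> ^ k * B e (c \<cdot> f) - c = c * (\<pi> ^ k * B e f - 1)"
      by (simp add: B_scale_right algebra_simps)
    then show ?thesis using that pi_ef by (simp add: ipow_multl)
  qed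
qed (use assms e f perf_osub perf_Y_right pi_B_left in
    \<open>auto simp: B_diff_right B_scale_right right_diff_distrib mem_ipow_k_iff mult.left_commute\<close>)

text \<open>Projection along \<open>f\<close>. The Gram condition holds only modulo \<oo>, but its
  scaled error lies in \<pp>^k, which compensates the denominator \<pi>^k of
  \<open>B e y\<close>.\<close>

lemma split_right:
  assumes y: "y \<in> X'"
  shows "y - (\<pi> ^ k * B e y) \<cdot> f \<in> {y \<in> X'. B e y \<in> ipow 0}"
proof -
  have a: "\<pi> ^ k * B e y \<in> ipow 0" using e(2) y by (rule pi_B_left)
  have "y - (\<pi> ^ k * B e y) \<cdot> f \<in> X'"
    using y f(1) a perf_osub(2) by (intro add_subgroup_diff osub_subgroup osub_scale)
  moreover have "B e (y - (\<pi> ^ k * B e y) \<cdot> f) = - (B e y * (\<pi> ^ k * B e f - 1))"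
    by (simp add: B_diff_right B_scale_right algebra_simps)
  moreover have "B e y * (\<pi> ^ k * B e f - 1) \<in> ipow 0"
  proof -
    obtain c where c: "c \<in> ipow 0" "\<pi> ^ k * B e f - 1 = \<pi> ^ k * c" using pi_ef ipow_iff by blast
    have "B e y * (\<pi> ^ k * B e f - 1) = (\<pi> ^ k * B e y) * c" by (simp add: c(2))
    then show ?thesis using a c(1) by (simp only: ipow_multl)
  qed
  ultimately show ?thesis by simp
qed

lemma split_left:
  assumes x: "x \<in> X"
  shows "x - \<tau> (\<pi> ^ k * B x f) \<cdot> e \<in> {x \<in> X. B x f \<in> ipow 0}"
proof -
  have a: "\<pi> ^ k * B x f \<in> ipow 0" using x f(2) by (rule pi_B_right)
  have "x - \<tau> (\<pi> ^ k * B x f) \<cdot> e \<in> X"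
    using x e(1) a perf_osub(1) by (intro add_subgroup_diff osub_subgroup osub_scale) auto
  moreover have "B (x - \<tau> (\<pi> ^ k * B x f) \<cdot> e) f = - (B x f * (\<pi> ^ k * B e f - 1))"
    by (simp only: B_diff_left B_scale_left tau_tau) (simp add: algebra_simps)
  moreover have "B x f * (\<pi> ^ k * B e f - 1) \<in> ipow 0"
  proof -
    obtain c where c: "c \<in> ipow 0" "\<pi> ^ k * B e f - 1 = \<pi> ^ k * c" using pi_ef ipow_iff by blast
    have "B x f * (\<pi> ^ k * B e f - 1) = (\<pi> ^ k * B x f) * c" by (simp add: c(2))
    then show ?thesis using a c(1) by (simp only: ipow_multl)
  qed
  ultimately show ?thesis by simp
qed

text \<open>By the projections, every vector of \<open>X'\<close> is one of its complement plus a
  multiple of \<open>f\<close>, and a vector of the other complement pairs integrally with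
  \<open>f\<close> anyway. So pairing integrally with the complement amounts to pairing integrally
  with all of \<open>X'\<close>; the other side is symmetric.\<close>

lemma perf_split: "perf {x \<in> X. B x f \<in> ipow 0} {y \<in> X'. B e y \<in> ipow 0}"
proof -
  let ?X = "{x \<in> X. B x f \<in> ipow 0}" and ?X' = "{y \<in> X'. B e y \<in> ipow 0}"
  have "osub ?X" "osub ?X'"
    using perf_osub perf_Y_left perf_Y_right e(1) f(1)
    by (auto simp: osub_def add_subgroup_def B_diff_left B_diff_right B_scale_left B_scale_right
        intro: ipow_diff ipow_multl)
  moreover have "x \<in> Y" if x: "x \<in> ?X" and *: "\<forall>y\<in>?X'. B x y \<in> ipow 0" for x
  proof (rule perf_left)
    fix y assume y: "y \<in> X'"
    have "B x (y - (\<pi> ^ k * B e y) \<cdot> f) \<in> ipow 0" using * split_right[OF y] by blast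
    moreover have "(\<pi> ^ k * B e y) * B x f \<in> ipow 0"
      by (rule ipow_multl[OF pi_B_left[OF e(2) y]]) (use x in simp)
    ultimately have "B x (y - (\<pi> ^ k * B e y) \<cdot> f) + (\<pi> ^ k * B e y) * B x f \<in> ipow 0"
      by (rule ipow_add)
    then show "B x y \<in> ipow 0" by (simp add: B_diff_right B_scale_right)
  qed (use x in auto)
  moreover have "y \<in> Y" if y: "y \<in> ?X'" and *: "\<forall>x\<in>?X. B x y \<in> ipow 0" for y
  proof (rule perf_right)
    fix x assume x: "x \<in> X"
    have "B (x - \<tau> (\<pi> ^ k * B x f) \<cdot> e) y \<in> ipow 0" using * split_left[OF x] by blast
    moreover have "(\<pi> ^ k * B x f) * B e y \<in> ipow 0"
      by (rule ipow_multl[OF pi_B_right[OF x f(2)]]) (use y in simp)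
    ultimately have "B (x - \<tau> (\<pi> ^ k * B x f) \<cdot> e) y + (\<pi> ^ k * B x f) * B e y \<in> ipow 0"
      by (rule ipow_add)
    then show "B x y \<in> ipow 0" by (simp only: B_diff_left B_scale_left tau_tau diff_add_cancel)
  qed (use y in auto)
  ultimately show ?thesis
    unfolding perf_def using perf_Y_left perf_Y_right by blast
qed

end

text \<open>As \<pi>^l x is nonzero modulo \<open>Y\<close>, it pairs to a value outside \<oo> with
  some y, whereas \<pi>^(l+1) x pairs integrally; so the pairing scaled by \<pi>^(l+1) is a
  unit.\<close>

lemma exists_dual_vector:
  assumes x: "x \<in> X" "\<pi> ^ Suc l \<cdot> x \<in> Y" "\<pi> ^ l \<cdot> x \<notin> Y"
  shows "\<exists>y\<in>X'. \<pi> ^ Suc l * B x y \<in> ipow 0 \<and> \<pi> ^ Suc l * B x y \<notin> ipow 1"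
proof -
  have "\<pi> ^ l \<cdot> x \<in> X"
    using x perf_osub(1) by (intro osub_scale) auto
  then obtain y where y: "y \<in> X'" "B (\<pi> ^ l \<cdot> x) y \<notin> ipow 0"
    using perf_left x(3) by blast
  have "\<pi> ^ 1 * B (\<pi> ^ l \<cdot> x) y \<notin> ipow (1 + 0)"
    using y(2) by (simp only: pi_mult_ipow_iff not_False_eq_True)
  then have "\<pi> ^ Suc l * B x y \<notin> ipow 1" by (simp add: B_pi_left mult.assoc)
  then show ?thesis using pi_B_left[OF x(2) y(1)] y(1) by blast
qed

text \<open>The partners of x form the fibre over 1 of the map sending y to \<pi>^(l+1) B(x, y).
  This map is onto \<oo> modulo \<pp>^(l+1), and the fibre over 1 is as large as the kernel.\<close>

lemma cnt_dual_vectors: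
  assumes x: "x \<in> X" "\<pi> ^ Suc l \<cdot> x \<in> Y" "\<pi> ^ l \<cdot> x \<notin> Y"
  shows "cnt Y X' = cnt Y {y \<in> X'. B x y - 1 / \<pi> ^ Suc l \<in> ipow 0} * Q ^ Suc l"
proof -
  let ?f = "\<lambda>y. \<pi> ^ Suc l * B x y"
  obtain y0 where y0: "y0 \<in> X'" "?f y0 \<in> ipow 0" "?f y0 \<notin> ipow 1"
    using exists_dual_vector[OF x] by blast
  have iu: "inverse (?f y0) \<in> ipow 0" using y0 by (intro unit_inverse)
  have surj: "\<exists>y\<in>X'. ?f y - c \<in> ipow (Suc l)" if c: "c \<in> ipow 0" for c
  proof (intro bexI)
    have "?f y0 \<noteq> 0" by (rule unit_neq_0[OF y0(3)])
    then have "?f ((c * inverse (?f y0)) \<cdot> y0) = c"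
      unfolding B_scale_right by (simp add: field_simps)
    then show "?f ((c * inverse (?f y0)) \<cdot> y0) - c \<in> ipow (Suc l)" by simp
    show "(c * inverse (?f y0)) \<cdot> y0 \<in> X'"
      using c iu y0(1) perf_osub(2) by (intro osub_scale ipow_multl)
  qed
  have diff: "?f (y - z) = ?f y - ?f z" for y z
    by (simp add: B_diff_right right_diff_distrib)
  have fY: "?f y \<in> ipow (Suc l)" if "y \<in> Y" for y
    using perf_Y_right[OF x(1) that] pi_mult_ipow_iff[of "Suc l" "B x y" 0] by simp
  have X': "add_subgroup X'" "Y \<subseteq> X'" using perf_osub(2) by (auto simp: osub_def)
  have "cnt Y X' = cnt Y {y \<in> X'. ?f y \<in> ipow (Suc l)} * cnt (ipow (Suc l)) (ipow 0)"
  proof (rule cnt_hom[OF Y_subgroup subgroup_ipow X' subgroup_ipow])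
    show "?f y \<in> ipow 0" if "y \<in> X'" for y using pi_B_left[OF x(2) that] .
    show "ipow (Suc l) \<subseteq> ipow 0" by (auto intro: ipow_mono[of 0])
  qed (use diff fY surj in auto)
  moreover obtain y1 where y1: "y1 \<in> X'" "?f y1 - 1 \<in> ipow (Suc l)" using surj[of 1] by auto
  have "cnt Y {y \<in> X'. ?f y - 1 \<in> ipow (Suc l)} = cnt Y {y \<in> X'. ?f y \<in> ipow (Suc l)}"
    by (rule cnt_fiber[OF Y_subgroup subgroup_ipow X' diff fY y1])
  moreover have "?f y - 1 \<in> ipow (Suc l) \<longleftrightarrow> B x y - 1 / \<pi> ^ Suc l \<in> ipow 0" for y
  proof -
    have "\<pi> ^ Suc l * (B x y - 1 / \<pi> ^ Suc l) = ?f y - 1" by (simp add: right_diff_distrib)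
    then show ?thesis using pi_mult_ipow_iff[of "Suc l" "B x y - 1 / \<pi> ^ Suc l" 0] by simp
  qed
  ultimately show ?thesis by (simp add: cnt_ipow_0)
qed

lemma card_dual_pairs:
  assumes finX: "finite (X \<inter> reps Y)" and finX': "finite (X' \<inter> reps Y)" and tor: "tor (Suc l) X = X"
  shows "card {(x, y). x \<in> X \<inter> reps Y \<and> y \<in> X' \<inter> reps Y \<and> B x y - 1 / \<pi> ^ Suc l \<in> ipow 0} * Q ^ Suc l =
    (cnt Y X - cnt Y (tor l X)) * cnt Y X'"
proof -
  let ?D = "\<lambda>x. {y \<in> X'. B x y - 1 / \<pi> ^ Suc l \<in> ipow 0} \<inter> reps Y"
  let ?A = "X \<inter> reps Y - tor l X \<inter> reps Y"
  \<comment> \<open>A vector killed by \<pi>^l has no partner: otherwise 1 / \<pi> would be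
    integral.\<close>
  have empty: "?D x = {}" if x: "x \<in> tor l X" for x
  proof -
    have "B x y - 1 / \<pi> ^ Suc l \<notin> ipow 0" if y: "y \<in> X'" for y
    proof
      assume "B x y - 1 / \<pi> ^ Suc l \<in> ipow 0"
      then have "\<pi> ^ l * (B x y - 1 / \<pi> ^ Suc l) \<in> ipow 0"
        by (rule ipow_multl[OF pi_power_ipow_0])
      moreover have "\<pi> ^ l * B x y \<in> ipow 0"
        using x y by (intro pi_B_left) (auto simp: tor_def)
      ultimately have "\<pi> ^ l * B x y - \<pi> ^ l * (B x y - 1 / \<pi> ^ Suc l) \<in> ipow 0"
        by (rule ipow_diff[rotated])
      moreover have "\<pi> ^ l * B x y - \<pi> ^ l * (B x y - 1 / \<pi> ^ Suc l) = 1 / \<pi> ^ 1"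
        by (simp add: right_diff_distrib)
      ultimately have "(1::'a) \<in> ipow 1"
        using div_pi_ipow_iff[of 1 1] by simp
      then show False by simp
    qed
    then show ?thesis by blast
  qed
  have fib: "card (?D x) * Q ^ Suc l = cnt Y X'" if x: "x \<in> ?A" for x
  proof -
    have "x \<in> X" "x \<in> tor (Suc l) X" "x \<notin> tor l X" using x tor by auto
    then have "\<pi> ^ Suc l \<cdot> x \<in> Y" "\<pi> ^ l \<cdot> x \<notin> Y" unfolding tor_def by blast+
    from cnt_dual_vectors[OF \<open>x \<in> X\<close> this] show ?thesis by (simp only: cnt_def)
  qed
  have finD: "finite (?D x)" for x by (rule finite_subset[OF _ finX']) auto
  have "{(x, y). x \<in> X \<inter> reps Y \<and> y \<in> X' \<inter> reps Y \<and> B x y - 1 / \<pi> ^ Suc l \<in> ipow 0} = Sigma ?A ?D"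
    using empty by blast
  then have "card {(x, y). x \<in> X \<inter> reps Y \<and> y \<in> X' \<inter> reps Y \<and> B x y - 1 / \<pi> ^ Suc l \<in> ipow 0} * Q ^ Suc l =
      (\<Sum>x\<in>?A. card (?D x)) * Q ^ Suc l"
    using finX finD by (simp add: card_SigmaI)
  also have "\<dots> = (\<Sum>x\<in>?A. cnt Y X')"
    unfolding sum_distrib_right using fib by (intro sum.cong) auto
  also have "\<dots> = card ?A * cnt Y X'" by simp
  also have "card ?A = cnt Y X - cnt Y (tor l X)"
    unfolding cnt_def using finX
    by (intro card_Diff_subset) (auto simp: tor_def intro: finite_subset[of _ "X \<inter> reps Y"])
  finally show ?thesis .
qed

end

end

section \<open>Frames\<close>

text \<open>Members may be vectors or pairs of vectors, so that one recursion serves all three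
  cases. Orthogonality is asked of earlier against later members only, which matches choosing the
  members one after the other.\<close>

definition frames :: "(nat \<Rightarrow> 'z \<Rightarrow> bool) \<Rightarrow> ('z \<Rightarrow> 'z \<Rightarrow> bool) \<Rightarrow> 'z set \<Rightarrow> nat list \<Rightarrow> 'z list set" where
  "frames g orth S ks = {zs. length zs = length ks \<and> set zs \<subseteq> S \<and> (\<forall>i<length ks. g (ks ! i) (zs ! i)) \<and>
     (\<forall>j<length ks. \<forall>i<j. orth (zs ! i) (zs ! j))}"

lemma frames_Nil: "frames g orth S [] = {[]}"
  by (auto simp: frames_def)

lemma frames_ConsI:
  "z # zs \<in> frames g orth S (k # ks) \<longleftrightarrow> z \<in> S \<and> g k z \<and> zs \<in> frames g orth {z' \<in> S. orth z z'} ks"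
proof -
  have "(\<forall>j<Suc (length ks). \<forall>i<j. orth ((z # zs) ! i) ((z # zs) ! j)) \<longleftrightarrow>
      (\<forall>j<length ks. orth z (zs ! j)) \<and> (\<forall>j<length ks. \<forall>i<j. orth (zs ! i) (zs ! j))"
    unfolding All_less_Suc2 by auto
  moreover have "(\<forall>i<Suc (length ks). g ((k # ks) ! i) ((z # zs) ! i)) \<longleftrightarrow>
      g k z \<and> (\<forall>i<length ks. g (ks ! i) (zs ! i))"
    unfolding All_less_Suc2 by simp
  moreover have "set zs \<subseteq> {z' \<in> S. orth z z'} \<longleftrightarrow> set zs \<subseteq> S \<and> (\<forall>j<length ks. orth z (zs ! j))"
    if "length zs = length ks"
    unfolding that[symmetric] all_set_conv_all_nth[symmetric] by blast
  ultimately show ?thesis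
    unfolding frames_def mem_Collect_eq length_Cons by auto
qed

lemma frames_Cons:
  "frames g orth S (k # ks) = (\<lambda>(z, zs). z # zs) ` Sigma {z \<in> S. g k z} (\<lambda>z. frames g orth {z' \<in> S. orth z z'} ks)"
proof (rule Set.set_eqI)
  fix zs
  show "zs \<in> frames g orth S (k # ks) \<longleftrightarrow> zs \<in> (\<lambda>(z, zs). z # zs) `
      Sigma {z \<in> S. g k z} (\<lambda>z. frames g orth {z' \<in> S. orth z z'} ks)"
  proof (cases zs)
    case (Cons z ws)
    then show ?thesis by (auto simp: frames_ConsI image_iff)
  qed (auto simp: frames_def)
qed

text \<open>The invariant \<open>Inv\<close> is to record that S represents a space whose type is
  given by the remaining parts. The number of choices for the first member then depends on the type
  only, and every choice leaves a complement with the same count.\<close>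

lemma card_frames:
  fixes F :: "nat list \<Rightarrow> real"
  assumes "Inv S ks" and F: "F [] = 1"
    and fin: "\<And>S k ks. Inv S (k # ks) \<Longrightarrow> finite S"
    and step: "\<And>S k ks. Inv S (k # ks) \<Longrightarrow> real (card {z \<in> S. g k z}) * F ks = F (k # ks)"
    and Inv: "\<And>S k ks z. Inv S (k # ks) \<Longrightarrow> z \<in> S \<Longrightarrow> g k z \<Longrightarrow> Inv {z' \<in> S. orth z z'} ks"
  shows "finite (frames g orth S ks) \<and> real (card (frames g orth S ks)) = F ks"
  using assms(1)
proof (induction ks arbitrary: S)
  case Nil
  then show ?case by (simp add: frames_Nil F)
next
  case (Cons k ks)
  let ?G = "{z \<in> S. g k z}" and ?H = "\<lambda>z. frames g orth {z' \<in> S. orth z z'} ks"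
  have IH: "finite (?H z) \<and> real (card (?H z)) = F ks" if "z \<in> ?G" for z
    using that Cons.prems by (intro Cons.IH Inv) auto
  have fin: "finite ?G" using fin[OF Cons.prems] by simp
  have inj: "inj_on (\<lambda>(z, zs). z # zs) (Sigma ?G ?H)" by (auto simp: inj_on_def)
  have "real (card (frames g orth S (k # ks))) = real (\<Sum>z\<in>?G. card (?H z))"
    unfolding frames_Cons using IH fin by (simp add: card_image[OF inj] card_SigmaI)
  also have "\<dots> = real (card ?G) * F ks"
    using IH by simp
  also have "\<dots> = F (k # ks)" by (rule step[OF Cons.prems])
  finally show ?case
    unfolding frames_Cons using IH fin by (auto intro!: finite_imageI finite_SigmaI)
qed

section \<open>Recursions over the parts of a partition\<close>

lemma b_part_Nil [simp]: "b_part [] s = 1"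
  by (simp add: b_part_def)

text \<open>Only the Pochhammer product of the part k changes; it acquires the factor whose exponent
  is the new multiplicity.\<close>

lemma b_part_Cons: "b_part (k # ks) s = (1 - s ^ count_list (k # ks) k) * b_part ks s"
proof -
  have rest: "(\<Prod>i\<in>set ks - {k}. qpoch s s (count_list (k # ks) i)) = (\<Prod>i\<in>set ks - {k}. qpoch s s (count_list ks i))"
    by (rule prod.cong) auto
  have head: "qpoch s s (count_list (k # ks) k) = (1 - s ^ count_list (k # ks) k) * qpoch s s (count_list ks k)"
    by (simp add: qpoch_def mult.commute)
  have "b_part (k # ks) s = qpoch s s (count_list (k # ks) k) * (\<Prod>i\<in>set ks - {k}. qpoch s s (count_list (k # ks) i))"
    unfolding b_part_def by (subst prod.remove[of _ k]) (auto simp: insert_Diff_if)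
  also have "\<dots> = (1 - s ^ count_list (k # ks) k) *
      (qpoch s s (count_list ks k) * (\<Prod>i\<in>set ks - {k}. qpoch s s (count_list ks i)))"
    by (simp only: rest head mult.assoc)
  also have "qpoch s s (count_list ks k) * (\<Prod>i\<in>set ks - {k}. qpoch s s (count_list ks i)) = b_part ks s"
  proof (cases "k \<in> set ks")
    case True
    then show ?thesis unfolding b_part_def by (subst (2) prod.remove[of _ k]) auto
  next
    case False
    then have "count_list ks k = 0" by (simp add: count_list_0_iff)
    then show ?thesis using False by (simp add: b_part_def qpoch_def)
  qed
  finally show ?thesis .
qed

lemma n_part_Nil [simp]: "n_part [] = 0"
  by (simp add: n_part_def)

text \<open>Every remaining part moves up by one index.\<close>

lemma n_part_Cons: "n_part (k # ks) = n_part ks + sum_list ks"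
  unfolding n_part_def length_Cons
  by (simp add: sum.lessThan_Suc_shift sum.distrib sum_list_sum_nth atLeast0LessThan del: sum.lessThan_Suc)

lemma is_partition_Cons:
  "is_partition (k # ks) \<longleftrightarrow> 0 < k \<and> (\<forall>l\<in>set ks. l \<le> k) \<and> is_partition ks"
  by (auto simp: is_partition_def)

lemma is_partition_tl: "is_partition (k # ks) \<Longrightarrow> is_partition ks"
  by (simp add: is_partition_Cons)

lemma is_partition_le: "is_partition (k # ks) \<Longrightarrow> l \<in> set (k # ks) \<Longrightarrow> l \<le> k"
  by (auto simp: is_partition_Cons)

text \<open>Truncation at l takes 1 off each part equal to l + 1.\<close>

lemma sum_list_map_min_Suc:
  assumes "\<forall>x\<in>set ls. x \<le> Suc l"
  shows "sum_list (map (min l) ls) + count_list ls (Suc l) = sum_list ls"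
  using assms
proof (induction ls)
  case (Cons a ls)
  then have "min l a + (if a = Suc l then 1 else 0) = a"
    by (auto simp: min_def)
  with Cons show ?case by auto
qed simp

lemma double_parts_Nil [simp]: "double_parts [] = []"
  and double_parts_Cons [simp]: "double_parts (k # ks) = k # k # double_parts ks"
  by (simp_all add: double_parts_def)

lemma set_double_parts [simp]: "set (double_parts ks) = set ks"
  by (induction ks) auto

lemma length_double_parts [simp]: "length (double_parts ks) = 2 * length ks"
  by (induction ks) auto

lemma sum_list_double_parts [simp]: "sum_list (double_parts ks) = 2 * sum_list ks"
  by (induction ks) auto

lemma count_list_double_parts [simp]: "count_list (double_parts ks) k = 2 * count_list ks k"
  by (induction ks) auto

text \<open>Here Q^(T + m) is the order of the space, Q^T that of its torsion one step below the
  exponent k, and m the multiplicity of k in its type. The exponent M is what remains of the squared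
  order after division by Q^k.\<close>

lemma dual_pair_count:
  fixes Q c :: nat
  assumes "Q > 0" "c * Q ^ k = (Q ^ (T + m) - Q ^ T) * Q ^ (T + m)" and "2 * (T + m) = k + M"
  shows "real c = real Q ^ M * (1 - (1 / real Q) ^ m)"
proof -
  have "Q ^ T \<le> Q ^ (T + m)" using assms(1) by (intro power_increasing) auto
  then have "real c * real Q ^ k = (real Q ^ (T + m) - real Q ^ T) * real Q ^ (T + m)"
    using arg_cong[OF assms(2), of real] by (simp add: of_nat_diff)
  also have "real Q ^ T = real Q ^ (T + m) * (1 / real Q) ^ m"
    using assms(1) by (simp add: power_add power_one_over)
  finally have "real c * real Q ^ k = (real Q ^ (T + m) * real Q ^ (T + m)) * (1 - (1 / real Q) ^ m)"
    by (simp only: right_diff_distrib left_diff_distrib mult_1_right mult_ac)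
  then have "real c * real Q ^ k = real Q ^ (2 * (T + m)) * (1 - (1 / real Q) ^ m)"
    by (simp only: mult_2 power_add)
  then have "real c * real Q ^ k = (real Q ^ M * (1 - (1 / real Q) ^ m)) * real Q ^ k"
    unfolding assms(3) by (simp add: power_add)
  then show ?thesis using assms(1) by simp
qed

section \<open>Counting frames for a duality and for an alternating form\<close>

context lattice
begin

lemma cnt_tor_partition:
  assumes "type_inv X ls" "\<forall>x\<in>set ls. x \<le> Suc l"
  obtains T where "cnt Y (tor l X) = Q ^ T" "T + count_list ls (Suc l) = sum_list ls"
  using that[of "sum_list (map (min l) ls)"] assms sum_list_map_min_Suc[OF assms(2)]
  by (auto simp: type_inv_def)

end

context sesquilinear
begin

definition dual_gram :: "nat \<Rightarrow> 'b \<times> 'b \<Rightarrow> bool" where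
  "dual_gram k = (\<lambda>(x, y). \<pi> ^ k \<cdot> x \<in> Y \<and> \<pi> ^ k \<cdot> y \<in> Y \<and> B x y - 1 / \<pi> ^ k \<in> ipow 0)"

definition dual_orth :: "'b \<times> 'b \<Rightarrow> 'b \<times> 'b \<Rightarrow> bool" where
  "dual_orth = (\<lambda>(x, y) (x', y'). B x y' \<in> ipow 0 \<and> B x' y \<in> ipow 0)"

text \<open>For a first part k of multiplicity m there are Q^(k + 2 |rest|) (1 - Q^(-m)) dual pairs:
  the squared order Q^(2k + 2 |rest|) over Q^k, times the proportion of vectors of exact exponent k.
  The exponent k + 2 |rest| is the increment of |\<lambda>| + 2 n(\<lambda>).\<close>

lemma card_dual_frames:
  assumes "perf X X'" "type_inv X ks" "type_inv X' ks" "is_partition ks"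
  shows "finite (frames dual_gram dual_orth ((X \<inter> reps Y) \<times> (X' \<inter> reps Y)) ks) \<and>
    real (card (frames dual_gram dual_orth ((X \<inter> reps Y) \<times> (X' \<inter> reps Y)) ks)) =
    real Q ^ (sum_list ks + 2 * n_part ks) * b_part ks (1 / real Q)"
proof -
  define Inv where "Inv S ks \<longleftrightarrow> (\<exists>X X'. S = (X \<inter> reps Y) \<times> (X' \<inter> reps Y) \<and> perf X X' \<and>
    type_inv X ks \<and> type_inv X' ks \<and> is_partition ks)" for S ks
  show ?thesis
  proof (rule card_frames[where Inv = Inv and F = "\<lambda>ks. real Q ^ (sum_list ks + 2 * n_part ks) * b_part ks (1 / real Q)"])
    show "Inv ((X \<inter> reps Y) \<times> (X' \<inter> reps Y)) ks"
      unfolding Inv_def using assms by blast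
  next
    fix S k ks assume "Inv S (k # ks)"
    then show "finite S" unfolding Inv_def
      using perf_osub type_inv_finite by auto
  next
    fix S k ks assume "Inv S (k # ks)"
    then obtain X X' where S: "S = (X \<inter> reps Y) \<times> (X' \<inter> reps Y)" and perf: "perf X X'"
      and inv: "type_inv X (k # ks)" "type_inv X' (k # ks)" and part: "is_partition (k # ks)"
      unfolding Inv_def by blast
    note le = is_partition_le[OF part]
    have tor: "tor k X = X" "tor k X' = X'"
      using type_inv_tor_all[OF perf_osub(1)[OF perf] inv(1), of k]
        type_inv_tor_all[OF perf_osub(2)[OF perf] inv(2), of k] le by blast+
    obtain l where l: "k = Suc l" using part by (cases k) (auto simp: is_partition_Cons)
    obtain T where T: "cnt Y (tor l X) = Q ^ T" "T + count_list (k # ks) k = sum_list (k # ks)"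
      using cnt_tor_partition[OF inv(1), of l] le unfolding l by blast
    have "{z \<in> S. dual_gram k z} =
        {(x, y). x \<in> X \<inter> reps Y \<and> y \<in> X' \<inter> reps Y \<and> B x y - 1 / \<pi> ^ k \<in> ipow 0}"
      using tor unfolding S dual_gram_def tor_def by blast
    then have "card {z \<in> S. dual_gram k z} * Q ^ k = (cnt Y X - cnt Y (tor l X)) * cnt Y X'"
      using card_dual_pairs[OF perf type_inv_finite[OF perf_osub(1)[OF perf] inv(1)]
          type_inv_finite[OF perf_osub(2)[OF perf] inv(2)], of l] tor(1) unfolding l by (simp only:)
    then have "card {z \<in> S. dual_gram k z} * Q ^ k =
        (Q ^ (T + count_list (k # ks) k) - Q ^ T) * Q ^ (T + count_list (k # ks) k)"
      using type_inv_cnt[OF perf_osub(1)[OF perf] inv(1)] type_inv_cnt[OF perf_osub(2)[OF perf] inv(2)] T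
      by (simp only:)
    then have "real (card {z \<in> S. dual_gram k z}) =
        real Q ^ (k + 2 * sum_list ks) * (1 - (1 / real Q) ^ count_list (k # ks) k)"
      by (rule dual_pair_count[OF Q_pos]) (use T(2) in simp)
    then show "real (card {z \<in> S. dual_gram k z}) * (real Q ^ (sum_list ks + 2 * n_part ks) * b_part ks (1 / real Q)) =
        real Q ^ (sum_list (k # ks) + 2 * n_part (k # ks)) * b_part (k # ks) (1 / real Q)"
    proof -
      have "real Q ^ (sum_list (k # ks) + 2 * n_part (k # ks)) =
          real Q ^ (k + 2 * sum_list ks) * real Q ^ (sum_list ks + 2 * n_part ks)"
        unfolding power_add[symmetric] n_part_Cons by (rule arg_cong[where f = "\<lambda>n. real Q ^ n"]) simp
      then show ?thesis unfolding b_part_Cons by (simp only: \<open>real (card _) = _\<close> mult_ac)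
    qed
  next
    fix S k ks z assume "Inv S (k # ks)" and z: "z \<in> S" "dual_gram k z"
    then obtain X X' where S: "S = (X \<inter> reps Y) \<times> (X' \<inter> reps Y)" and perf: "perf X X'"
      and inv: "type_inv X (k # ks)" "type_inv X' (k # ks)" and part: "is_partition (k # ks)"
      unfolding Inv_def by blast
    obtain x y where xy: "z = (x, y)" by fastforce
    have x: "x \<in> X" "\<pi> ^ k \<cdot> x \<in> Y" and y: "y \<in> X'" "\<pi> ^ k \<cdot> y \<in> Y" and B: "B x y - 1 / \<pi> ^ k \<in> ipow 0"
      using z by (auto simp: S xy dual_gram_def)
    have "{z' \<in> S. dual_orth z z'} =
        ({x' \<in> X. B x' y \<in> ipow 0} \<inter> reps Y) \<times> ({y' \<in> X'. B x y' \<in> ipow 0} \<inter> reps Y)"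
      unfolding S xy dual_orth_def by auto
    then show "Inv {z' \<in> S. dual_orth z z'} ks"
      unfolding Inv_def
      using perf_split[OF perf x y B] type_inv_split_left[OF perf x y B inv(1)]
        type_inv_split_right[OF perf x y B inv(2)] is_partition_tl[OF part] by blast
  qed simp
qed

text \<open>The order of arguments in \<open>B y x\<close> follows \<open>alt_form\<close>, which
  takes the value \<open>1 / \<pi> ^ k\<close> at an odd generator followed by the even generator of
  its block.\<close>

definition symp_gram :: "nat \<Rightarrow> 'b \<times> 'b \<Rightarrow> bool" where
  "symp_gram k = (\<lambda>(x, y). \<pi> ^ k \<cdot> x \<in> Y \<and> \<pi> ^ k \<cdot> y \<in> Y \<and> B y x - 1 / \<pi> ^ k \<in> ipow 0)"

definition symp_orth :: "'b \<times> 'b \<Rightarrow> 'b \<times> 'b \<Rightarrow> bool" where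
  "symp_orth = (\<lambda>(x, y) (x', y'). B x x' \<in> ipow 0 \<and> B x y' \<in> ipow 0 \<and> B y x' \<in> ipow 0 \<and> B y y' \<in> ipow 0)"

text \<open>The hyperbolic summand is split off in two steps, each removing one copy of k: the dual
  pair y, x first, then the pair x, -y inside the resulting complements, which contain these vectors
  because the form is alternating.\<close>

lemma symp_split:
  assumes alt: "\<And>x y. B x y = - B y x" "\<And>x. B x x = 0" and perf: "perf X X" and inv: "type_inv X (k # k # ls)"
    and x: "x \<in> X" "\<pi> ^ k \<cdot> x \<in> Y" and y: "y \<in> X" "\<pi> ^ k \<cdot> y \<in> Y" and B: "B y x - 1 / \<pi> ^ k \<in> ipow 0"
  defines "X2 \<equiv> {z \<in> X. B x z \<in> ipow 0 \<and> B y z \<in> ipow 0}"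
  shows "perf X2 X2" "type_inv X2 ls"
proof -
  let ?X1 = "{z \<in> X. B z x \<in> ipow 0}" and ?X1' = "{z \<in> X. B y z \<in> ipow 0}"
  have flip: "B z w \<in> ipow 0 \<longleftrightarrow> B w z \<in> ipow 0" for z w
    using alt(1)[of z w] by simp
  have perf1: "perf ?X1 ?X1'" by (rule perf_split[OF perf y x B])
  have inv1: "type_inv ?X1 (k # ls)" by (rule type_inv_split_left[OF perf y x B inv])
  have x1: "x \<in> ?X1" using x alt(2) by simp
  have y1: "- y \<in> ?X1'" "\<pi> ^ k \<cdot> (- y) \<in> Y"
    using y alt(2) add_subgroup_uminus[OF osub_subgroup[OF perf_osub(1)[OF perf]]] add_subgroup_uminus[OF Y_subgroup]
    by (auto simp: B_uminus_right vs.scale_minus_right)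
  have B1: "B x (- y) - 1 / \<pi> ^ k \<in> ipow 0"
    using B alt(1)[of y x] by (simp add: B_uminus_right)
  have "{z \<in> ?X1. B z (- y) \<in> ipow 0} = X2"
    unfolding X2_def using flip by (auto simp: B_uminus_right)
  moreover have "{z \<in> ?X1'. B x z \<in> ipow 0} = X2"
    unfolding X2_def by auto
  ultimately show "perf X2 X2" "type_inv X2 ls"
    using perf_split[OF perf1 x1 x(2) y1 B1] type_inv_split_left[OF perf1 x1 x(2) y1 B1 inv1]
    by (simp_all only:)
qed

text \<open>All parts of the module are doubled, so k has multiplicity 2m and contributes 1 -
  Q^(-2m), which leads to the parameter Q^(-2). The squared order Q^(4 |\<lambda>|) over Q^k gives
  the exponent 3k + 4 |rest|.\<close>

lemma card_symp_frames:
  assumes alt: "\<And>x y. B x y = - B y x" "\<And>x. B x x = 0"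
    and "perf X X" "type_inv X (double_parts ks)" "is_partition ks"
  shows "real (card (frames symp_gram symp_orth ((X \<inter> reps Y) \<times> (X \<inter> reps Y)) ks)) =
    real Q ^ (4 * n_part ks + 3 * sum_list ks) * b_part ks (1 / real Q ^ 2)"
proof -
  define Inv where "Inv S ks \<longleftrightarrow> (\<exists>X. S = (X \<inter> reps Y) \<times> (X \<inter> reps Y) \<and> perf X X \<and>
    type_inv X (double_parts ks) \<and> is_partition ks)" for S ks
  let ?F = "\<lambda>ks. real Q ^ (4 * n_part ks + 3 * sum_list ks) * b_part ks (1 / real Q ^ 2)"
  have "finite (frames symp_gram symp_orth ((X \<inter> reps Y) \<times> (X \<inter> reps Y)) ks) \<and>
    real (card (frames symp_gram symp_orth ((X \<inter> reps Y) \<times> (X \<inter> reps Y)) ks)) = ?F ks"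
  proof (rule card_frames[where Inv = Inv and F = ?F])
    show "Inv ((X \<inter> reps Y) \<times> (X \<inter> reps Y)) ks"
      unfolding Inv_def using assms by blast
  next
    fix S k ks assume "Inv S (k # ks)"
    then show "finite S" unfolding Inv_def
      using perf_osub type_inv_finite by auto
  next
    fix S k ks assume "Inv S (k # ks)"
    then obtain X where S: "S = (X \<inter> reps Y) \<times> (X \<inter> reps Y)" and perf: "perf X X"
      and inv: "type_inv X (double_parts (k # ks))" and part: "is_partition (k # ks)"
      unfolding Inv_def by blast
    have le: "l \<le> k" if "l \<in> set (double_parts (k # ks))" for l
      using that is_partition_le[OF part, of l] unfolding set_double_parts by simp
    have tor: "tor k X = X"
      by (rule type_inv_tor_all[OF perf_osub(1)[OF perf] inv le])
    obtain l where l: "k = Suc l" using part by (cases k) (auto simp: is_partition_Cons)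
    obtain T where T: "cnt Y (tor l X) = Q ^ T"
      "T + count_list (double_parts (k # ks)) k = sum_list (double_parts (k # ks))"
      using cnt_tor_partition[OF inv, of l] le unfolding l by blast
    note fin = type_inv_finite[OF perf_osub(1)[OF perf] inv]
    let ?m = "count_list (double_parts (k # ks)) k"
    let ?D = "{(x, y). x \<in> X \<inter> reps Y \<and> y \<in> X \<inter> reps Y \<and> B x y - 1 / \<pi> ^ k \<in> ipow 0}"
    \<comment> \<open>\<open>card_dual_pairs\<close> counts the same pairs with their components
      exchanged.\<close>
    have "{z \<in> S. symp_gram k z} = (\<lambda>(x, y). (y, x)) ` ?D"
      using tor unfolding S symp_gram_def tor_def by (auto simp: image_iff)
    then have "card {z \<in> S. symp_gram k z} = card ?D"
      by (simp only:) (rule card_image, auto simp: inj_on_def)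
    then have "card {z \<in> S. symp_gram k z} * Q ^ k = (cnt Y X - cnt Y (tor l X)) * cnt Y X"
      using card_dual_pairs[OF perf fin fin, of l] tor unfolding l by (simp only:)
    then have "card {z \<in> S. symp_gram k z} * Q ^ k = (Q ^ (T + ?m) - Q ^ T) * Q ^ (T + ?m)"
      using type_inv_cnt[OF perf_osub(1)[OF perf] inv] T by (simp only:)
    then have "real (card {z \<in> S. symp_gram k z}) =
        real Q ^ (3 * k + 4 * sum_list ks) * (1 - (1 / real Q) ^ ?m)"
      by (rule dual_pair_count[OF Q_pos]) (use T(2) in simp)
    also have "(1 / real Q) ^ ?m = (1 / real Q ^ 2) ^ count_list (k # ks) k"
      by (simp only: count_list_double_parts power_mult power_one_over)
    finally have card: "real (card {z \<in> S. symp_gram k z}) =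
        real Q ^ (3 * k + 4 * sum_list ks) * (1 - (1 / real Q ^ 2) ^ count_list (k # ks) k)" .
    show "real (card {z \<in> S. symp_gram k z}) * ?F ks = ?F (k # ks)"
    proof -
      have "real Q ^ (4 * n_part (k # ks) + 3 * sum_list (k # ks)) =
          real Q ^ (3 * k + 4 * sum_list ks) * real Q ^ (4 * n_part ks + 3 * sum_list ks)"
        unfolding power_add[symmetric] n_part_Cons by (rule arg_cong[where f = "\<lambda>n. real Q ^ n"]) simp
      then show ?thesis unfolding b_part_Cons by (simp only: card mult_ac)
    qed
  next
    fix S k ks z assume "Inv S (k # ks)" and z: "z \<in> S" "symp_gram k z"
    then obtain X where S: "S = (X \<inter> reps Y) \<times> (X \<inter> reps Y)" and perf: "perf X X"
      and inv: "type_inv X (k # k # double_parts ks)" and part: "is_partition (k # ks)"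
      unfolding Inv_def double_parts_Cons by blast
    obtain x y where xy: "z = (x, y)" by fastforce
    have x: "x \<in> X" "\<pi> ^ k \<cdot> x \<in> Y" and y: "y \<in> X" "\<pi> ^ k \<cdot> y \<in> Y" and B: "B y x - 1 / \<pi> ^ k \<in> ipow 0"
      using z by (auto simp: S xy symp_gram_def)
    let ?X2 = "{z \<in> X. B x z \<in> ipow 0 \<and> B y z \<in> ipow 0}"
    have "{z' \<in> S. symp_orth z z'} = (?X2 \<inter> reps Y) \<times> (?X2 \<inter> reps Y)"
      unfolding S xy symp_orth_def by auto
    then show "Inv {z' \<in> S. symp_orth z z'} ks"
      unfolding Inv_def using symp_split[OF alt perf inv x y B] is_partition_tl[OF part] by blast
  qed simp
  then show ?thesis ..
qed

end

section \<open>Hermitian lattices and the number of vectors of given norm\<close>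

locale hermitian_lattice = sesquilinear v \<pi> \<tau> scale Y B + hermitian_field v \<pi> \<tau> q
  for v :: "'a::field \<Rightarrow> int" and \<pi> \<tau> and scale :: "'a \<Rightarrow> 'g::ab_group_add \<Rightarrow> 'g" (infixr \<open>\<cdot>\<close> 75)
    and Y B and q +
  assumes hermitian: "B y x = \<tau> (B x y)"
begin

definition nrm :: "nat \<Rightarrow> 'g \<Rightarrow> 'a" where
  "nrm k x = \<pi> ^ k * B x x"

lemma tau_nrm: "\<tau> (nrm k x) = nrm k x"
  using hermitian[of x x] by (simp add: nrm_def tau_mult tau_power)

lemma nrm_scale: "nrm k (a \<cdot> x) = a * \<tau> a * nrm k x"
  by (simp add: nrm_def B_scale_left B_scale_right mult_ac)

lemma nrm_add: "nrm k (x + y) = nrm k x + nrm k y + (\<pi> ^ k * B x y + \<tau> (\<pi> ^ k * B x y))"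
  using hermitian[of y x]
  by (simp add: nrm_def B_add_left B_add_right tau_mult tau_power algebra_simps)

lemma nrm_minus_one_iff: "nrm k x - 1 \<in> ipow k \<longleftrightarrow> B x x - 1 / \<pi> ^ k \<in> ipow 0"
proof -
  have "\<pi> ^ k * (B x x - 1 / \<pi> ^ k) = nrm k x - 1" by (simp add: nrm_def right_diff_distrib)
  then show ?thesis using pi_mult_ipow_iff[of k "B x x - 1 / \<pi> ^ k" 0] by simp
qed

definition non_unit_count :: "'g set \<Rightarrow> nat \<Rightarrow> nat" where
  "non_unit_count X k = cnt Y {x \<in> X. nrm k x \<in> ipow 1}"

context
  fixes X :: "'g set" and k :: nat
  assumes perf: "perf X X" and tor: "tor k X = X" and k: "0 < k"
begin

lemma nrm_integral: "x \<in> X \<Longrightarrow> nrm k x \<in> ipow 0"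
  unfolding nrm_def using tor by (intro pi_B_left[OF perf]) (auto simp: tor_def)

lemma nrm_cong:
  assumes "x - y \<in> Y" "x \<in> X" "y \<in> X"
  shows "nrm k x - nrm k y \<in> ipow k"
proof -
  have "\<pi> ^ k * (B x x - B y y) \<in> ipow (k + 0)"
    unfolding pi_mult_ipow_iff by (rule B_cong[OF perf assms(1,1,2,3,2,3)])
  then show ?thesis by (simp add: nrm_def right_diff_distrib)
qed

lemma subgroup_X: "add_subgroup X" and Y_X: "Y \<subseteq> X" and sat_X: "saturated Y X"
  using perf_osub(1)[OF perf] by (auto simp: osub_def intro: saturated_subgroup)

lemma saturated_nrm: "j \<le> k \<Longrightarrow> saturated Y {x \<in> X. nrm k x - c \<in> ipow j}"
  unfolding saturated_def
proof clarify
  fix x y assume j: "j \<le> k" and x: "x \<in> X" "nrm k x - c \<in> ipow j" and yx: "y - x \<in> Y"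
  have y: "y \<in> X" using saturatedD[OF sat_X x(1) yx] .
  have "nrm k y - nrm k x \<in> ipow j"
    using nrm_cong[OF yx y x(1)] by (rule ipow_mono[OF j])
  then show "y \<in> X \<and> nrm k y - c \<in> ipow j" using ipow_trans[OF _ x(2)] y by blast
qed

lemma nrm_tau_fixed_units: "x \<in> X \<Longrightarrow> nrm k x \<notin> ipow 1 \<Longrightarrow> nrm k x \<in> tau_fixed_units j"
  by (simp add: tau_fixed_units_def tau_fixed_def nrm_integral tau_nrm)

text \<open>A vector x of exact exponent k has a partner w for which \<pi>^k B(x, w) has trace 1.
  The scaled norm of x + w is then 1 more than the sum of those of x and w, so one of the three is a
  unit, and by \<open>norm_surj\<close> its vector can be rescaled to norm 1 / \<pi>^k.\<close>

lemma exists_unit_vector: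
  assumes "tor (k - 1) X \<noteq> X"
  shows "\<exists>e\<in>X. B e e - 1 / \<pi> ^ k \<in> ipow 0"
proof -
  obtain l where l: "k = Suc l" using k by (cases k) auto
  obtain x where x: "x \<in> X" "\<pi> ^ l \<cdot> x \<notin> Y" using assms l by (auto simp: tor_def)
  have "\<pi> ^ Suc l \<cdot> x \<in> Y" using x(1) tor unfolding l tor_def by blast
  then obtain y where y: "y \<in> X" "\<pi> ^ k * B x y \<in> ipow 0" "\<pi> ^ k * B x y \<notin> ipow 1"
    using exists_dual_vector[OF perf x(1) _ x(2)] unfolding l by blast
  obtain c where c: "c \<in> ipow 0" "c + \<tau> c = 1" using trace_one by blast
  define w where "w = (c * inverse (\<pi> ^ k * B x y)) \<cdot> y"
  have w: "w \<in> X" unfolding w_def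
    using c(1) unit_inverse[OF y(2,3)] y(1) perf_osub(1)[OF perf] by (intro osub_scale ipow_multl)
  have "\<pi> ^ k * B x y \<noteq> 0" by (rule unit_neq_0[OF y(3)])
  then have "\<pi> ^ k * B x w = c"
    unfolding w_def B_scale_right by (simp add: field_simps)
  then have "nrm k (x + w) = nrm k x + nrm k w + 1"
    using nrm_add[of k x w] c(2) by simp
  then have sum: "nrm k (x + w) - (nrm k x + nrm k w) = 1" by simp
  have "\<exists>z\<in>X. nrm k z \<notin> ipow 1"
  proof (rule ccontr)
    assume "\<not> ?thesis"
    then have *: "nrm k z \<in> ipow 1" if "z \<in> X" for z using that by blast
    have "x + w \<in> X" using add_subgroup_add[OF subgroup_X x(1) w] .
    then have "nrm k (x + w) - (nrm k x + nrm k w) \<in> ipow 1"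
      using * x(1) w by (intro ipow_diff ipow_add)
    then show False unfolding sum by simp
  qed
  then obtain z where z: "z \<in> X" "nrm k z \<notin> ipow 1" by blast
  note z0 = nrm_integral[OF z(1)]
  have "inverse (nrm k z) \<in> tau_fixed_units k"
    using unit_inverse[OF z0 z(2)] unit_inverse'[OF z0 z(2)]
    by (simp add: tau_fixed_units_def tau_fixed_def tau_inverse tau_nrm)
  then obtain a where a: "a \<in> ipow 0" "a * \<tau> a - inverse (nrm k z) \<in> ipow k"
    using norm_surj k by blast
  have "(a * \<tau> a - inverse (nrm k z)) * nrm k z = nrm k (a \<cdot> z) - 1"
    using unit_neq_0[OF z(2)] by (simp add: nrm_scale left_diff_distrib)
  then have "nrm k (a \<cdot> z) - 1 \<in> ipow k"
    using ipow_multr[OF a(2) z0] by simp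
  moreover have "a \<cdot> z \<in> X" using osub_scale[OF perf_osub(1)[OF perf] a(1) z(1)] .
  ultimately show ?thesis unfolding nrm_minus_one_iff by blast
qed

text \<open>Scaling by an \<open>a\<close> of norm c modulo \<pp>^k, which exists by
  \<open>norm_surj\<close>.\<close>

lemma cnt_nrm_fiber:
  assumes c: "c \<in> tau_fixed_units k"
  shows "cnt Y {x \<in> X. nrm k x - 1 \<in> ipow k} = cnt Y {x \<in> X. nrm k x - c \<in> ipow k}"
proof -
  obtain a where a: "a \<in> ipow 0" "a \<notin> ipow 1" "a * \<tau> a - c \<in> ipow k"
    using norm_surj[OF c k] by blast
  have N: "a * \<tau> a \<in> ipow 0" "a * \<tau> a \<notin> ipow 1"
    using a(1,2) norm_unit_iff[of a] ipow_multl[of a "\<tau> a" 0] by auto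
  note scale_X = osub_scale[OF perf_osub(1)[OF perf]]
  have iff: "nrm k (a \<cdot> x) - c \<in> ipow k \<longleftrightarrow> nrm k x - 1 \<in> ipow k" for x
  proof -
    have "nrm k (a \<cdot> x) - c - a * \<tau> a * (nrm k x - 1) = a * \<tau> a - c"
      by (simp add: nrm_scale algebra_simps)
    then have "nrm k (a \<cdot> x) - c \<in> ipow k \<longleftrightarrow> a * \<tau> a * (nrm k x - 1) \<in> ipow k"
      using a(3) by (intro ipow_cong) (simp only:)
    then show ?thesis by (simp only: unit_mult_ipow_iff[OF N])
  qed
  have inv_scale: "inverse a \<cdot> (a \<cdot> x) = x" "a \<cdot> (inverse a \<cdot> x) = x" for x
    using unit_neq_0[OF a(2)] by simp_all
  note ia = unit_inverse[OF a(1,2)]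
  show ?thesis
  proof (rule cnt_cong[OF Y_subgroup Y_subgroup saturated_nrm saturated_nrm, where f = "\<lambda>x. a \<cdot> x"])
    show "a \<cdot> x \<in> {x \<in> X. nrm k x - c \<in> ipow k}" if "x \<in> {x \<in> X. nrm k x - 1 \<in> ipow k}" for x
      using that iff scale_X[OF a(1)] by blast
    show "a \<cdot> x - a \<cdot> y \<in> Y \<longleftrightarrow> x - y \<in> Y" for x y
      using Y_scale[OF a(1), of "x - y"] Y_scale[OF ia, of "a \<cdot> (x - y)"]
      by (auto simp only: inv_scale vs.scale_right_diff_distrib)
    show "\<exists>x\<in>{x \<in> X. nrm k x - 1 \<in> ipow k}. a \<cdot> x - y \<in> Y" if "y \<in> {x \<in> X. nrm k x - c \<in> ipow k}" for y
    proof (intro bexI)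
      show "a \<cdot> (inverse a \<cdot> y) - y \<in> Y" by (simp only: inv_scale diff_self add_subgroup_0[OF Y_subgroup])
      show "inverse a \<cdot> y \<in> {x \<in> X. nrm k x - 1 \<in> ipow k}"
        using that iff[of "inverse a \<cdot> y"] scale_X[OF ia, of y] by (simp only: inv_scale) blast
    qed
  qed simp_all
qed

text \<open>The norm of the units is surjective, so all unit values of the form occur equally often.\<close>

lemma card_unit_vectors:
  assumes fin: "finite (X \<inter> reps Y)"
  shows "cnt Y {x \<in> X. B x x - 1 / \<pi> ^ k \<in> ipow 0} * (q ^ k - q ^ (k - 1)) + non_unit_count X k = cnt Y X"
proof -
  let ?A = "{x \<in> X. nrm k x \<notin> ipow 1} \<inter> reps Y" and ?U = "tau_fixed_units k \<inter> reps (ipow k)"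
  let ?f = "\<lambda>x. rep (ipow k) (nrm k x)"
  have finU: "finite ?U"
    by (rule finite_reps_subset) (auto simp: tau_fixed_units_def tau_fixed_def)
  have finA: "finite ?A" by (rule finite_subset[OF _ fin]) auto
  have satU: "saturated (ipow k) (tau_fixed_units k)" using k by (rule saturated_tau_fixed_units)
  have im: "?f ` ?A \<subseteq> ?U"
    by (auto simp: rep_mem_iff[OF subgroup_ipow satU] intro: nrm_tau_fixed_units)
  have fib: "card {x \<in> ?A. ?f x = c} = cnt Y {x \<in> X. B x x - 1 / \<pi> ^ k \<in> ipow 0}" if c: "c \<in> ?U" for c
  proof -
    have "?f x = c \<longleftrightarrow> nrm k x - c \<in> ipow k" for x
      using rep_eq_iff[of "ipow k" "nrm k x" c] rep_reps[of "ipow k" c] c by simp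
    moreover have "nrm k x \<notin> ipow 1" if "nrm k x - c \<in> ipow k" for x
    proof -
      have "nrm k x - c \<in> ipow 1" by (rule ipow_mono[OF _ that]) (use k in simp)
      then show ?thesis using unit_cong[of "nrm k x" c] c by (simp add: tau_fixed_units_def)
    qed
    ultimately have "{x \<in> ?A. ?f x = c} = {x \<in> X. nrm k x - c \<in> ipow k} \<inter> reps Y" by blast
    then show ?thesis
      using cnt_nrm_fiber[of c] c unfolding nrm_minus_one_iff by (simp add: cnt_def)
  qed
  have "card ?A = (\<Sum>c\<in>?U. card {x \<in> ?A. ?f x = c})"
    by (rule card_eq_sum_fibers[OF finA finU im])
  also have "\<dots> = card ?U * cnt Y {x \<in> X. B x x - 1 / \<pi> ^ k \<in> ipow 0}"
    using fib by simp
  also have "card ?U = q ^ k - q ^ (k - 1)"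
    using cnt_tau_fixed_units[OF k] by (simp only: cnt_def)
  finally have A: "card ?A = (q ^ k - q ^ (k - 1)) * cnt Y {x \<in> X. B x x - 1 / \<pi> ^ k \<in> ipow 0}" .
  have "X \<inter> reps Y = ?A \<union> ({x \<in> X. nrm k x \<in> ipow 1} \<inter> reps Y)" by blast
  then have "cnt Y X = card ?A + non_unit_count X k"
    unfolding cnt_def non_unit_count_def
    using card_Un_disjoint[OF finA finite_subset[OF _ fin], of "{x \<in> X. nrm k x \<in> ipow 1} \<inter> reps Y"] by auto
  then show ?thesis unfolding A by (simp add: mult.commute)
qed

end

text \<open>For a non-unit c the norm of a, hence a itself, must be a non-unit. For a unit c there
  are q + 1 classes modulo \<pp>, each consisting of Q^(k-1) classes modulo \<pp>^k.\<close>

lemma cnt_norm_solutions: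
  assumes k: "0 < k" and c: "c \<in> ipow 0" "\<tau> c = c"
  shows "card {a \<in> ipow 0 \<inter> reps (ipow k). a * \<tau> a + c \<in> ipow 1} =
    (if c \<in> ipow 1 then Q ^ (k - 1) else (q + 1) * Q ^ (k - 1))"
proof (cases "c \<in> ipow 1")
  case True
  have "{a \<in> ipow 0 \<inter> reps (ipow k). a * \<tau> a + c \<in> ipow 1} = ipow 1 \<inter> reps (ipow k)"
  proof -
    have "a * \<tau> a + c \<in> ipow 1 \<longleftrightarrow> a * \<tau> a \<in> ipow 1" for a
      by (rule ipow_cong) (simp add: True)
    then have "a \<in> ipow 0 \<and> a * \<tau> a + c \<in> ipow 1 \<longleftrightarrow> a \<in> ipow 1" for a
      using norm_unit_iff[of a] ipow_mono[of 0 1 a] by auto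
    then show ?thesis by blast
  qed
  then show ?thesis using True cnt_ipow[of 1 k] k by (simp add: cnt_def)
next
  case False
  have "- c \<in> tau_fixed_units 1"
    using c False by (simp add: tau_fixed_units_def tau_fixed_def tau_uminus)
  then have 1: "cnt (ipow 1) (norm_fiber (- c)) = q + 1" by (rule cnt_norm_fiber)
  have "cnt (ipow k) (norm_fiber (- c)) = cnt (ipow 1) (norm_fiber (- c)) * cnt (ipow k) (ipow 1)"
    using k by (intro cnt_refine subgroup_ipow saturated_norm_fiber finite_reps_subset)
      (auto simp: norm_fiber_def intro: ipow_mono[of 1 k])
  moreover have "{a \<in> ipow 0 \<inter> reps (ipow k). a * \<tau> a + c \<in> ipow 1} = norm_fiber (- c) \<inter> reps (ipow k)"
    by (auto simp: norm_fiber_def)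
  ultimately show ?thesis using False 1 cnt_ipow[of 1 k] k by (simp add: cnt_def)
qed

text \<open>Modulo \<open>Y\<close> a vector is a e + z with z in the complement of e, and modulo
  \<pp> its scaled norm is a \<tau> a plus that of z. Summing over z instead of a turns the inner
  count into \<open>cnt_norm_solutions\<close>.\<close>

lemma non_unit_count_rec:
  assumes perf: "perf X X" and tor: "tor k X = X" and k: "0 < k" and fin: "finite (X \<inter> reps Y)"
    and e: "e \<in> X" "B e e - 1 / \<pi> ^ k \<in> ipow 0"
  defines "X1 \<equiv> {x \<in> X. B e x \<in> ipow 0}"
  shows "non_unit_count X k = Q ^ (k - 1) * (non_unit_count X1 k + (q + 1) * (cnt Y X1 - non_unit_count X1 k))"
proof -
  let ?R = "ipow 0 \<inter> reps (ipow k)" and ?S = "{x \<in> X. nrm k x \<in> ipow 1}"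
  let ?f = "\<lambda>x. rep (ipow k) (\<pi> ^ k * B e x)"
  have \<pi>e: "\<pi> ^ k \<cdot> e \<in> Y" using e(1) tor by (auto simp: tor_def)
  note subX = osub_subgroup[OF perf_osub(1)[OF perf]]
  have satX: "saturated Y X" by (rule osub_saturated[OF perf_osub(1)[OF perf]])
  have nrm1: "nrm k e - 1 \<in> ipow k" unfolding nrm_minus_one_iff by (rule e(2))
  have p1: "x \<in> ipow 1" if "x \<in> ipow k" for x by (rule ipow_mono[OF _ that]) (use k in simp)
  have int: "nrm k z \<in> ipow 0" if "z \<in> X" for z by (rule nrm_integral[OF perf tor k that])
  have X1X: "X1 \<subseteq> X" by (auto simp: X1_def)
  have finX1: "finite (X1 \<inter> reps Y)" by (rule finite_subset[OF _ fin]) (use X1X in auto)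
  have satS: "saturated Y ?S"
    using saturated_nrm[OF perf tor k, of 1 0] k by simp
  \<comment> \<open>Translation by a e carries the admissible z onto the vectors with coordinate a
    along e and non-unit scaled norm.\<close>
  have key: "z \<in> X1 \<and> a * \<tau> a + nrm k z \<in> ipow 1 \<longleftrightarrow>
      a \<cdot> e + z \<in> X \<and> \<pi> ^ k * B e (a \<cdot> e + z) - a \<in> ipow k \<and> nrm k (a \<cdot> e + z) \<in> ipow 1"
    if a: "a \<in> ipow 0" for a z
  proof -
    have ae: "a \<cdot> e \<in> X" using osub_scale[OF perf_osub(1)[OF perf] a e(1)] .
    have 1: "a \<cdot> e + z \<in> X \<longleftrightarrow> z \<in> X"
      using add_subgroup_add[OF subX ae, of z] add_subgroup_diff[OF subX _ ae, of "a \<cdot> e + z"] by auto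
    have "\<pi> ^ k * B e (a \<cdot> e + z) - a - \<pi> ^ k * B e z = a * (nrm k e - 1)"
      by (simp add: B_add_right B_scale_right nrm_def algebra_simps)
    then have "\<pi> ^ k * B e (a \<cdot> e + z) - a \<in> ipow k \<longleftrightarrow> \<pi> ^ k * B e z \<in> ipow k"
      using ipow_multl[OF a nrm1] by (intro ipow_cong) (simp only:)
    also have "\<dots> \<longleftrightarrow> B e z \<in> ipow 0" using pi_mult_ipow_iff[of k _ 0] by simp
    finally have 2: "\<pi> ^ k * B e (a \<cdot> e + z) - a \<in> ipow k \<longleftrightarrow> B e z \<in> ipow 0" .
    have 3: "nrm k (a \<cdot> e + z) \<in> ipow 1 \<longleftrightarrow> a * \<tau> a + nrm k z \<in> ipow 1" if z: "B e z \<in> ipow 0"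
    proof (rule ipow_cong)
      let ?b = "\<pi> ^ k * B (a \<cdot> e) z"
      have b: "?b \<in> ipow 1"
      proof (rule p1)
        have "\<tau> a * B e z \<in> ipow 0" using a z by (simp add: ipow_multl)
        then show "?b \<in> ipow k" using pi_mult_ipow_iff[of k _ 0] by (simp add: B_scale_left)
      qed
      have "a * \<tau> a * (nrm k e - 1) \<in> ipow 1"
        using a by (intro ipow_multl[OF _ p1[OF nrm1]] ipow_multl[OF a]) simp
      then have "a * \<tau> a * (nrm k e - 1) + (?b + \<tau> ?b) \<in> ipow 1"
        by (rule ipow_add[OF _ ipow_add]) (use b in simp_all)
      moreover have "nrm k (a \<cdot> e + z) - (a * \<tau> a + nrm k z) = a * \<tau> a * (nrm k e - 1) + (?b + \<tau> ?b)"
        unfolding nrm_add nrm_scale by (simp add: algebra_simps)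
      ultimately show "nrm k (a \<cdot> e + z) - (a * \<tau> a + nrm k z) \<in> ipow 1" by simp
    qed
    show ?thesis unfolding X1_def using 1 2 3 by blast
  qed
  have fib: "card {x \<in> ?S \<inter> reps Y. ?f x = a} = card {z \<in> X1 \<inter> reps Y. a * \<tau> a + nrm k z \<in> ipow 1}"
    if a: "a \<in> ?R" for a
  proof -
    have "?f x = a \<longleftrightarrow> \<pi> ^ k * B e x - a \<in> ipow k" for x
      using rep_eq_iff[of "ipow k" "\<pi> ^ k * B e x" a] rep_reps[of "ipow k" a] a by simp
    then have *: "{x \<in> ?S \<inter> reps Y. ?f x = a} = {x \<in> X. \<pi> ^ k * B e x - a \<in> ipow k \<and> nrm k x \<in> ipow 1} \<inter> reps Y"
      by blast
    have sat: "saturated Y {x \<in> X. \<pi> ^ k * B e x - a \<in> ipow k \<and> nrm k x \<in> ipow 1}"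
      unfolding saturated_def
    proof clarify
      fix x y assume x: "x \<in> X" "\<pi> ^ k * B e x - a \<in> ipow k" "nrm k x \<in> ipow 1" and yx: "y - x \<in> Y"
      have "y \<in> ?S" using satS x yx unfolding saturated_def by blast
      moreover have "\<pi> ^ k * B e y - \<pi> ^ k * B e x \<in> ipow k"
        using pi_mult_ipow_iff[of k "B e (y - x)" 0] perf_Y_right[OF perf e(1) yx]
        by (simp add: B_diff_right right_diff_distrib)
      then have "\<pi> ^ k * B e y - a \<in> ipow k" using ipow_trans[OF _ x(2)] by blast
      ultimately show "y \<in> X \<and> \<pi> ^ k * B e y - a \<in> ipow k \<and> nrm k y \<in> ipow 1" by blast
    qed
    have sat1: "saturated Y {z. z \<in> X1 \<and> a * \<tau> a + nrm k z \<in> ipow 1}"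
      unfolding saturated_def
    proof clarify
      fix z w assume z: "z \<in> X1" "a * \<tau> a + nrm k z \<in> ipow 1" and wz: "w - z \<in> Y"
      have "(a \<cdot> e + w) - (a \<cdot> e + z) \<in> Y" using wz by simp
      moreover have "a \<cdot> e + z \<in> {x \<in> X. \<pi> ^ k * B e x - a \<in> ipow k \<and> nrm k x \<in> ipow 1}"
        using key[of a z] z a by blast
      ultimately have "a \<cdot> e + w \<in> {x \<in> X. \<pi> ^ k * B e x - a \<in> ipow k \<and> nrm k x \<in> ipow 1}"
        using saturatedD[OF sat] by blast
      then show "w \<in> X1 \<and> a * \<tau> a + nrm k w \<in> ipow 1" using key[of a w] a by blast
    qed
    have "cnt Y {z. z \<in> X1 \<and> a * \<tau> a + nrm k z \<in> ipow 1} =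
        cnt Y {x \<in> X. \<pi> ^ k * B e x - a \<in> ipow k \<and> nrm k x \<in> ipow 1}"
      by (rule cnt_translate[OF Y_subgroup sat1 sat, where a = "a \<cdot> e"]) (use key a in blast)
    moreover have "{z \<in> X1 \<inter> reps Y. a * \<tau> a + nrm k z \<in> ipow 1} = {z. z \<in> X1 \<and> a * \<tau> a + nrm k z \<in> ipow 1} \<inter> reps Y"
      by blast
    ultimately show ?thesis unfolding * by (simp only: cnt_def)
  qed
  have im: "?f ` (?S \<inter> reps Y) \<subseteq> ?R"
  proof -
    have "?f x \<in> ipow 0" if "x \<in> X" for x
      using pi_B_left[OF perf \<pi>e that] rep_mem_iff[OF subgroup_ipow saturated_ipow[of 0 k]] by simp
    then show ?thesis by auto
  qed
  have finS: "finite (?S \<inter> reps Y)" by (rule finite_subset[OF _ fin]) auto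
  let ?N = "{z \<in> X1 \<inter> reps Y. nrm k z \<in> ipow 1}"
  have N: "card ?N = non_unit_count X1 k" "card (X1 \<inter> reps Y - ?N) = cnt Y X1 - non_unit_count X1 k"
  proof -
    have eq: "?N = {x \<in> X1. nrm k x \<in> ipow 1} \<inter> reps Y" by blast
    then show *: "card ?N = non_unit_count X1 k" by (simp only: non_unit_count_def cnt_def)
    show "card (X1 \<inter> reps Y - ?N) = cnt Y X1 - non_unit_count X1 k"
      unfolding *[symmetric] cnt_def by (rule card_Diff_subset[OF finite_subset[OF _ finX1]]) blast+
  qed
  have "non_unit_count X k = (\<Sum>a\<in>?R. card {x \<in> ?S \<inter> reps Y. ?f x = a})"
    unfolding non_unit_count_def cnt_def by (rule card_eq_sum_fibers[OF finS finite_ipow_reps im])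
  also have "\<dots> = (\<Sum>a\<in>?R. card {z \<in> X1 \<inter> reps Y. a * \<tau> a + nrm k z \<in> ipow 1})"
    by (rule sum.cong[OF refl fib])
  \<comment> \<open>Double counting of the pairs (a, z).\<close>
  also have "\<dots> = (\<Sum>z\<in>X1 \<inter> reps Y. card {a \<in> ?R. a * \<tau> a + nrm k z \<in> ipow 1})"
    by (rule sum_multicount_gen[OF finite_ipow_reps finX1 ballI]) simp
  also have "\<dots> = (\<Sum>z\<in>X1 \<inter> reps Y. if nrm k z \<in> ipow 1 then Q ^ (k - 1) else (q + 1) * Q ^ (k - 1))"
    using X1X by (intro sum.cong refl cnt_norm_solutions k int tau_nrm) auto
  also have "\<dots> = card ?N * Q ^ (k - 1) + card (X1 \<inter> reps Y - ?N) * ((q + 1) * Q ^ (k - 1))"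
  proof -
    have "X1 \<inter> reps Y \<inter> {z. nrm k z \<in> ipow 1} = ?N" "X1 \<inter> reps Y \<inter> - {z. nrm k z \<in> ipow 1} = X1 \<inter> reps Y - ?N"
      by blast+
    then show ?thesis using finX1 by (simp add: sum.If_cases)
  qed
  finally show ?thesis unfolding N by (simp only: distrib_left mult_ac)
qed

text \<open>The scale \<pi>^(l+1) is one step too large when \<pi>^l kills X, so all scaled norms
  lie in \<pp>. This ends the recursion for \<open>non_unit_count\<close>, in which the scale stays
  fixed while parts are removed.\<close>

lemma non_unit_count_all:
  assumes perf: "perf X X" and tor: "tor l X = X"
  shows "non_unit_count X (Suc l) = cnt Y X"
proof -
  have "nrm (Suc l) x \<in> ipow 1" if x: "x \<in> X" for x
  proof -
    have "\<pi> ^ l \<cdot> x \<in> Y" using x tor by (auto simp: tor_def)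
    then have "\<pi> ^ l * B x x \<in> ipow 0" using x by (rule pi_B_left[OF perf])
    then have "\<pi> ^ 1 * (\<pi> ^ l * B x x) \<in> ipow (1 + 0)" by (simp only: pi_mult_ipow_iff)
    then show ?thesis by (simp add: nrm_def mult.assoc)
  qed
  then have "{x \<in> X. nrm (Suc l) x \<in> ipow 1} = X" by blast
  then show ?thesis by (simp add: non_unit_count_def)
qed

lemma hermitian_flip: "B x y \<in> ipow 0 \<longleftrightarrow> B y x \<in> ipow 0"
  by (subst hermitian) simp

lemma herm_split:
  assumes perf: "perf X X" and inv: "type_inv X (k # ls)"
    and e: "e \<in> X" "\<pi> ^ k \<cdot> e \<in> Y" "B e e - 1 / \<pi> ^ k \<in> ipow 0"
  shows "perf {x \<in> X. B e x \<in> ipow 0} {x \<in> X. B e x \<in> ipow 0}" "type_inv {x \<in> X. B e x \<in> ipow 0} ls"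
  using perf_split[OF perf e(1,2,1,2,3)] type_inv_split_right[OF perf e(1,2,1,2,3) inv]
  by (simp_all only: hermitian_flip[of _ e])

text \<open>With m parts equal to l + 1, the proportion 1/q + (1 - 1/q) E, where E = (-1/q)^m, is
  that of the isotropic vectors of a nondegenerate Hermitian form in m variables over the residue
  field. One more variable replaces E by -E / q; this sign is the origin of the parameter
  -t.\<close>

lemma non_unit_count_eq:
  assumes "perf X X" "type_inv X ls" "is_partition ls" "\<forall>x\<in>set ls. x \<le> Suc l"
  shows "real (non_unit_count X (Suc l)) =
    real q ^ (2 * sum_list ls) * (1 - (1 - 1 / real q) * (1 - (- 1 / real q) ^ count_list ls (Suc l)))"
  using assms
proof (induction ls arbitrary: X)
  case Nil
  have "tor l X = X" by (rule type_inv_tor_all[OF perf_osub(1)[OF Nil(1)] Nil(2)]) simp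
  then show ?case
    using non_unit_count_all[OF Nil(1)] type_inv_cnt[OF perf_osub(1)[OF Nil(1)] Nil(2)] by simp
next
  case (Cons a ls)
  note perf = Cons.prems(1) and inv = Cons.prems(2) and part = Cons.prems(3)
  have X: "osub X" by (rule perf_osub(1)[OF perf])
  show ?case
  proof (cases "a \<le> l")
    case True
    have le: "x \<le> l" if "x \<in> set (a # ls)" for x
      using is_partition_le[OF part that] True by simp
    have "tor l X = X" by (rule type_inv_tor_all[OF X inv le])
    moreover have "count_list (a # ls) (Suc l) = 0"
      using le not_less_eq_eq by (subst count_list_0_iff) blast
    moreover have "real (cnt Y X) = real q ^ (2 * sum_list (a # ls))"
      unfolding type_inv_cnt[OF X inv] Q_eq by (simp only: of_nat_power power_mult)
    ultimately show ?thesis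
      using non_unit_count_all[OF perf] by simp
  next
    case False
    then have a: "a = Suc l" using Cons.prems(4) by auto
    define k where "k = Suc l"
    have inv': "type_inv X (k # ls)" using inv unfolding a k_def .
    have le: "\<forall>x\<in>set (k # ls). x \<le> Suc l" using Cons.prems(4) unfolding a k_def .
    have tor: "tor k X = X" using le by (intro type_inv_tor_all[OF X inv']) (auto simp: k_def)
    have k: "0 < k" by (simp add: k_def)
    \<comment> \<open>A part equal to k makes the l-torsion smaller than X, so that a vector of norm
      1 / \<pi>^k exists.\<close>
    have "tor (k - 1) X \<noteq> X"
    proof
      assume "tor (k - 1) X = X"
      then have "tor l X = X" by (simp add: k_def)
      moreover obtain T where T: "cnt Y (tor l X) = Q ^ T" "T + count_list (k # ls) (Suc l) = sum_list (k # ls)"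
        using cnt_tor_partition[OF inv' le] by blast
      ultimately have "Q ^ T = Q ^ sum_list (k # ls)"
        using type_inv_cnt[OF X inv'] by simp
      then have "T = sum_list (k # ls)"
        using Q_ge_2 by (subst (asm) power_inject_exp) auto
      then show False using T(2) by (simp add: k_def)
    qed
    then obtain e where e: "e \<in> X" "B e e - 1 / \<pi> ^ k \<in> ipow 0"
      using exists_unit_vector[OF perf tor k] by blast
    have \<pi>e: "\<pi> ^ k \<cdot> e \<in> Y" using e(1) tor by (auto simp: tor_def)
    let ?X1 = "{x \<in> X. B e x \<in> ipow 0}"
    note X1 = herm_split[OF perf inv' e(1) \<pi>e e(2)]
    define I1 where "I1 = non_unit_count ?X1 k"
    define E1 where "E1 = (- 1 / real q) ^ count_list ls k"
    let ?C1 = "real q ^ (2 * sum_list ls)"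
    have I1: "real I1 = ?C1 * (1 - (1 - 1 / real q) * (1 - E1))"
      using Cons.IH[OF X1 is_partition_tl[OF part]] le unfolding I1_def E1_def k_def by auto
    have C1: "real (cnt Y ?X1) = ?C1"
      unfolding type_inv_cnt[OF perf_osub(1)[OF X1(1)] X1(2)] Q_eq by (simp only: of_nat_power power_mult)
    have "I1 \<le> cnt Y ?X1"
      unfolding I1_def non_unit_count_def cnt_def
      using type_inv_finite[OF perf_osub(1)[OF X1(1)] X1(2)] by (intro card_mono) auto
    then have "real (non_unit_count X k) = real (Q ^ l) * (real I1 + (real q + 1) * (?C1 - real I1))"
      using arg_cong[OF non_unit_count_rec[OF perf tor k type_inv_finite[OF X inv'] e], of real]
      unfolding I1_def[symmetric] C1[symmetric]
      by (simp only: of_nat_mult of_nat_add of_nat_diff of_nat_1 k_def diff_Suc_1)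
    also have "real I1 + (real q + 1) * (?C1 - real I1) = ?C1 * (1 + (real q - 1) * (1 - E1))"
      unfolding I1 using q_ge_2 by (simp add: field_simps)
    also have "real (Q ^ l) = real q ^ (2 * l)"
      unfolding Q_eq by (simp only: of_nat_power power_mult)
    finally have "real (non_unit_count X k) = real q ^ (2 * l) * ?C1 * (1 + (real q - 1) * (1 - E1))"
      by (simp only: mult.assoc)
    also have "1 + (real q - 1) * (1 - E1) = real q ^ 2 * (1 - (1 - 1 / real q) * (1 - (- 1 / real q) * E1))"
      using q_ge_2 by (simp add: field_simps power2_eq_square)
    also have "real q ^ (2 * l) * ?C1 * (real q ^ 2 * (1 - (1 - 1 / real q) * (1 - (- 1 / real q) * E1))) =
        real q ^ (2 * sum_list (k # ls)) * (1 - (1 - 1 / real q) * (1 - (- 1 / real q) * E1))"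
    proof -
      have "real q ^ (2 * sum_list (k # ls)) = real q ^ (2 * l) * ?C1 * real q ^ 2"
        unfolding power_add[symmetric] by (rule arg_cong[where f = "\<lambda>n. real q ^ n"]) (simp add: k_def)
      then show ?thesis by (simp only: mult.assoc)
    qed
    also have "(- 1 / real q) * E1 = (- 1 / real q) ^ count_list (k # ls) k"
      by (simp add: E1_def)
    finally show ?thesis unfolding a k_def .
  qed
qed

definition herm_gram :: "nat \<Rightarrow> 'g \<Rightarrow> bool" where
  "herm_gram k x \<longleftrightarrow> \<pi> ^ k \<cdot> x \<in> Y \<and> B x x - 1 / \<pi> ^ k \<in> ipow 0"

definition herm_orth :: "'g \<Rightarrow> 'g \<Rightarrow> bool" where
  "herm_orth x y \<longleftrightarrow> B x y \<in> ipow 0"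

text \<open>Of the q^(2 |\<lambda>|) vectors the proportion (1 - 1/q) (1 - (-1/q)^m) has unit scaled
  norm, equally distributed over the q^k (1 - 1/q) fixed units modulo \<pp>^k. This leaves q^(2
  |\<lambda>| - k) (1 - (-1/q)^m) choices for the first part k of multiplicity m.\<close>

lemma card_herm_frames:
  assumes "perf X X" "type_inv X ks" "is_partition ks"
  shows "real (card (frames herm_gram herm_orth (X \<inter> reps Y) ks)) =
    real q ^ (sum_list ks + 2 * n_part ks) * b_part ks (- 1 / real q)"
proof -
  define Inv where "Inv S ks \<longleftrightarrow> (\<exists>X. S = X \<inter> reps Y \<and> perf X X \<and> type_inv X ks \<and> is_partition ks)" for S ks
  let ?F = "\<lambda>ks. real q ^ (sum_list ks + 2 * n_part ks) * b_part ks (- 1 / real q)"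
  have "finite (frames herm_gram herm_orth (X \<inter> reps Y) ks) \<and>
    real (card (frames herm_gram herm_orth (X \<inter> reps Y) ks)) = ?F ks"
  proof (rule card_frames[where Inv = Inv and F = ?F])
    show "Inv (X \<inter> reps Y) ks"
      unfolding Inv_def using assms by blast
  next
    fix S k ks assume "Inv S (k # ks)"
    then show "finite S" unfolding Inv_def
      using perf_osub type_inv_finite by auto
  next
    fix S k ks assume "Inv S (k # ks)"
    then obtain X where S: "S = X \<inter> reps Y" and perf: "perf X X"
      and inv: "type_inv X (k # ks)" and part: "is_partition (k # ks)"
      unfolding Inv_def by blast
    have X: "osub X" by (rule perf_osub(1)[OF perf])
    note le = is_partition_le[OF part]
    have tor: "tor k X = X" by (rule type_inv_tor_all[OF X inv le])
    obtain l where l: "k = Suc l" using part by (cases k) (auto simp: is_partition_Cons)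
    have k: "0 < k" by (simp add: l)
    define E where "E = 1 - (- 1 / real q) ^ count_list (k # ks) k"
    define c where "c = card {z \<in> S. herm_gram k z}"
    have "{z \<in> S. herm_gram k z} = {x \<in> X. B x x - 1 / \<pi> ^ k \<in> ipow 0} \<inter> reps Y"
      using tor unfolding S herm_gram_def tor_def by blast
    then have "c = cnt Y {x \<in> X. B x x - 1 / \<pi> ^ k \<in> ipow 0}"
      by (simp only: c_def cnt_def)
    then have "c * (q ^ k - q ^ (k - 1)) + non_unit_count X k = Q ^ sum_list (k # ks)"
      using card_unit_vectors[OF perf tor k type_inv_finite[OF X inv]] type_inv_cnt[OF X inv] by simp
    then have eq: "real c * (real q ^ k - real q ^ (k - 1)) + real (non_unit_count X k) = real q ^ (2 * sum_list (k # ks))"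
    proof -
      have "q ^ (k - 1) \<le> q ^ k" using q_ge_2 by (intro power_increasing) auto
      then have "real (c * (q ^ k - q ^ (k - 1)) + non_unit_count X k) =
          real c * (real q ^ k - real q ^ (k - 1)) + real (non_unit_count X k)"
        by (simp add: of_nat_diff)
      moreover have "real (Q ^ sum_list (k # ks)) = real q ^ (2 * sum_list (k # ks))"
        unfolding Q_eq by (simp only: of_nat_power power_mult)
      ultimately show ?thesis
        using \<open>c * (q ^ k - q ^ (k - 1)) + non_unit_count X k = Q ^ sum_list (k # ks)\<close> by metis
    qed
    define r where "r = 1 - 1 / real q"
    have I: "real (non_unit_count X k) = real q ^ (2 * sum_list (k # ks)) * (1 - r * E)"
      unfolding r_def using non_unit_count_eq[OF perf inv part, of l] le unfolding E_def l by blast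
    have qk: "real q ^ k - real q ^ (k - 1) = real q ^ k * r"
      using q_ge_2 by (simp add: r_def l field_simps)
    have "real c * real q ^ k * r = real q ^ (2 * sum_list (k # ks)) * E * r"
      using eq unfolding I qk right_diff_distrib by (simp only: mult_ac mult_1_right)
    moreover have "r \<noteq> 0" using q_ge_2 by (simp add: r_def)
    ultimately have "real c * real q ^ k = real q ^ (2 * sum_list (k # ks)) * E"
      by (simp only: mult_cancel_right simp_thms)
    also have "real q ^ (2 * sum_list (k # ks)) = real q ^ k * real q ^ (k + 2 * sum_list ks)"
      unfolding power_add[symmetric] by (rule arg_cong[where f = "\<lambda>n. real q ^ n"]) simp
    finally have c: "real c = real q ^ (k + 2 * sum_list ks) * E"
      using q_ge_2 by (simp add: mult_ac)
    have "real q ^ (sum_list (k # ks) + 2 * n_part (k # ks)) =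
        real q ^ (k + 2 * sum_list ks) * real q ^ (sum_list ks + 2 * n_part ks)"
      unfolding power_add[symmetric] n_part_Cons by (rule arg_cong[where f = "\<lambda>n. real q ^ n"]) simp
    then show "real (card {z \<in> S. herm_gram k z}) * ?F ks = ?F (k # ks)"
      unfolding b_part_Cons E_def[symmetric] c_def[symmetric] c by (simp only: mult_ac)
  next
    fix S k ks z assume "Inv S (k # ks)" and z: "z \<in> S" "herm_gram k z"
    then obtain X where S: "S = X \<inter> reps Y" and perf: "perf X X"
      and inv: "type_inv X (k # ks)" and part: "is_partition (k # ks)"
      unfolding Inv_def by blast
    have z': "z \<in> X" "\<pi> ^ k \<cdot> z \<in> Y" "B z z - 1 / \<pi> ^ k \<in> ipow 0"
      using z by (auto simp: S herm_gram_def)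
    have "{z' \<in> S. herm_orth z z'} = {x \<in> X. B z x \<in> ipow 0} \<inter> reps Y"
      unfolding S herm_orth_def by auto
    then show "Inv {z' \<in> S. herm_orth z z'} ks"
      unfolding Inv_def using herm_split[OF perf inv z'] is_partition_tl[OF part] by blast
  qed simp
  then show ?thesis ..
qed

end

section \<open>The modules of a given type as lattices\<close>

definition vscale :: "'a::field \<Rightarrow> (nat \<Rightarrow> 'a) \<Rightarrow> nat \<Rightarrow> 'a" where
  "vscale a x = (\<lambda>i. a * x i)"

definition unit_vec :: "nat \<Rightarrow> nat \<Rightarrow> 'a::field" where
  "unit_vec j = (\<lambda>i. if i = j then 1 else 0)"

text \<open>Coordinates from \<open>length L\<close> on are unconstrained both here and in
  \<open>null_vecs\<close>, so they disappear in the quotient and all functions may serve as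
  vectors.\<close>

definition int_vecs :: "('a::field \<Rightarrow> int) \<Rightarrow> nat list \<Rightarrow> (nat \<Rightarrow> 'a) set" where
  "int_vecs v L = {x. \<forall>i<length L. x i \<in> pp v 0}"

definition null_vecs :: "('a::field \<Rightarrow> int) \<Rightarrow> nat list \<Rightarrow> (nat \<Rightarrow> 'a) set" where
  "null_vecs v L = {x. \<forall>i<length L. x i \<in> pp v (int (L ! i))}"

lemma vector_space_vscale: "vector_space (vscale :: 'a::field \<Rightarrow> _)"
  by unfold_locales (simp_all add: vscale_def fun_eq_iff algebra_simps)

lemma sum_fun_apply: "(\<Sum>i\<in>A. f i) k = (\<Sum>i\<in>A. f i (k :: nat) :: 'a::field)"
  by (induction A rule: infinite_finite_induct) simp_all

locale std_lattice = field_with_involution v \<pi> \<tau> for v :: "'a::field \<Rightarrow> int" and \<pi> \<tau> +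
  fixes L :: "nat list"
begin

abbreviation X0 :: "(nat \<Rightarrow> 'a) set" where "X0 \<equiv> int_vecs v L"
abbreviation Y0 :: "(nat \<Rightarrow> 'a) set" where "Y0 \<equiv> null_vecs v L"
abbreviation n :: nat where "n \<equiv> length L"

lemma X0_iff: "x \<in> X0 \<longleftrightarrow> (\<forall>i<n. x i \<in> ipow 0)"
  by (simp add: int_vecs_def ipow_def)

lemma Y0_iff: "x \<in> Y0 \<longleftrightarrow> (\<forall>i<n. x i \<in> ipow (L ! i))"
  by (simp add: null_vecs_def ipow_def)

lemma Y0_subgroup: "add_subgroup Y0"
  unfolding add_subgroup_def by (auto simp: Y0_iff intro: ipow_diff)

sublocale lattice v \<pi> \<tau> vscale Y0
proof (intro lattice.intro lattice_axioms.intro field_with_involution_axioms vector_space_vscale Y0_subgroup)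
  show "vscale a x \<in> Y0" if "a \<in> ipow 0" "x \<in> Y0" for a x
    using that by (auto simp: Y0_iff vscale_def intro: ipow_multl)
qed

lemma osub_coords:
  assumes "\<And>i. i < n \<Longrightarrow> K i \<le> L ! i"
  shows "osub {x. \<forall>i<n. x i \<in> ipow (K i)}"
proof -
  have "x i \<in> ipow (K i)" if "x \<in> Y0" "i < n" for x i
    using that assms[of i] ipow_mono[of "K i" "L ! i"] by (simp add: Y0_iff)
  then show ?thesis
    unfolding osub_def add_subgroup_def
    by (auto simp: vscale_def intro: ipow_diff ipow_multl)
qed

lemma osub_X0: "osub X0"
proof -
  have "X0 = {x. \<forall>i<n. x i \<in> ipow 0}" using X0_iff by blast
  then show ?thesis using osub_coords[of "\<lambda>i. 0"] by simp
qed

lemma Y0_subset_X0: "Y0 \<subseteq> X0"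
  using osub_Y[OF osub_X0] .

lemma unit_vec_X0: "unit_vec j \<in> X0"
  by (auto simp: X0_iff unit_vec_def)

lemma unit_vec_tor: "vscale (\<pi> ^ (L ! j)) (unit_vec j) \<in> Y0"
  by (auto simp: Y0_iff unit_vec_def vscale_def)

text \<open>Passes from \<open>X n = Y0\<close> up to \<open>X 0 = X0\<close>, releasing one
  coordinate at a time; coordinate m contributes a cyclic summand generated by
  \<open>unit_vec m\<close>.\<close>

lemma type_inv_X0: "type_inv X0 L"
proof -
  define X where "X m = {x. \<forall>i<n. x i \<in> ipow (if i < m then L ! i else 0)}" for m
  have osub: "osub (X m)" for m unfolding X_def by (rule osub_coords) simp
  have inv: "type_inv (X m) (drop m L)" if "m \<le> n" for m
    using that
  proof (induction rule: inc_induct)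
    case base
    have "X n = Y0" unfolding X_def using Y0_iff by auto
    moreover have "tor j Y0 = Y0" for j
      using Y_scale[OF pi_power_ipow_0] by (auto simp: tor_def)
    ultimately show ?case by (simp add: type_inv_def cnt_self[OF Y_subgroup])
  next
    case (step m)
    have Xm: "x m \<in> ipow 0" if "x \<in> X m" for x
      using that step.hyps unfolding X_def by fastforce
    have Y: "x m \<in> ipow (L ! m)" if "x \<in> Y0" for x
      using that step.hyps by (simp add: Y0_iff)
    have e: "unit_vec m \<in> X m" by (auto simp: X_def unit_vec_def)
    have eq: "X (Suc m) = {x \<in> X m. x m \<in> ipow (L ! m)}"
    proof -
      have "x \<in> X (Suc m) \<longleftrightarrow> x \<in> X m \<and> x m \<in> ipow (L ! m)" for x
      proof
        assume x: "x \<in> X (Suc m)"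
        have "x i \<in> ipow (if i < m then L ! i else 0)" if "i < n" for i
        proof -
          have "x i \<in> ipow (if i < Suc m then L ! i else 0)" using x that unfolding X_def by blast
          then show ?thesis using ipow_mono[of 0 "L ! i" "x i"] by (cases "i < m"; cases "i < Suc m") auto
        qed
        moreover have "x m \<in> ipow (L ! m)" using x step.hyps unfolding X_def by fastforce
        ultimately show "x \<in> X m \<and> x m \<in> ipow (L ! m)" unfolding X_def by blast
      next
        assume x: "x \<in> X m \<and> x m \<in> ipow (L ! m)"
        then show "x \<in> X (Suc m)" unfolding X_def by (auto simp: less_Suc_eq)
      qed
      then show ?thesis by blast
    qed
    have "cnt Y0 (tor j (X m)) = cnt Y0 (tor j {x \<in> X m. x m \<in> ipow (L ! m)}) * Q ^ min j (L ! m)" for j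
      by (rule cnt_tor_split[OF osub, where e = "unit_vec m" and \<rho> = "\<lambda>c. c"])
        (use Xm Y e unit_vec_tor in \<open>auto simp: vscale_def unit_vec_def\<close>)
    then have "cnt Y0 (tor j (X m)) = Q ^ sum_list (map (min j) (L ! m # drop (Suc m) L))" for j
      using step.IH unfolding eq[symmetric] by (simp add: type_inv_def power_add)
    moreover have "tor (sum_list L) (X m) = X m"
    proof -
      have "vscale (\<pi> ^ sum_list L) x \<in> Y0" if x: "x \<in> X m" for x
        unfolding Y0_iff
      proof (intro allI impI)
        fix i assume i: "i < n"
        have "x i \<in> ipow 0" using x i ipow_mono[of 0 "L ! i" "x i"] unfolding X_def by (auto split: if_splits)
        then have "\<pi> ^ sum_list L * x i \<in> ipow (sum_list L)" by (intro ipow_multr) auto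
        then show "vscale (\<pi> ^ sum_list L) x i \<in> ipow (L ! i)"
          unfolding vscale_def using i by (intro ipow_mono[OF elem_le_sum_list]) auto
      qed
      then show ?thesis by (auto simp: tor_def)
    qed
    ultimately show ?case
      using step.hyps by (auto simp: type_inv_def Cons_nth_drop_Suc)
  qed
  have "X 0 = X0" using X0_iff by (auto simp: X_def)
  then show ?thesis using inv[of 0] by simp
qed

lemma finite_X0_reps: "finite (X0 \<inter> reps Y0)"
  by (rule type_inv_finite[OF osub_X0 type_inv_X0])

lemma cnt_X0: "cnt Y0 X0 = Q ^ sum_list L"
  by (rule type_inv_cnt[OF osub_X0 type_inv_X0])


section \<open>Cosets and representatives of the concrete module\<close>

definition cls :: "(nat \<Rightarrow> 'a) \<Rightarrow> nat \<Rightarrow> 'a set" where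
  "cls x = (\<lambda>i\<in>{..<n}. {z. z - x i \<in> ipow (L ! i)})"

abbreviation M :: "('a, nat \<Rightarrow> 'a set) module" where "M \<equiv> type_module v L"

lemma cls_eq_iff: "cls x = cls y \<longleftrightarrow> x - y \<in> Y0"
proof -
  have "cls x = cls y \<longleftrightarrow> (\<forall>i<n. {z. z - x i \<in> ipow (L ! i)} = {z. z - y i \<in> ipow (L ! i)})"
    by (auto simp: cls_def fun_eq_iff restrict_def)
  then show ?thesis by (simp only: coset_eq_iff Y0_iff fun_diff_def)
qed

lemma carrier_M: "carrier M = cls ` X0"
proof (intro subset_antisym subsetI)
  fix c assume c: "c \<in> carrier M"
  then have ext: "c \<in> extensional {..<n}" and "\<forall>i<n. \<exists>a\<in>ipow 0. c i = {z. z - a \<in> ipow (L ! i)}"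
    by (auto simp: type_module_def carrier_cyc PiE_def Pi_def image_iff)
  then obtain a where a: "\<And>i. i < n \<Longrightarrow> a i \<in> ipow 0 \<and> c i = {z. z - a i \<in> ipow (L ! i)}"
    by metis
  have "c = cls a"
    by (rule extensionalityI[OF ext]) (auto simp: cls_def a)
  moreover have "a \<in> X0" using a by (simp add: X0_iff)
  ultimately show "c \<in> cls ` X0" by blast
next
  fix c assume "c \<in> cls ` X0"
  then show "c \<in> carrier M"
    by (auto simp: type_module_def carrier_cyc cls_def X0_iff)
qed

lemma cls_carrier: "x \<in> X0 \<Longrightarrow> cls x \<in> carrier M"
  by (simp add: carrier_M)

lemma cyc_add:
  "{z. z - a \<in> ipow k} \<oplus>\<^bsub>cyc v k\<^esub> {z. z - b \<in> ipow k} = {z. z - (a + b) \<in> ipow k}" (is "?A \<oplus>\<^bsub>_\<^esub> ?B = ?C")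
proof -
  have "?A \<oplus>\<^bsub>cyc v k\<^esub> ?B = {z. \<exists>x\<in>?A. \<exists>y\<in>?B. z = x + y}"
    by (auto simp: cyc_def FactRing_def set_add_def set_mult_def int_ring_def)
  also have "\<dots> = ?C"
  proof (intro subset_antisym subsetI)
    fix z assume "z \<in> {z. \<exists>x\<in>?A. \<exists>y\<in>?B. z = x + y}"
    then obtain x y where "x - a \<in> ipow k" "y - b \<in> ipow k" "z = x + y" by blast
    then have "(x - a) + (y - b) \<in> ipow k" by (intro ipow_add)
    then show "z \<in> ?C" using \<open>z = x + y\<close> by (simp add: algebra_simps)
  next
    fix z assume z: "z \<in> ?C"
    show "z \<in> {z. \<exists>x\<in>?A. \<exists>y\<in>?B. z = x + y}"
      by (intro CollectI bexI[of _ "z - b"] bexI[of _ b]) (use z in \<open>auto simp: algebra_simps\<close>)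
  qed
  finally show ?thesis .
qed

text \<open>The product in the quotient is the union of the cosets of all products of
  representatives. These cosets coincide, since every representative of an integral class is
  integral.\<close>

lemma cyc_mult:
  assumes "a \<in> ipow 0" "b \<in> ipow 0"
  shows "{z. z - a \<in> ipow k} \<otimes>\<^bsub>cyc v k\<^esub> {z. z - b \<in> ipow k} = {z. z - a * b \<in> ipow k}" (is "?A \<otimes>\<^bsub>_\<^esub> ?B = ?C")
proof -
  have "?A \<otimes>\<^bsub>cyc v k\<^esub> ?B = (\<Union>x\<in>?A. \<Union>y\<in>?B. {z. z - x * y \<in> ipow k})"
    by (simp add: cyc_def FactRing_def rcoset_mult_def int_ring_coset ipow_def) (simp add: int_ring_def)
  also have "\<dots> = (\<Union>x\<in>?A. \<Union>y\<in>?B. ?C)"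
  proof (intro SUP_cong refl)
    fix x y assume xy: "x \<in> ?A" "y \<in> ?B"
    then have x: "x - a \<in> ipow k" and y: "y - b \<in> ipow k" by auto
    have y0: "y \<in> ipow 0"
      using ipow_cong[of y b 0] ipow_mono[OF _ y, of 0] assms(2) by simp
    have "(x - a) * y + a * (y - b) \<in> ipow k"
      by (rule ipow_add[OF ipow_multr[OF x y0] ipow_multl[OF assms(1) y]])
    then have "x * y - a * b \<in> ipow k" by (simp add: algebra_simps)
    then show "{z. z - x * y \<in> ipow k} = ?C" by (simp only: coset_eq_iff)
  qed
  also have "\<dots> = ?C"
  proof -
    have "a \<in> ?A" "b \<in> ?B" by auto
    then show ?thesis by blast
  qed
  finally show ?thesis .
qed

lemma cls_add: "cls x \<oplus>\<^bsub>M\<^esub> cls y = cls (x + y)"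
  by (auto simp: type_module_def cls_def fun_eq_iff restrict_def cyc_add)

lemma cls_scale: "r \<in> ipow 0 \<Longrightarrow> x \<in> X0 \<Longrightarrow> r \<odot>\<^bsub>M\<^esub> cls x = cls (vscale r x)"
proof -
  assume r: "r \<in> ipow 0" and x: "x \<in> X0"
  have "ipow k +>\<^bsub>int_ring v\<^esub> r = {z. z - r \<in> ipow k}" for k
    unfolding ipow_def by (rule int_ring_coset)
  then have "(ipow (L ! i) +>\<^bsub>int_ring v\<^esub> r) \<otimes>\<^bsub>cyc v (L ! i)\<^esub> {z. z - x i \<in> ipow (L ! i)} =
      {z. z - r * x i \<in> ipow (L ! i)}" if "i < n" for i
    using cyc_mult[OF r, of "x i"] x that by (simp add: X0_iff)
  then show ?thesis
    by (simp add: type_module_def cls_def fun_eq_iff restrict_def vscale_def flip: ipow_def)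
qed

text \<open>Applying \<open>rep\<close> to an arbitrary preimage puts the lift into
  \<open>reps Y0\<close>, so that lifted images of generators can be members of frames.\<close>

definition lift :: "(nat \<Rightarrow> 'a set) \<Rightarrow> nat \<Rightarrow> 'a" where
  "lift c = rep Y0 (SOME x. x \<in> X0 \<and> cls x = c)"

lemma lift:
  assumes "c \<in> carrier M"
  shows "lift c \<in> X0 \<inter> reps Y0" "cls (lift c) = c"
proof -
  let ?x = "SOME x. x \<in> X0 \<and> cls x = c"
  have x: "?x \<in> X0 \<and> cls ?x = c"
    by (rule someI_ex[of "\<lambda>x. x \<in> X0 \<and> cls x = c"]) (use assms in \<open>auto simp: carrier_M\<close>)
  then show "lift c \<in> X0 \<inter> reps Y0"
    using rep_mem_iff[OF Y_subgroup osub_saturated[OF osub_X0]] by (simp add: lift_def)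
  have "cls (lift c) = cls ?x"
    unfolding cls_eq_iff lift_def by (rule rep_diff[OF Y_subgroup])
  with x show "cls (lift c) = c" by simp
qed

lemma lift_cls:
  assumes x: "x \<in> X0"
  shows "lift (cls x) - x \<in> Y0"
  using lift(2)[OF cls_carrier[OF x]] unfolding cls_eq_iff .

lemma lift_cls_reps: "x \<in> X0 \<inter> reps Y0 \<Longrightarrow> lift (cls x) = x"
  using lift(1)[OF cls_carrier, of x] lift_cls[of x] reps_eq[OF Y_subgroup] by blast

lemma card_carrier_M: "finite (carrier M)" "card (carrier M) = Q ^ sum_list L"
proof -
  have bij: "bij_betw lift (carrier M) (X0 \<inter> reps Y0)"
  proof (rule bij_betw_byWitness[where f' = cls])
    show "\<forall>c\<in>carrier M. cls (lift c) = c" using lift(2) by blast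
    show "\<forall>x\<in>X0 \<inter> reps Y0. lift (cls x) = x" using lift_cls_reps by blast
    show "lift ` carrier M \<subseteq> X0 \<inter> reps Y0" using lift(1) by blast
    show "cls ` (X0 \<inter> reps Y0) \<subseteq> carrier M" using cls_carrier by blast
  qed
  show "finite (carrier M)" using bij_betw_finite[OF bij] finite_X0_reps by blast
  show "card (carrier M) = Q ^ sum_list L"
    using bij_betw_same_card[OF bij] cnt_X0 by (simp add: cnt_def)
qed


section \<open>Automorphisms as tuples of images of the generators\<close>

definition lincomb :: "(nat \<Rightarrow> nat \<Rightarrow> 'a) \<Rightarrow> (nat \<Rightarrow> 'a) \<Rightarrow> nat \<Rightarrow> 'a" where
  "lincomb xs a = (\<Sum>j<n. vscale (a j) (xs j))"

text \<open>An endomorphism is represented by its values on the standard generators.\<close>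

definition hom_tuples :: "(nat \<Rightarrow> nat \<Rightarrow> 'a) set" where
  "hom_tuples = {xs \<in> {..<n} \<rightarrow>\<^sub>E (X0 \<inter> reps Y0). \<forall>j<n. vscale (\<pi> ^ (L ! j)) (xs j) \<in> Y0}"

text \<open>Injectivity is all that has to be recorded, since an injective endomorphism of a finite
  module is bijective.\<close>

definition inj_tuple :: "(nat \<Rightarrow> nat \<Rightarrow> 'a) \<Rightarrow> bool" where
  "inj_tuple xs \<longleftrightarrow> (\<forall>a\<in>X0. lincomb xs a \<in> Y0 \<longrightarrow> a \<in> Y0)"

lemma lincomb_add: "lincomb xs (a + b) = lincomb xs a + lincomb xs b"
  by (simp add: lincomb_def sum.distrib[symmetric] vs.scale_left_distrib)

lemma lincomb_diff: "lincomb xs (a - b) = lincomb xs a - lincomb xs b"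
  by (simp add: lincomb_def sum_subtractf[symmetric] vs.scale_left_diff_distrib)

lemma lincomb_scale: "lincomb xs (vscale r a) = vscale r (lincomb xs a)"
  by (simp add: lincomb_def vs.scale_sum_right vscale_def[of r a])

lemma lincomb_sum: "lincomb xs (\<Sum>i\<in>I. f i) = (\<Sum>i\<in>I. lincomb xs (f i))"
proof -
  have "lincomb xs 0 = 0" by (simp add: lincomb_def)
  from sum_comp_morphism[of "lincomb xs" f I, OF this lincomb_add] show ?thesis
    by (simp only: comp_def)
qed

lemma lincomb_unit_vec: "j < n \<Longrightarrow> lincomb xs (unit_vec j) = xs j"
proof -
  assume j: "j < n"
  have "lincomb xs (unit_vec j) = (\<Sum>i<n. if i = j then xs i else 0)"
    unfolding lincomb_def by (intro sum.cong) (auto simp: unit_vec_def vscale_def fun_eq_iff)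
  then show ?thesis using j by simp
qed

lemma lincomb_unit_vecs: "a - lincomb unit_vec a \<in> Y0"
proof -
  have "lincomb unit_vec a k = a k" if "k < n" for k
    using that by (simp add: lincomb_def sum_fun_apply vscale_def unit_vec_def if_distrib cong: if_cong)
  then show ?thesis by (simp add: Y0_iff)
qed

lemma lincomb_X0:
  assumes "\<And>j. j < n \<Longrightarrow> xs j \<in> X0" "a \<in> X0"
  shows "lincomb xs a \<in> X0"
  unfolding lincomb_def
proof (rule add_subgroup_sum[OF osub_subgroup[OF osub_X0]])
  fix j assume "j \<in> {..<n}"
  then have j: "j < n" by simp
  then have "a j \<in> ipow 0" using assms(2) X0_iff by blast
  then show "vscale (a j) (xs j) \<in> X0" by (rule osub_scale[OF osub_X0 _ assms(1)[OF j]])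
qed

text \<open>Coefficient j of a null vector is divisible by the power of \<pi> that kills the image
  of generator j; this is what makes the linear map descend to the quotient.\<close>

lemma lincomb_Y0:
  assumes xs: "\<And>j. j < n \<Longrightarrow> vscale (\<pi> ^ (L ! j)) (xs j) \<in> Y0" and a: "a \<in> Y0"
  shows "lincomb xs a \<in> Y0"
  unfolding lincomb_def
proof (rule add_subgroup_sum[OF Y_subgroup])
  fix j assume j: "j \<in> {..<n}"
  have "a j \<in> ipow (L ! j)" using a j by (simp add: Y0_iff)
  then obtain b where b: "b \<in> ipow 0" "a j = \<pi> ^ (L ! j) * b"
    using ipow_iff by blast
  have "vscale (a j) (xs j) = vscale b (vscale (\<pi> ^ (L ! j)) (xs j))"
    unfolding b(2) by (simp add: mult.commute)
  also have "\<dots> \<in> Y0" by (rule Y_scale[OF b(1) xs]) (use j in simp)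
  finally show "vscale (a j) (xs j) \<in> Y0" .
qed

lemma hom_tuplesD:
  assumes "xs \<in> hom_tuples"
  shows "\<And>j. j < n \<Longrightarrow> xs j \<in> X0" "\<And>j. j < n \<Longrightarrow> xs j \<in> reps Y0"
    "\<And>j. j < n \<Longrightarrow> vscale (\<pi> ^ (L ! j)) (xs j) \<in> Y0" "xs \<in> extensional {..<n}"
  using assms by (auto simp: hom_tuples_def PiE_def)

lemma lincomb_cong:
  assumes xs: "xs \<in> hom_tuples" and ab: "a - b \<in> Y0"
  shows "lincomb xs a - lincomb xs b \<in> Y0"
  unfolding lincomb_diff[symmetric] by (rule lincomb_Y0[OF hom_tuplesD(3)[OF xs] ab])

lemma inj_tuple_surj:
  assumes xs: "xs \<in> hom_tuples" and inj: "inj_tuple xs" and y: "y \<in> X0"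
  shows "\<exists>a\<in>X0. lincomb xs a - y \<in> Y0"
proof -
  let ?S = "X0 \<inter> reps Y0" and ?h = "\<lambda>a. rep Y0 (lincomb xs a)"
  have sat: "saturated Y0 X0" by (rule osub_saturated[OF osub_X0])
  have "inj_on ?h ?S"
  proof (rule inj_onI)
    fix a b assume ab: "a \<in> ?S" "b \<in> ?S" "?h a = ?h b"
    then have l: "lincomb xs (a - b) \<in> Y0"
      by (simp only: rep_eq_iff[OF Y_subgroup] lincomb_diff)
    have d: "a - b \<in> X0" using ab by (intro add_subgroup_diff[OF osub_subgroup[OF osub_X0]]) blast+
    have "a - b \<in> Y0" using inj d l unfolding inj_tuple_def by blast
    with ab show "a = b" by (intro reps_eq[OF Y_subgroup]) blast+
  qed
  moreover have "?h ` ?S \<subseteq> ?S"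
  proof (rule image_subsetI)
    fix a assume "a \<in> ?S"
    then have "lincomb xs a \<in> X0" by (intro lincomb_X0[OF hom_tuplesD(1)[OF xs]]) auto
    then show "?h a \<in> ?S" using rep_mem_iff[OF Y_subgroup sat] rep_in_reps by blast
  qed
  ultimately have "?h ` ?S = ?S" by (rule endo_inj_surj[OF finite_X0_reps, rotated])
  moreover have "rep Y0 y \<in> ?S" using y rep_mem_iff[OF Y_subgroup sat] rep_in_reps by blast
  ultimately have "rep Y0 y \<in> ?h ` ?S" by (simp only:)
  then obtain a where "a \<in> X0" "rep Y0 (lincomb xs a) = rep Y0 y" by auto
  then show ?thesis unfolding rep_eq_iff[OF Y_subgroup] by blast
qed

definition aut_tuple :: "((nat \<Rightarrow> 'a set) \<Rightarrow> nat \<Rightarrow> 'a set) \<Rightarrow> nat \<Rightarrow> nat \<Rightarrow> 'a" where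
  "aut_tuple f = (\<lambda>j\<in>{..<n}. lift (f (cls (unit_vec j))))"

definition tuple_aut :: "(nat \<Rightarrow> nat \<Rightarrow> 'a) \<Rightarrow> (nat \<Rightarrow> 'a set) \<Rightarrow> nat \<Rightarrow> 'a set" where
  "tuple_aut xs = (\<lambda>c\<in>carrier M. cls (lincomb xs (lift c)))"

abbreviation auts :: "((nat \<Rightarrow> 'a set) \<Rightarrow> nat \<Rightarrow> 'a set) set" where
  "auts \<equiv> module_auts (int_ring v) M"

lemma autsD:
  assumes "f \<in> auts"
  shows "\<And>c. c \<in> carrier M \<Longrightarrow> f c \<in> carrier M" "inj_on f (carrier M)" "f \<in> extensional (carrier M)"
    "\<And>x y. x \<in> X0 \<Longrightarrow> y \<in> X0 \<Longrightarrow> f (cls (x + y)) = f (cls x) \<oplus>\<^bsub>M\<^esub> f (cls y)"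
    "\<And>r x. r \<in> ipow 0 \<Longrightarrow> x \<in> X0 \<Longrightarrow> f (cls (vscale r x)) = r \<odot>\<^bsub>M\<^esub> f (cls x)"
  using assms cls_carrier unfolding module_auts_def carrier_int_ring
  by (auto simp: PiE_def Pi_def bij_betw_def simp flip: cls_add cls_scale)

text \<open>Additivity and linearity of \<open>f\<close> are applied to the partial sums of
  \<open>a\<close> written through the generators; coordinates of \<open>a\<close> beyond the range
  do not affect its class.\<close>

lemma aut_eq_lincomb:
  assumes f: "f \<in> auts" and a: "a \<in> X0"
  shows "f (cls a) = cls (lincomb (aut_tuple f) a)"
proof -
  note fD = autsD[OF f]
  have tup: "aut_tuple f j \<in> X0" "cls (aut_tuple f j) = f (cls (unit_vec j))" if "j < n" for j
    using that lift[OF fD(1)[OF cls_carrier[OF unit_vec_X0]], of j] by (auto simp: aut_tuple_def)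
  note sub = osub_subgroup[OF osub_X0]
  have part: "(\<Sum>j<m. vscale (a j) (unit_vec j)) \<in> X0 \<and> (\<Sum>j<m. vscale (a j) (aut_tuple f j)) \<in> X0 \<and>
      f (cls (\<Sum>j<m. vscale (a j) (unit_vec j))) = cls (\<Sum>j<m. vscale (a j) (aut_tuple f j))" if "m \<le> n" for m
    using that
  proof (induction m)
    case 0
    have 0: "0 \<in> X0" by (rule add_subgroup_0[OF sub])
    \<comment> \<open>That \<open>f\<close> fixes the zero class comes from linearity for the scalar
      0.\<close>
    have "f (cls (vscale 0 0)) = 0 \<odot>\<^bsub>M\<^esub> f (cls 0)"
      using 0 by (intro fD(5)) auto
    moreover obtain w where w: "w \<in> X0" "f (cls 0) = cls w"
      using fD(1)[OF cls_carrier[OF 0]] by (auto simp: carrier_M)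
    ultimately have "f (cls 0) = cls 0"
      using cls_scale[OF _ w(1), of 0] by simp
    then show ?case using 0 by (simp only: lessThan_0 sum.empty simp_thms)
  next
    case (Suc m)
    then have m: "m < n" and am: "a m \<in> ipow 0" using a by (auto simp: X0_iff)
    have u: "vscale (a m) (unit_vec m) \<in> X0" "vscale (a m) (aut_tuple f m) \<in> X0"
      using osub_scale[OF osub_X0 am] unit_vec_X0 tup(1)[OF m] by auto
    have 1: "f (cls (vscale (a m) (unit_vec m))) = cls (vscale (a m) (aut_tuple f m))"
      using fD(5)[OF am unit_vec_X0] cls_scale[OF am tup(1)[OF m]] tup(2)[OF m] by simp
    have IH: "(\<Sum>j<m. vscale (a j) (unit_vec j)) \<in> X0" "(\<Sum>j<m. vscale (a j) (aut_tuple f j)) \<in> X0"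
      "f (cls (\<Sum>j<m. vscale (a j) (unit_vec j))) = cls (\<Sum>j<m. vscale (a j) (aut_tuple f j))"
      using Suc.IH m by auto
    show ?case
      unfolding sum.lessThan_Suc fD(4)[OF IH(1) u(1)] 1 IH(3) cls_add
      by (intro conjI add_subgroup_add[OF sub] IH u refl)
  qed
  have "cls a = cls (lincomb unit_vec a)"
    unfolding cls_eq_iff by (rule lincomb_unit_vecs)
  then show ?thesis using part[of n] by (simp add: lincomb_def)
qed

lemma aut_tuple_in:
  assumes f: "f \<in> auts"
  shows "aut_tuple f \<in> hom_tuples" "inj_tuple (aut_tuple f)"
proof -
  note fD = autsD[OF f]
  have tup: "aut_tuple f j \<in> X0 \<inter> reps Y0" "cls (aut_tuple f j) = f (cls (unit_vec j))" if "j < n" for j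
    using that lift[OF fD(1)[OF cls_carrier[OF unit_vec_X0]], of j] by (auto simp: aut_tuple_def)
  have 0: "0 \<in> X0" by (rule add_subgroup_0[OF osub_subgroup[OF osub_X0]])
  have f0: "f (cls a) = cls 0 \<longleftrightarrow> a \<in> Y0" if a: "a \<in> X0" for a
  proof -
    have "f (cls 0) = cls 0" using aut_eq_lincomb[OF f 0] by (simp add: lincomb_def)
    then have "f (cls a) = cls 0 \<longleftrightarrow> cls a = cls 0"
      using inj_onD[OF fD(2) _ cls_carrier[OF a] cls_carrier[OF 0]] by auto
    then show ?thesis by (simp add: cls_eq_iff)
  qed
  have "vscale (\<pi> ^ (L ! j)) (aut_tuple f j) \<in> Y0" if j: "j < n" for j
  proof -
    have u: "vscale (\<pi> ^ (L ! j)) (unit_vec j) \<in> X0" using unit_vec_tor Y0_subset_X0 by blast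
    have "cls (vscale (\<pi> ^ (L ! j)) (aut_tuple f j)) = f (cls (vscale (\<pi> ^ (L ! j)) (unit_vec j)))"
      using fD(5)[OF pi_power_ipow_0 unit_vec_X0] cls_scale[OF pi_power_ipow_0, of "aut_tuple f j"] tup[OF j]
      by (metis IntD1)
    also have "\<dots> = cls 0" using f0[OF u] unit_vec_tor by blast
    finally show ?thesis by (simp add: cls_eq_iff)
  qed
  then show "aut_tuple f \<in> hom_tuples"
    using tup(1) by (auto simp: hom_tuples_def aut_tuple_def)
  show "inj_tuple (aut_tuple f)"
    unfolding inj_tuple_def
  proof (intro ballI impI)
    fix a assume a: "a \<in> X0" "lincomb (aut_tuple f) a \<in> Y0"
    then have "f (cls a) = cls 0" by (simp add: aut_eq_lincomb[OF f] cls_eq_iff)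
    then show "a \<in> Y0" using f0[OF a(1)] by blast
  qed
qed

lemma tuple_aut_cls:
  assumes xs: "xs \<in> hom_tuples" and a: "a \<in> X0"
  shows "tuple_aut xs (cls a) = cls (lincomb xs a)"
  using cls_carrier[OF a] lincomb_cong[OF xs lift_cls[OF a]]
  by (simp add: tuple_aut_def cls_eq_iff)

lemma tuple_aut_in:
  assumes xs: "xs \<in> hom_tuples" and inj: "inj_tuple xs"
  shows "tuple_aut xs \<in> auts"
proof -
  note lX = lincomb_X0[OF hom_tuplesD(1)[OF xs]]
  note sub = osub_subgroup[OF osub_X0]
  have car: "tuple_aut xs c \<in> carrier M" if "c \<in> carrier M" for c
    using that lift(1)[OF that] lX cls_carrier by (simp add: tuple_aut_def)
  have "inj_on (tuple_aut xs) (carrier M)"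
  proof (rule inj_onI)
    fix c d assume cd: "c \<in> carrier M" "d \<in> carrier M" "tuple_aut xs c = tuple_aut xs d"
    obtain a b where ab: "a \<in> X0" "c = cls a" "b \<in> X0" "d = cls b" using cd by (auto simp: carrier_M)
    have "lincomb xs (a - b) \<in> Y0"
      using cd(3) ab by (simp add: tuple_aut_cls[OF xs] cls_eq_iff lincomb_diff)
    then have "a - b \<in> Y0" using inj add_subgroup_diff[OF sub ab(1,3)] unfolding inj_tuple_def by blast
    then show "c = d" by (simp only: ab cls_eq_iff)
  qed
  then have "bij_betw (tuple_aut xs) (carrier M) (carrier M)"
    using endo_inj_surj[OF card_carrier_M(1)] car by (auto simp: bij_betw_def image_subset_iff)
  moreover have "tuple_aut xs (c \<oplus>\<^bsub>M\<^esub> d) = tuple_aut xs c \<oplus>\<^bsub>M\<^esub> tuple_aut xs d"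
    if "c \<in> carrier M" "d \<in> carrier M" for c d
    using that add_subgroup_add[OF sub] by (auto simp: carrier_M cls_add tuple_aut_cls[OF xs] lincomb_add)
  moreover have "tuple_aut xs (r \<odot>\<^bsub>M\<^esub> c) = r \<odot>\<^bsub>M\<^esub> tuple_aut xs c"
    if "r \<in> ipow 0" "c \<in> carrier M" for r c
    using that osub_scale[OF osub_X0] lX by (auto simp: carrier_M cls_scale tuple_aut_cls[OF xs] lincomb_scale)
  moreover have "tuple_aut xs \<in> carrier M \<rightarrow>\<^sub>E carrier M"
    using car by (auto simp: tuple_aut_def)
  ultimately show ?thesis unfolding module_auts_def carrier_int_ring by blast
qed

lemma aut_tuple_tuple_aut:
  assumes xs: "xs \<in> hom_tuples"
  shows "aut_tuple (tuple_aut xs) = xs"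
proof (rule extensionalityI[of _ "{..<n}"])
  show "aut_tuple (tuple_aut xs) \<in> extensional {..<n}" by (simp add: aut_tuple_def)
  show "xs \<in> extensional {..<n}" by (rule hom_tuplesD[OF xs])
  fix j assume "j \<in> {..<n}"
  then show "aut_tuple (tuple_aut xs) j = xs j"
    using hom_tuplesD(1,2)[OF xs, of j]
    by (simp add: aut_tuple_def tuple_aut_cls[OF xs unit_vec_X0] lincomb_unit_vec lift_cls_reps)
qed

lemma tuple_aut_aut_tuple:
  assumes f: "f \<in> auts"
  shows "tuple_aut (aut_tuple f) = f"
proof (rule extensionalityI[of _ "carrier M"])
  show "tuple_aut (aut_tuple f) \<in> extensional (carrier M)" by (simp add: tuple_aut_def)
  show "f \<in> extensional (carrier M)" by (rule autsD[OF f])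
  fix c assume "c \<in> carrier M"
  then show "tuple_aut (aut_tuple f) c = f c"
    by (auto simp: carrier_M tuple_aut_cls[OF aut_tuple_in(1)[OF f]] aut_eq_lincomb[OF f])
qed

lemma bij_betw_auts_tuples: "bij_betw aut_tuple auts {xs \<in> hom_tuples. inj_tuple xs}"
  by (rule bij_betw_byWitness[where f' = tuple_aut])
    (use aut_tuple_tuple_aut tuple_aut_aut_tuple aut_tuple_in tuple_aut_in in auto)

end

section \<open>Automorphism groups\<close>

locale std_form = std_lattice v \<pi> \<tau> L + sesquilinear v \<pi> \<tau> vscale "null_vecs v L" B
  for v :: "'a::field \<Rightarrow> int" and \<pi> \<tau> L B +
  assumes perf_X0: "perf X0 X0"
begin

definition gram_tuple :: "(nat \<Rightarrow> nat \<Rightarrow> 'a) \<Rightarrow> bool" where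
  "gram_tuple xs \<longleftrightarrow> (\<forall>i<n. \<forall>j<n. B (xs i) (xs j) - B (unit_vec i) (unit_vec j) \<in> ipow 0)"

lemma B_lincomb: "B (lincomb xs a) (lincomb ys b) = (\<Sum>i<n. \<Sum>j<n. \<tau> (a i) * (b j * B (xs i) (ys j)))"
proof -
  have "B (lincomb xs a) (lincomb ys b) = (\<Sum>i<n. B (vscale (a i) (xs i)) (lincomb ys b))"
    by (simp only: lincomb_def[of xs] B_sum_left)
  also have "\<dots> = (\<Sum>i<n. \<Sum>j<n. \<tau> (a i) * (b j * B (xs i) (ys j)))"
    by (simp only: lincomb_def B_sum_right B_scale_left B_scale_right sum_distrib_left mult_ac)
  finally show ?thesis .
qed

text \<open>From generators to all vectors by sesquilinearity. A vector is only congruent to the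
  combination of generators with its coordinates, so \<open>B_cong\<close> has to absorb the
  difference.\<close>

lemma gram_tuple_iff:
  assumes xs: "xs \<in> hom_tuples"
  shows "gram_tuple xs \<longleftrightarrow> (\<forall>a\<in>X0. \<forall>b\<in>X0. B (lincomb xs a) (lincomb xs b) - B a b \<in> ipow 0)"
proof
  assume gram: "gram_tuple xs"
  show "\<forall>a\<in>X0. \<forall>b\<in>X0. B (lincomb xs a) (lincomb xs b) - B a b \<in> ipow 0"
  proof (intro ballI)
    fix a b assume a: "a \<in> X0" and b: "b \<in> X0"
    have u: "lincomb unit_vec c \<in> X0" if "c \<in> X0" for c
      by (rule lincomb_X0[OF unit_vec_X0 that])
    have "B a b - B (lincomb unit_vec a) (lincomb unit_vec b) \<in> ipow 0"
      by (rule B_cong[OF perf_X0 lincomb_unit_vecs lincomb_unit_vecs a u[OF a] b u[OF b]])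
    moreover have "B (lincomb xs a) (lincomb xs b) - B (lincomb unit_vec a) (lincomb unit_vec b) \<in> ipow 0"
    proof -
      have "B (lincomb xs a) (lincomb xs b) - B (lincomb unit_vec a) (lincomb unit_vec b) =
          (\<Sum>i<n. \<Sum>j<n. \<tau> (a i) * (b j * (B (xs i) (xs j) - B (unit_vec i) (unit_vec j))))"
        unfolding B_lincomb by (simp only: sum_subtractf right_diff_distrib)
      also have "\<dots> \<in> ipow 0"
      proof (intro ipow_sum)
        fix i j assume "i \<in> {..<n}" "j \<in> {..<n}"
        then have ij: "i < n" "j < n" by auto
        have "b j * (B (xs i) (xs j) - B (unit_vec i) (unit_vec j)) \<in> ipow 0"
          using b gram ij unfolding gram_tuple_def X0_iff by (intro ipow_multl) blast+
        moreover have "\<tau> (a i) \<in> ipow 0" using a ij(1) unfolding X0_iff by simp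
        ultimately show "\<tau> (a i) * (b j * (B (xs i) (xs j) - B (unit_vec i) (unit_vec j))) \<in> ipow 0"
          by (rule ipow_multl[rotated])
      qed
      finally show ?thesis .
    qed
    ultimately have "(B (lincomb xs a) (lincomb xs b) - B (lincomb unit_vec a) (lincomb unit_vec b)) -
        (B a b - B (lincomb unit_vec a) (lincomb unit_vec b)) \<in> ipow 0"
      by (rule ipow_diff[rotated])
    then show "B (lincomb xs a) (lincomb xs b) - B a b \<in> ipow 0" by simp
  qed
next
  assume *: "\<forall>a\<in>X0. \<forall>b\<in>X0. B (lincomb xs a) (lincomb xs b) - B a b \<in> ipow 0"
  show "gram_tuple xs"
    unfolding gram_tuple_def
  proof (intro allI impI)
    fix i j assume ij: "i < n" "j < n"
    have "B (lincomb xs (unit_vec i)) (lincomb xs (unit_vec j)) - B (unit_vec i) (unit_vec j) \<in> ipow 0"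
      using * unit_vec_X0 by blast
    then show "B (xs i) (xs j) - B (unit_vec i) (unit_vec j) \<in> ipow 0"
      by (simp only: lincomb_unit_vec[OF ij(1)] lincomb_unit_vec[OF ij(2)])
  qed
qed

text \<open>A vector mapped to zero pairs integrally with all images, so by the Gram condition the
  vector itself pairs integrally with all vectors; nondegeneracy makes it zero.\<close>

lemma gram_tuple_inj:
  assumes xs: "xs \<in> hom_tuples" and gram: "gram_tuple xs"
  shows "inj_tuple xs"
  unfolding inj_tuple_def
proof (intro ballI impI)
  fix a assume a: "a \<in> X0" "lincomb xs a \<in> Y0"
  show "a \<in> Y0"
  proof (rule perf_left[OF perf_X0 a(1)])
    fix b assume b: "b \<in> X0"
    have "B (lincomb xs a) (lincomb xs b) \<in> ipow 0"
      by (rule perf_Y_left[OF perf_X0 a(2)]) (rule lincomb_X0[OF hom_tuplesD(1)[OF xs] b])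
    moreover have "B (lincomb xs a) (lincomb xs b) - B a b \<in> ipow 0"
      using gram a(1) b unfolding gram_tuple_iff[OF xs] by blast
    ultimately show "B a b \<in> ipow 0" using ipow_cong by blast
  qed
qed

text \<open>Independence of the representatives is \<open>B_cong\<close>.\<close>

lemma induced_pairing_cls:
  assumes a: "a \<in> X0" and b: "b \<in> X0"
  shows "induced_pairing v n B (cls a) (cls b) = {c. c - B a b \<in> ipow 0}"
proof -
  have mem: "(\<forall>i<n. a' i \<in> cls a i) \<longleftrightarrow> a' - a \<in> Y0" for a a' by (simp add: cls_def Y0_iff)
  have X: "a' \<in> X0" if "a \<in> X0" "a' - a \<in> Y0" for a a'
    using saturatedD[OF osub_saturated[OF osub_X0] that] .
  have "c - B a' b' \<in> ipow 0 \<longleftrightarrow> c - B a b \<in> ipow 0" if "a' - a \<in> Y0" "b' - b \<in> Y0" for a' b' c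
  proof (rule ipow_cong)
    have "B a' b' - B a b \<in> ipow 0"
      by (rule B_cong[OF perf_X0 that X[OF a that(1)] a X[OF b that(2)] b])
    then show "c - B a' b' - (c - B a b) \<in> ipow 0"
      using ipow_comm by simp
  qed
  moreover have "a - a \<in> Y0" "b - b \<in> Y0" using add_subgroup_0[OF Y_subgroup] by simp_all
  moreover have "pp v 0 = ipow 0" by (simp add: ipow_def)
  ultimately show ?thesis
    unfolding induced_pairing_def mem by blast
qed

definition isometries :: "((nat \<Rightarrow> 'a set) \<Rightarrow> nat \<Rightarrow> 'a set) set" where
  "isometries = {f \<in> auts. \<forall>x\<in>carrier M. \<forall>y\<in>carrier M.
     induced_pairing v n B (f x) (f y) = induced_pairing v n B x y}"

lemma card_isometries: "card isometries = card {xs \<in> hom_tuples. gram_tuple xs}"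
proof -
  have eq: "{c. c - r \<in> ipow 0} = {c. c - s \<in> ipow 0} \<longleftrightarrow> r - s \<in> ipow 0" for r s
    by (rule coset_eq_iff)
  have iff: "(\<forall>x\<in>carrier M. \<forall>y\<in>carrier M. induced_pairing v n B (f x) (f y) = induced_pairing v n B x y) \<longleftrightarrow>
      gram_tuple (aut_tuple f)" if f: "f \<in> auts" for f
  proof -
    note xs = aut_tuple_in(1)[OF f]
    have lX: "lincomb (aut_tuple f) a \<in> X0" if "a \<in> X0" for a
      by (rule lincomb_X0) (use hom_tuplesD(1)[OF xs] that in blast)+
    have "induced_pairing v n B (f (cls a)) (f (cls b)) = induced_pairing v n B (cls a) (cls b) \<longleftrightarrow>
        B (lincomb (aut_tuple f) a) (lincomb (aut_tuple f) b) - B a b \<in> ipow 0" if "a \<in> X0" "b \<in> X0" for a b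
      unfolding aut_eq_lincomb[OF f that(1)] aut_eq_lincomb[OF f that(2)]
        induced_pairing_cls[OF that] induced_pairing_cls[OF lX[OF that(1)] lX[OF that(2)]] eq ..
    then show ?thesis
      unfolding gram_tuple_iff[OF xs] carrier_M by simp
  qed
  have "isometries = {f \<in> auts. gram_tuple (aut_tuple f)}"
    unfolding isometries_def using iff by blast
  moreover have "bij_betw aut_tuple {f \<in> auts. gram_tuple (aut_tuple f)} {xs \<in> hom_tuples. gram_tuple xs}"
  proof (rule bij_betw_byWitness[where f' = tuple_aut])
    show "\<forall>f\<in>{f \<in> auts. gram_tuple (aut_tuple f)}. tuple_aut (aut_tuple f) = f"
      using tuple_aut_aut_tuple by blast
    show "\<forall>xs\<in>{xs \<in> hom_tuples. gram_tuple xs}. aut_tuple (tuple_aut xs) = xs"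
      using aut_tuple_tuple_aut by blast
    show "aut_tuple ` {f \<in> auts. gram_tuple (aut_tuple f)} \<subseteq> {xs \<in> hom_tuples. gram_tuple xs}"
      using aut_tuple_in by blast
    show "tuple_aut ` {xs \<in> hom_tuples. gram_tuple xs} \<subseteq> {f \<in> auts. gram_tuple (aut_tuple f)}"
      using tuple_aut_in gram_tuple_inj aut_tuple_tuple_aut by auto
  qed
  ultimately show ?thesis by (simp add: bij_betw_same_card)
qed

end

section \<open>The diagonal form, and automorphisms without pairing or with a Hermitian one\<close>

context std_lattice
begin

lemma her_form_add_left: "her_form \<tau> \<pi> L (x + y) z = her_form \<tau> \<pi> L x z + her_form \<tau> \<pi> L y z"
  by (simp add: her_form_def tau_add sum.distrib[symmetric] algebra_simps add_divide_distrib)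

lemma her_form_add_right: "her_form \<tau> \<pi> L z (x + y) = her_form \<tau> \<pi> L z x + her_form \<tau> \<pi> L z y"
  by (simp add: her_form_def sum.distrib[symmetric] algebra_simps add_divide_distrib)

lemma her_form_scale_left: "her_form \<tau> \<pi> L (vscale a x) y = \<tau> a * her_form \<tau> \<pi> L x y"
  by (simp add: her_form_def tau_mult vscale_def sum_distrib_left mult.assoc)

lemma her_form_scale_right: "her_form \<tau> \<pi> L x (vscale a y) = a * her_form \<tau> \<pi> L x y"
  by (simp add: her_form_def vscale_def sum_distrib_left mult.left_commute)

lemma her_form_unit_right: "j < n \<Longrightarrow> her_form \<tau> \<pi> L x (unit_vec j) = \<tau> (x j) / \<pi> ^ (L ! j)"
  by (simp add: her_form_def unit_vec_def if_distrib if_distribR cong: if_cong)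

lemma her_form_unit_left: "j < n \<Longrightarrow> her_form \<tau> \<pi> L (unit_vec j) y = y j / \<pi> ^ (L ! j)"
  by (simp add: her_form_def unit_vec_def if_distrib[of \<tau>] if_distrib if_distribR cong: if_cong)

text \<open>For nondegeneracy, pairing with \<open>unit_vec j\<close> reads off coordinate j, up to
  \<tau> and divided by \<open>\<pi> ^ (L ! j)\<close>; an integral value puts the coordinate into
  \<open>ipow (L ! j)\<close>.\<close>

lemma std_form_her_form: "std_form v \<pi> \<tau> L (her_form \<tau> \<pi> L)"
proof -
  interpret sesquilinear v \<pi> \<tau> vscale "null_vecs v L" "her_form \<tau> \<pi> L"
    by unfold_locales (rule her_form_add_left her_form_add_right her_form_scale_left her_form_scale_right)+
  have "perf X0 X0"
    unfolding perf_def
  proof (intro conjI osub_X0 ballI impI)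
    fix x y assume x: "x \<in> Y0" and y: "y \<in> X0"
    have "\<tau> (x i) * y i / \<pi> ^ (L ! i) \<in> ipow 0" if "i < n" for i
      unfolding div_pi_ipow_iff using that x y by (intro ipow_multr) (auto simp: X0_iff Y0_iff)
    then show "her_form \<tau> \<pi> L x y \<in> ipow 0" unfolding her_form_def by (intro ipow_sum) simp
  next
    fix x y assume x: "x \<in> X0" and y: "y \<in> Y0"
    have "\<tau> (x i) * y i / \<pi> ^ (L ! i) \<in> ipow 0" if "i < n" for i
      unfolding div_pi_ipow_iff using that x y by (intro ipow_multl) (auto simp: X0_iff Y0_iff)
    then show "her_form \<tau> \<pi> L x y \<in> ipow 0" unfolding her_form_def by (intro ipow_sum) simp
  next
    fix x assume "x \<in> X0" and *: "\<forall>y\<in>X0. her_form \<tau> \<pi> L x y \<in> ipow 0"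
    have "x j \<in> ipow (L ! j)" if j: "j < n" for j
    proof -
      have "\<tau> (x j) / \<pi> ^ (L ! j) \<in> ipow 0" using * unit_vec_X0[of j] her_form_unit_right[OF j] by metis
      then show ?thesis unfolding div_pi_ipow_iff by simp
    qed
    then show "x \<in> Y0" by (simp add: Y0_iff)
  next
    fix y assume "y \<in> X0" and *: "\<forall>x\<in>X0. her_form \<tau> \<pi> L x y \<in> ipow 0"
    have "y j \<in> ipow (L ! j)" if j: "j < n" for j
    proof -
      have "y j / \<pi> ^ (L ! j) \<in> ipow 0" using * unit_vec_X0[of j] her_form_unit_left[OF j] by metis
      then show ?thesis unfolding div_pi_ipow_iff .
    qed
    then show "y \<in> Y0" by (simp add: Y0_iff)
  qed
  then show ?thesis by unfold_locales
qed

lemma hom_tuplesI: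
  assumes "\<And>j. j < n \<Longrightarrow> f j \<in> X0 \<inter> reps Y0" "\<And>j. j < n \<Longrightarrow> vscale (\<pi> ^ (L ! j)) (f j) \<in> Y0"
  shows "(\<lambda>j\<in>{..<n}. f j) \<in> hom_tuples"
  using assms by (simp add: hom_tuples_def)

end

text \<open>An automorphism is recorded together with its inverse adjoint.\<close>

lemma (in std_lattice) card_auts:
  assumes tau: "\<tau> = (\<lambda>x. x)" and part: "is_partition L"
  shows "real (card auts) = real Q ^ (sum_list L + 2 * n_part L) * b_part L (1 / real Q)"
proof -
  let ?B = "her_form \<tau> \<pi> L"
  interpret std_form v \<pi> \<tau> L ?B by (rule std_form_her_form)
  let ?S = "(X0 \<inter> reps Y0) \<times> (X0 \<inter> reps Y0)"
  let ?F = "frames dual_gram dual_orth ?S L"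
  let ?g = "\<lambda>zs. \<lambda>j\<in>{..<n}. fst (zs ! j)"
  define \<delta> where "\<delta> i j = (if i = j then 1 / \<pi> ^ (L ! i) else 0)" for i j
  have frame: "zs \<in> ?F \<longleftrightarrow> length zs = n \<and> (\<forall>i<n. zs ! i \<in> ?S \<and> vscale (\<pi> ^ (L ! i)) (fst (zs ! i)) \<in> Y0 \<and>
      vscale (\<pi> ^ (L ! i)) (snd (zs ! i)) \<in> Y0) \<and>
      (\<forall>i<n. \<forall>j<n. ?B (fst (zs ! i)) (snd (zs ! j)) - \<delta> i j \<in> ipow 0)" for zs
  proof -
    have "(\<forall>i<n. ?B (fst (zs ! i)) (snd (zs ! i)) - 1 / \<pi> ^ (L ! i) \<in> ipow 0) \<and>
        (\<forall>j<n. \<forall>i<j. ?B (fst (zs ! i)) (snd (zs ! j)) \<in> ipow 0 \<and> ?B (fst (zs ! j)) (snd (zs ! i)) \<in> ipow 0) \<longleftrightarrow>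
        (\<forall>i<n. \<forall>j<n. ?B (fst (zs ! i)) (snd (zs ! j)) - \<delta> i j \<in> ipow 0)" (is "?l \<longleftrightarrow> ?r")
    proof
      assume l: ?l
      show ?r
      proof (intro allI impI)
        fix i j assume "i < n" "j < n"
        then show "?B (fst (zs ! i)) (snd (zs ! j)) - \<delta> i j \<in> ipow 0"
          using l by (cases i j rule: linorder_cases) (auto simp: \<delta>_def)
      qed
    next
      assume r: ?r
      show ?l
      proof (intro conjI allI impI)
        fix i assume "i < n"
        then have "?B (fst (zs ! i)) (snd (zs ! i)) - \<delta> i i \<in> ipow 0" using r by blast
        then show "?B (fst (zs ! i)) (snd (zs ! i)) - 1 / \<pi> ^ (L ! i) \<in> ipow 0"
          by (simp add: \<delta>_def)
      next
        fix i j assume "j < n" "i < j"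
        then have "i < n" "i \<noteq> j" by auto
        with r \<open>j < n\<close> have "?B (fst (zs ! i)) (snd (zs ! j)) - \<delta> i j \<in> ipow 0"
          "?B (fst (zs ! j)) (snd (zs ! i)) - \<delta> j i \<in> ipow 0" by blast+
        with \<open>i \<noteq> j\<close> show "?B (fst (zs ! i)) (snd (zs ! j)) \<in> ipow 0" "?B (fst (zs ! j)) (snd (zs ! i)) \<in> ipow 0"
          by (auto simp: \<delta>_def)
      qed
    qed
    moreover have "set zs \<subseteq> ?S \<longleftrightarrow> (\<forall>i<n. zs ! i \<in> ?S)" if "length zs = n"
      unfolding subset_code(1) all_set_conv_all_nth that by blast
    ultimately show ?thesis
      unfolding frames_def dual_gram_def dual_orth_def case_prod_unfold mem_Collect_eq by blast
  qed
  have gramD: "?B (fst (zs ! i)) (snd (zs ! j)) - \<delta> i j \<in> ipow 0" if "zs \<in> ?F" "i < n" "j < n" for zs i j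
    using that unfolding frame by blast
  have "bij_betw ?g ?F {xs \<in> hom_tuples. inj_tuple xs}"
  proof (rule bij_betw_imageI)
    \<comment> \<open>Pairing a vanishing combination with the j-th dual vector isolates the
      coefficient \<open>a j\<close>.\<close>
    have inj: "inj_tuple (?g zs)" if zs: "zs \<in> ?F" for zs
      unfolding inj_tuple_def
    proof (intro ballI impI)
      fix a assume a: "a \<in> X0" "lincomb (?g zs) a \<in> Y0"
      have "a j \<in> ipow (L ! j)" if j: "j < n" for j
      proof -
        have "?B (lincomb (?g zs) a) (snd (zs ! j)) \<in> ipow 0"
          using zs j unfolding frame by (intro perf_Y_left[OF perf_X0 a(2)]) auto
        moreover have "?B (lincomb (?g zs) a) (snd (zs ! j)) - a j / \<pi> ^ (L ! j) =
            (\<Sum>i<n. a i * (?B (fst (zs ! i)) (snd (zs ! j)) - \<delta> i j))"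
        proof -
          have "?B (lincomb (?g zs) a) (snd (zs ! j)) = (\<Sum>i<n. a i * ?B (fst (zs ! i)) (snd (zs ! j)))"
            unfolding lincomb_def B_sum_left B_scale_left by (simp add: tau)
          moreover have "(\<Sum>i<n. a i * \<delta> i j) = a j / \<pi> ^ (L ! j)"
            using j by (simp add: \<delta>_def if_distrib cong: if_cong)
          ultimately show ?thesis by (simp only: right_diff_distrib sum_subtractf)
        qed
        moreover have "(\<Sum>i<n. a i * (?B (fst (zs ! i)) (snd (zs ! j)) - \<delta> i j)) \<in> ipow 0"
        proof (rule ipow_sum)
          fix i assume "i \<in> {..<n}"
          then show "a i * (?B (fst (zs ! i)) (snd (zs ! j)) - \<delta> i j) \<in> ipow 0"
            using a(1) j by (intro ipow_multl[OF _ gramD[OF zs]]) (simp_all add: X0_iff)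
        qed
        ultimately have "a j / \<pi> ^ (L ! j) \<in> ipow 0" using ipow_cong by metis
        then show ?thesis unfolding div_pi_ipow_iff .
      qed
      then show "a \<in> Y0" by (simp add: Y0_iff)
    qed
    have hom: "?g zs \<in> hom_tuples" if "zs \<in> ?F" for zs
      using that unfolding frame by (intro hom_tuplesI) auto
    show "inj_on ?g ?F"
    proof (rule inj_onI)
      fix zs ws assume zs: "zs \<in> ?F" and ws: "ws \<in> ?F" and eq: "?g zs = ?g ws"
      have fst: "fst (zs ! i) = fst (ws ! i)" if "i < n" for i
        using fun_cong[OF eq, of i] that by simp
      \<comment> \<open>The second components are determined by the first: these span, and the
        difference of two candidates pairs integrally with each of them.\<close>
      have snd: "snd (zs ! j) = snd (ws ! j)" if j: "j < n" for j
      proof (rule reps_eq[OF Y_subgroup])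
        let ?y = "snd (zs ! j)" and ?y' = "snd (ws ! j)"
        show "?y \<in> reps Y0" "?y' \<in> reps Y0" using zs ws j unfolding frame by auto
        have yX: "?y \<in> X0" "?y' \<in> X0" using zs ws j unfolding frame by auto
        show "?y - ?y' \<in> Y0"
        proof (rule perf_right[OF perf_X0])
          show dX: "?y - ?y' \<in> X0" using yX by (rule add_subgroup_diff[OF osub_subgroup[OF osub_X0]])
          fix x assume x: "x \<in> X0"
          obtain a where a: "a \<in> X0" "lincomb (?g zs) a - x \<in> Y0"
            using inj_tuple_surj[OF hom[OF zs] inj[OF zs] x] by blast
          have "?B (lincomb (?g zs) a - x) (?y - ?y') \<in> ipow 0"
            by (rule perf_Y_left[OF perf_X0 a(2) dX])
          moreover have "?B (lincomb (?g zs) a) (?y - ?y') \<in> ipow 0"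
          proof -
            have "?B (lincomb (?g zs) a) (?y - ?y') = (\<Sum>i<n. a i * ?B (fst (zs ! i)) (?y - ?y'))"
              unfolding lincomb_def B_sum_left B_scale_left by (simp add: tau)
            also have "\<dots> \<in> ipow 0"
            proof (rule ipow_sum)
              fix i assume i: "i \<in> {..<n}"
              have "(?B (fst (zs ! i)) ?y - \<delta> i j) - (?B (fst (ws ! i)) ?y' - \<delta> i j) \<in> ipow 0"
                using i by (intro ipow_diff[OF gramD[OF zs _ j] gramD[OF ws _ j]]) simp_all
              then have "?B (fst (zs ! i)) (?y - ?y') \<in> ipow 0"
                using fst[of i] i by (simp add: B_diff_right)
              moreover have "a i \<in> ipow 0" using a(1) i unfolding X0_iff by simp
              ultimately show "a i * ?B (fst (zs ! i)) (?y - ?y') \<in> ipow 0" by (rule ipow_multl[rotated])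
            qed
            finally show ?thesis .
          qed
          ultimately have "?B (lincomb (?g zs) a) (?y - ?y') - ?B (lincomb (?g zs) a - x) (?y - ?y') \<in> ipow 0"
            by (rule ipow_diff[rotated])
          then show "?B x (?y - ?y') \<in> ipow 0" by (simp only: B_diff_left) simp
        qed
      qed
      have "length zs = n" "length ws = n" using zs ws unfolding frame by blast+
      then show "zs = ws" using fst snd by (intro nth_equalityI prod_eqI) auto
    qed
    have "xs \<in> ?g ` ?F" if xs: "xs \<in> hom_tuples" "inj_tuple xs" for xs
    proof -
      \<comment> \<open>As preimages of the generators, the \<open>b i\<close> are the columns of
        the inverse automorphism.\<close>
      obtain b where b: "\<And>i. b i \<in> X0" "\<And>i. lincomb xs (b i) - unit_vec i \<in> Y0"
        using inj_tuple_surj[OF xs unit_vec_X0] by metis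
      have pb: "\<pi> ^ (L ! i) * b i j \<in> ipow (L ! j)" if "j < n" for i j
      proof -
        have "vscale (\<pi> ^ (L ! i)) (lincomb xs (b i) - unit_vec i) \<in> Y0"
          by (rule Y_scale[OF pi_power_ipow_0 b(2)])
        then have "lincomb xs (vscale (\<pi> ^ (L ! i)) (b i)) - vscale (\<pi> ^ (L ! i)) (unit_vec i) \<in> Y0"
          by (simp only: lincomb_scale vs.scale_right_diff_distrib)
        then have "lincomb xs (vscale (\<pi> ^ (L ! i)) (b i)) \<in> Y0"
          using unit_vec_tor[of i] add_subgroup_mem_cong[OF Y_subgroup] by blast
        then have "vscale (\<pi> ^ (L ! i)) (b i) \<in> Y0"
          using xs(2) osub_scale[OF osub_X0 pi_power_ipow_0 b(1)] unfolding inj_tuple_def by blast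
        then show ?thesis using that by (simp add: Y0_iff vscale_def)
      qed
      \<comment> \<open>The adjoint of the inverse for the diagonal form: transposing the matrix of
        the inverse brings in a quotient of powers of \<pi>. It is integral because the inverse
        respects torsion, which is \<open>pb\<close>.\<close>
      define y where "y j = (\<lambda>i. \<pi> ^ (L ! i) * b i j / \<pi> ^ (L ! j))" for j
      have yX: "y j \<in> X0" if "j < n" for j
        using pb[OF that] by (simp add: X0_iff y_def div_pi_ipow_iff)
      have ytor: "vscale (\<pi> ^ (L ! j)) (y j) \<in> Y0" if j: "j < n" for j
        unfolding Y0_iff
      proof (intro allI impI)
        fix i assume "i < n"
        have "vscale (\<pi> ^ (L ! j)) (y j) i = \<pi> ^ (L ! i) * b i j" by (simp add: vscale_def y_def)
        also have "\<dots> \<in> ipow (L ! i)" using b(1)[of i] j by (intro ipow_multr) (simp_all add: X0_iff)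
        finally show "vscale (\<pi> ^ (L ! j)) (y j) i \<in> ipow (L ! i)" .
      qed
      have gram: "?B (xs k) (y j) - \<delta> k j \<in> ipow 0" if k: "k < n" and j: "j < n" for k j
      proof -
        \<comment> \<open>The inverse applied to \<open>xs k\<close>, hence congruent to generator
          k; its coordinate j, divided by \<open>\<pi> ^ (L ! j)\<close>, is the pairing of
          \<open>xs k\<close> with \<open>y j\<close>.\<close>
        define c where "c = (\<Sum>i<n. vscale (xs k i) (b i))"
        have xk: "xs k i \<in> ipow 0" if "i < n" for i
          using hom_tuplesD(1)[OF xs(1) k] that by (simp add: X0_iff)
        have cX: "c \<in> X0"
          unfolding c_def
          by (rule add_subgroup_sum[OF osub_subgroup[OF osub_X0]], rule osub_scale[OF osub_X0 xk b(1)]) simp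
        have "(\<Sum>i<n. vscale (xs k i) (lincomb xs (b i) - unit_vec i)) \<in> Y0"
          by (rule add_subgroup_sum[OF Y_subgroup], rule Y_scale[OF xk b(2)]) simp
        moreover have "(\<Sum>i<n. vscale (xs k i) (lincomb xs (b i) - unit_vec i)) = lincomb xs c - lincomb unit_vec (xs k)"
          unfolding c_def lincomb_sum
          by (simp only: lincomb_scale vs.scale_right_diff_distrib sum_subtractf lincomb_def[of unit_vec])
        ultimately have "lincomb xs c - lincomb unit_vec (xs k) \<in> Y0" by (simp only:)
        then have "lincomb xs c - xs k \<in> Y0"
          using add_subgroup_trans[OF Y_subgroup _ add_subgroup_comm[OF Y_subgroup lincomb_unit_vecs]] by blast
        then have "lincomb xs (c - unit_vec k) \<in> Y0"
          by (simp only: lincomb_diff lincomb_unit_vec[OF k])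
        then have "c - unit_vec k \<in> Y0"
          using xs(2) add_subgroup_diff[OF osub_subgroup[OF osub_X0] cX unit_vec_X0] unfolding inj_tuple_def by blast
        then have "c j - unit_vec k j \<in> ipow (L ! j)" using j by (simp add: Y0_iff)
        then have "(c j - unit_vec k j) / \<pi> ^ (L ! j) \<in> ipow 0" unfolding div_pi_ipow_iff .
        moreover have "?B (xs k) (y j) = c j / \<pi> ^ (L ! j)"
          by (simp add: her_form_def tau y_def c_def sum_fun_apply vscale_def sum_divide_distrib mult_ac)
        moreover have "unit_vec k j / \<pi> ^ (L ! j) = \<delta> k j" by (simp add: unit_vec_def \<delta>_def)
        ultimately show ?thesis by (simp add: diff_divide_distrib)
      qed
      let ?y = "\<lambda>j. rep Y0 (y j)"
      have sat: "saturated Y0 X0" by (rule osub_saturated[OF osub_X0])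
      have ry: "?y j - y j \<in> Y0" for j by (rule rep_diff[OF Y_subgroup])
      have ryX: "?y j \<in> X0" if "j < n" for j using yX[OF that] rep_mem_iff[OF Y_subgroup sat] by blast
      let ?zs = "map (\<lambda>j. (xs j, ?y j)) [0..<n]"
      have zsF: "?zs \<in> ?F"
        unfolding frame
      proof (intro conjI allI impI)
        fix i assume i: "i < n"
        show "?zs ! i \<in> ?S" using i hom_tuplesD(1,2)[OF xs(1) i] ryX[OF i] rep_in_reps by simp
        show "vscale (\<pi> ^ (L ! i)) (fst (?zs ! i)) \<in> Y0" using i hom_tuplesD(3)[OF xs(1) i] by simp
        have "vscale (\<pi> ^ (L ! i)) (?y i - y i) \<in> Y0" by (rule Y_scale[OF pi_power_ipow_0 ry])
        then have "vscale (\<pi> ^ (L ! i)) (?y i) \<in> Y0"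
          using ytor[OF i] add_subgroup_mem_cong[OF Y_subgroup] unfolding vs.scale_right_diff_distrib by blast
        then show "vscale (\<pi> ^ (L ! i)) (snd (?zs ! i)) \<in> Y0" using i by simp
        fix j assume j: "j < n"
        have "?B (xs i) (?y j - y j) \<in> ipow 0"
          by (rule perf_Y_right[OF perf_X0 hom_tuplesD(1)[OF xs(1) i] ry])
        then have "?B (xs i) (?y j - y j) + (?B (xs i) (y j) - \<delta> i j) \<in> ipow 0"
          using gram[OF i j] by (rule ipow_add)
        then show "?B (fst (?zs ! i)) (snd (?zs ! j)) - \<delta> i j \<in> ipow 0"
          using i j by (simp add: B_diff_right)
      qed simp
      have gzs: "?g ?zs = xs"
        by (rule extensionalityI[OF _ hom_tuplesD(4)[OF xs(1)]]) auto
      show ?thesis by (rule image_eqI[of xs ?g ?zs, OF gzs[symmetric] zsF])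
    qed
    then have "{xs \<in> hom_tuples. inj_tuple xs} \<subseteq> ?g ` ?F" by blast
    moreover have "?g ` ?F \<subseteq> {xs \<in> hom_tuples. inj_tuple xs}"
      by (rule image_subsetI) (rule CollectI, rule conjI[OF hom inj])
    ultimately show "?g ` ?F = {xs \<in> hom_tuples. inj_tuple xs}" by (rule subset_antisym[rotated])
  qed
  from bij_betw_same_card[OF this] bij_betw_same_card[OF bij_betw_auts_tuples]
  have "card auts = card ?F" by (simp only:)
  then show ?thesis
    using card_dual_frames[OF perf_X0 type_inv_X0 type_inv_X0 part] by simp
qed

text \<open>Here a frame is just the tuple of images of the generators. The Gram conditions with i >
  j, which \<open>frames\<close> does not ask for, follow by Hermitian symmetry.\<close>

lemma (in std_lattice) card_her_auts:
  assumes herm: "hermitian_field v \<pi> \<tau> q" and part: "is_partition L"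
  shows "real (card (her_auts v \<tau> \<pi> L)) = real q ^ (sum_list L + 2 * n_part L) * b_part L (- 1 / real q)"
proof -
  let ?B = "her_form \<tau> \<pi> L"
  interpret std_form v \<pi> \<tau> L ?B by (rule std_form_her_form)
  interpret hermitian_field v \<pi> \<tau> q by (rule herm)
  interpret hermitian_lattice v \<pi> \<tau> vscale "null_vecs v L" ?B q
  proof
    show "?B y x = \<tau> (?B x y)" for x y
    proof -
      have "\<tau> (\<Sum>i\<in>A. f i) = (\<Sum>i\<in>A. \<tau> (f i))" for A and f :: "nat \<Rightarrow> 'a"
        by (induction A rule: infinite_finite_induct) (simp_all add: tau_add)
      then show ?thesis
        by (simp add: her_form_def tau_divide tau_mult tau_power mult.commute)
    qed
  qed
  let ?F = "frames herm_gram herm_orth (X0 \<inter> reps Y0) L"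
  define \<delta> where "\<delta> i j = (if i = j then 1 / \<pi> ^ (L ! i) else 0)" for i j
  have unit: "?B (unit_vec i) (unit_vec j) = \<delta> i j" if "j < n" for i j
    unfolding her_form_unit_right[OF that] by (simp add: \<delta>_def unit_vec_def)
  have frame: "zs \<in> ?F \<longleftrightarrow> length zs = n \<and>
      (\<forall>i<n. zs ! i \<in> X0 \<inter> reps Y0 \<and> vscale (\<pi> ^ (L ! i)) (zs ! i) \<in> Y0) \<and>
      (\<forall>i<n. \<forall>j<n. ?B (zs ! i) (zs ! j) - \<delta> i j \<in> ipow 0)" for zs
  proof -
    have "(\<forall>i<n. ?B (zs ! i) (zs ! i) - 1 / \<pi> ^ (L ! i) \<in> ipow 0) \<and>
        (\<forall>j<n. \<forall>i<j. ?B (zs ! i) (zs ! j) \<in> ipow 0) \<longleftrightarrow>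
        (\<forall>i<n. \<forall>j<n. ?B (zs ! i) (zs ! j) - \<delta> i j \<in> ipow 0)" (is "?l \<longleftrightarrow> ?r")
    proof
      assume l: ?l
      show ?r
      proof (intro allI impI)
        fix i j assume ij: "i < n" "j < n"
        consider "i < j" | "i = j" | "j < i" by (rule linorder_cases)
        then show "?B (zs ! i) (zs ! j) - \<delta> i j \<in> ipow 0"
        proof cases
          case 1
          then have "?B (zs ! i) (zs ! j) \<in> ipow 0" using l ij by blast
          with 1 show ?thesis by (simp add: \<delta>_def)
        next
          case 2
          have "?B (zs ! i) (zs ! i) - 1 / \<pi> ^ (L ! i) \<in> ipow 0" using l ij by blast
          with 2 show ?thesis by (simp add: \<delta>_def)
        next
          case 3
          then have "?B (zs ! j) (zs ! i) \<in> ipow 0" using l ij by blast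
          then have "?B (zs ! i) (zs ! j) \<in> ipow 0" by (subst hermitian_flip)
          with 3 show ?thesis by (simp add: \<delta>_def)
        qed
      qed
    next
      assume r: ?r
      show ?l
      proof (intro conjI allI impI)
        fix i assume "i < n"
        then have "?B (zs ! i) (zs ! i) - \<delta> i i \<in> ipow 0" using r by blast
        then show "?B (zs ! i) (zs ! i) - 1 / \<pi> ^ (L ! i) \<in> ipow 0"
          by (simp add: \<delta>_def)
      next
        fix i j assume "j < n" "i < j"
        then have "i < n" "i \<noteq> j" by auto
        with r \<open>j < n\<close> have "?B (zs ! i) (zs ! j) - \<delta> i j \<in> ipow 0" by blast
        with \<open>i \<noteq> j\<close> show "?B (zs ! i) (zs ! j) \<in> ipow 0" by (simp add: \<delta>_def)
      qed
    qed
    moreover have "set zs \<subseteq> X0 \<inter> reps Y0 \<longleftrightarrow> (\<forall>i<n. zs ! i \<in> X0 \<inter> reps Y0)" if "length zs = n"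
      unfolding subset_code(1) all_set_conv_all_nth that by blast
    ultimately show ?thesis
      unfolding frames_def herm_gram_def herm_orth_def mem_Collect_eq by blast
  qed
  have gram: "gram_tuple xs \<longleftrightarrow> (\<forall>i<n. \<forall>j<n. ?B (xs i) (xs j) - \<delta> i j \<in> ipow 0)" for xs
    unfolding gram_tuple_def using unit by simp
  have "bij_betw (\<lambda>zs. \<lambda>j\<in>{..<n}. zs ! j) ?F {xs \<in> hom_tuples. gram_tuple xs}"
  proof (rule bij_betw_byWitness[where f' = "\<lambda>xs. map xs [0..<n]"])
    show "\<forall>zs\<in>?F. map (\<lambda>j\<in>{..<n}. zs ! j) [0..<n] = zs"
    proof
      fix zs assume "zs \<in> ?F"
      then have "length zs = n" unfolding frame by blast
      then show "map (\<lambda>j\<in>{..<n}. zs ! j) [0..<n] = zs" by (intro nth_equalityI) simp_all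
    qed
    show "\<forall>xs\<in>{xs \<in> hom_tuples. gram_tuple xs}. (\<lambda>j\<in>{..<n}. map xs [0..<n] ! j) = xs"
    proof clarify
      fix xs assume "xs \<in> hom_tuples"
      then show "(\<lambda>j\<in>{..<n}. map xs [0..<n] ! j) = xs"
        by (intro extensionalityI[OF restrict_extensional hom_tuplesD(4)]) simp_all
    qed
    show "(\<lambda>zs. \<lambda>j\<in>{..<n}. zs ! j) ` ?F \<subseteq> {xs \<in> hom_tuples. gram_tuple xs}"
    proof (rule image_subsetI)
      fix zs assume zs: "zs \<in> ?F"
      then have "(\<lambda>j\<in>{..<n}. zs ! j) \<in> hom_tuples" unfolding frame by (intro hom_tuplesI) blast+
      moreover have "gram_tuple (\<lambda>j\<in>{..<n}. zs ! j)" using zs unfolding frame gram by simp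
      ultimately show "(\<lambda>j\<in>{..<n}. zs ! j) \<in> {xs \<in> hom_tuples. gram_tuple xs}" by blast
    qed
    show "(\<lambda>xs. map xs [0..<n]) ` {xs \<in> hom_tuples. gram_tuple xs} \<subseteq> ?F"
    proof (rule image_subsetI)
      fix xs assume "xs \<in> {xs \<in> hom_tuples. gram_tuple xs}"
      then have xs: "xs \<in> hom_tuples" "gram_tuple xs" by auto
      show "map xs [0..<n] \<in> ?F"
        unfolding frame using hom_tuplesD(1-3)[OF xs(1)] xs(2) unfolding gram by simp
    qed
  qed
  from bij_betw_same_card[OF this] have "card ?F = card isometries"
    by (simp only: card_isometries)
  moreover have "her_auts v \<tau> \<pi> L = isometries"
    unfolding her_auts_def her_pairing_def isometries_def ..
  ultimately show ?thesis
    using card_herm_frames[OF perf_X0 type_inv_X0 part] by simp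
qed

section \<open>The alternating form and its automorphisms\<close>

lemma nth_double_parts:
  "i < length lam \<Longrightarrow> double_parts lam ! (2 * i) = lam ! i"
  "i < length lam \<Longrightarrow> double_parts lam ! Suc (2 * i) = lam ! i"
proof (induction lam arbitrary: i)
  case (Cons k lam)
  { case 1 then show ?case using Cons.IH(1)[of "i - 1"] by (cases i) auto }
  { case 2 then show ?case using Cons.IH(2)[of "i - 1"] by (cases i) auto }
qed auto

lemma all_less_double: "(\<forall>k<2 * m. P k) \<longleftrightarrow> (\<forall>i<m. P (2 * i) \<and> P (Suc (2 * i)))"
proof
  assume *: "\<forall>i<m. P (2 * i) \<and> P (Suc (2 * i))"
  show "\<forall>k<2 * m. P k"
  proof (intro allI impI)
    fix k assume k: "k < 2 * m"
    then have "k div 2 < m" by simp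
    with * have "P (2 * (k div 2))" "P (Suc (2 * (k div 2)))" by auto
    moreover have "k = 2 * (k div 2) \<or> k = Suc (2 * (k div 2))" by presburger
    ultimately show "P k" by metis
  qed
qed auto

text \<open>Pairing with the generator at \<open>2 * j\<close> reads the coordinate at
  \<open>2 * j + 1\<close> up to sign, and conversely, so the generators detect both coordinates of
  each block.\<close>

lemma (in std_lattice) std_form_alt_form:
  assumes tau: "\<tau> = (\<lambda>x. x)" and L: "L = double_parts lam"
  shows "std_form v \<pi> \<tau> L (alt_form \<pi> lam)"
proof -
  let ?B = "alt_form \<pi> lam"
  interpret sesquilinear v \<pi> \<tau> vscale "null_vecs v L" ?B
  proof
    show "?B (x + y) z = ?B x z + ?B y z" for x y z
      by (simp add: alt_form_def sum.distrib[symmetric] algebra_simps add_divide_distrib diff_divide_distrib)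
    show "?B z (x + y) = ?B z x + ?B z y" for x y z
      by (simp add: alt_form_def sum.distrib[symmetric] algebra_simps add_divide_distrib diff_divide_distrib)
    show "?B (vscale a x) y = \<tau> a * ?B x y" for a x y
      by (simp add: alt_form_def vscale_def tau sum_distrib_left right_diff_distrib mult_ac)
    show "?B x (vscale a y) = a * ?B x y" for a x y
      by (simp add: alt_form_def vscale_def sum_distrib_left right_diff_distrib mult_ac)
  qed
  have n: "n = 2 * length lam" by (simp add: L)
  have Li: "L ! (2 * i) = lam ! i" "L ! Suc (2 * i) = lam ! i" if "i < length lam" for i
    using nth_double_parts[OF that] by (simp_all add: L)
  have X: "x \<in> X0 \<longleftrightarrow> (\<forall>i<length lam. x (2 * i) \<in> ipow 0 \<and> x (Suc (2 * i)) \<in> ipow 0)" for x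
    unfolding X0_iff n by (rule all_less_double)
  have Y: "x \<in> Y0 \<longleftrightarrow> (\<forall>i<length lam. x (2 * i) \<in> ipow (lam ! i) \<and> x (Suc (2 * i)) \<in> ipow (lam ! i))" for x
    unfolding Y0_iff n all_less_double using Li by simp
  have unit: "?B x (unit_vec (2 * j)) = x (Suc (2 * j)) / \<pi> ^ (lam ! j)"
    "?B x (unit_vec (Suc (2 * j))) = - (x (2 * j) / \<pi> ^ (lam ! j))"
    "?B (unit_vec (2 * j)) x = - (x (Suc (2 * j)) / \<pi> ^ (lam ! j))"
    "?B (unit_vec (Suc (2 * j))) x = x (2 * j) / \<pi> ^ (lam ! j)" if "j < length lam" for x j
  proof -
    have sum: "(\<Sum>i<length lam. if i = j then f i else 0) = f j" for f :: "nat \<Rightarrow> 'a"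
      using that by simp
    have par: "2 * i \<noteq> Suc (2 * j)" "Suc (2 * i) \<noteq> 2 * j" for i by presburger+
    show "?B x (unit_vec (2 * j)) = x (Suc (2 * j)) / \<pi> ^ (lam ! j)"
      unfolding sum[of "\<lambda>i. x (Suc (2 * i)) / \<pi> ^ (lam ! i)", symmetric] alt_form_def
      by (rule sum.cong) (use par in \<open>auto simp: unit_vec_def\<close>)
    show "?B x (unit_vec (Suc (2 * j))) = - (x (2 * j) / \<pi> ^ (lam ! j))"
      unfolding sum[of "\<lambda>i. - (x (2 * i) / \<pi> ^ (lam ! i))", symmetric] alt_form_def
      by (rule sum.cong) (use par in \<open>auto simp: unit_vec_def\<close>)
    show "?B (unit_vec (2 * j)) x = - (x (Suc (2 * j)) / \<pi> ^ (lam ! j))"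
      unfolding sum[of "\<lambda>i. - (x (Suc (2 * i)) / \<pi> ^ (lam ! i))", symmetric] alt_form_def
      by (rule sum.cong) (use par in \<open>auto simp: unit_vec_def\<close>)
    show "?B (unit_vec (Suc (2 * j))) x = x (2 * j) / \<pi> ^ (lam ! j)"
      unfolding sum[of "\<lambda>i. x (2 * i) / \<pi> ^ (lam ! i)", symmetric] alt_form_def
      by (rule sum.cong) (use par in \<open>auto simp: unit_vec_def\<close>)
  qed
  have summand: "(x (2 * i + 1) * y (2 * i) - x (2 * i) * y (2 * i + 1)) / \<pi> ^ (lam ! i) \<in> ipow 0"
    if "x (2 * i) * y (Suc (2 * i)) \<in> ipow (lam ! i)" "x (Suc (2 * i)) * y (2 * i) \<in> ipow (lam ! i)" for x y i
    unfolding div_pi_ipow_iff using that by (simp add: ipow_diff)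
  have "perf X0 X0"
    unfolding perf_def
  proof (intro conjI osub_X0 ballI impI)
    fix x y assume x: "x \<in> Y0" and y: "y \<in> X0"
    show "?B x y \<in> ipow 0"
      unfolding alt_form_def
    proof (intro ipow_sum summand)
      fix i assume "i \<in> {..<length lam}"
      then show "x (2 * i) * y (Suc (2 * i)) \<in> ipow (lam ! i)" "x (Suc (2 * i)) * y (2 * i) \<in> ipow (lam ! i)"
        using x y unfolding X Y by (auto intro: ipow_multr)
    qed
  next
    fix x y assume x: "x \<in> X0" and y: "y \<in> Y0"
    show "?B x y \<in> ipow 0"
      unfolding alt_form_def
    proof (intro ipow_sum summand)
      fix i assume "i \<in> {..<length lam}"
      then show "x (2 * i) * y (Suc (2 * i)) \<in> ipow (lam ! i)" "x (Suc (2 * i)) * y (2 * i) \<in> ipow (lam ! i)"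
        using x y unfolding X Y by (auto intro: ipow_multl)
    qed
  next
    fix x assume "x \<in> X0" and *: "\<forall>y\<in>X0. ?B x y \<in> ipow 0"
    show "x \<in> Y0"
      unfolding Y
    proof (intro allI impI)
      fix j assume j: "j < length lam"
      have "x (Suc (2 * j)) / \<pi> ^ (lam ! j) \<in> ipow 0" "- (x (2 * j) / \<pi> ^ (lam ! j)) \<in> ipow 0"
        unfolding unit(1,2)[OF j, symmetric] using * unit_vec_X0 by blast+
      then show "x (2 * j) \<in> ipow (lam ! j) \<and> x (Suc (2 * j)) \<in> ipow (lam ! j)"
        unfolding ipow_uminus div_pi_ipow_iff by blast
    qed
  next
    fix y assume "y \<in> X0" and *: "\<forall>x\<in>X0. ?B x y \<in> ipow 0"
    show "y \<in> Y0"
      unfolding Y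
    proof (intro allI impI)
      fix j assume j: "j < length lam"
      have "- (y (Suc (2 * j)) / \<pi> ^ (lam ! j)) \<in> ipow 0" "y (2 * j) / \<pi> ^ (lam ! j) \<in> ipow 0"
        unfolding unit(3,4)[OF j, symmetric] using * unit_vec_X0 by blast+
      then show "y (2 * j) \<in> ipow (lam ! j) \<and> y (Suc (2 * j)) \<in> ipow (lam ! j)"
        unfolding ipow_uminus div_pi_ipow_iff by blast
    qed
  qed
  then show ?thesis by unfold_locales
qed

lemma (in std_lattice) card_alt_auts:
  assumes tau: "\<tau> = (\<lambda>x. x)" and L: "L = double_parts lam" and part: "is_partition lam"
  shows "real (card (alt_auts v \<pi> lam)) = real Q ^ (4 * n_part lam + 3 * sum_list lam) * b_part lam (1 / real Q ^ 2)"
proof -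
  let ?B = "alt_form \<pi> lam" and ?m = "length lam"
  interpret std_form v \<pi> \<tau> L ?B using tau L by (rule std_form_alt_form)
  have n: "n = 2 * ?m" by (simp add: L)
  have Li: "L ! (2 * i) = lam ! i" "L ! Suc (2 * i) = lam ! i" if "i < ?m" for i
    using nth_double_parts[OF that] by (simp_all add: L)
  have alt: "?B x y = - ?B y x" and alt0: "?B x x = 0" for x y
    by (simp_all add: alt_form_def sum_negf[symmetric] minus_divide_left mult.commute)
  have flip: "?B x y \<in> ipow 0 \<longleftrightarrow> ?B y x \<in> ipow 0" for x y
    using alt[of x y] by simp
  let ?S = "(X0 \<inter> reps Y0) \<times> (X0 \<inter> reps Y0)"
  let ?F = "frames symp_gram symp_orth ?S lam"
  define \<delta> where "\<delta> i j = (if i = j then 1 / \<pi> ^ (lam ! i) else 0)" for i j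
  \<comment> \<open>The four entries of a block of the Gram matrix; \<delta> occurs with opposite
    signs because the form is alternating.\<close>
  define G where "G x y i j \<longleftrightarrow> ?B (x i) (x j) \<in> ipow 0 \<and> ?B (x i) (y j) + \<delta> i j \<in> ipow 0 \<and>
      ?B (y i) (x j) - \<delta> i j \<in> ipow 0 \<and> ?B (y i) (y j) \<in> ipow 0" for x y :: "nat \<Rightarrow> nat \<Rightarrow> 'a" and i j
  have unit: "?B (unit_vec (2 * i)) (unit_vec (2 * j)) = 0" "?B (unit_vec (2 * i)) (unit_vec (Suc (2 * j))) = - \<delta> i j"
    "?B (unit_vec (Suc (2 * i))) (unit_vec (2 * j)) = \<delta> i j" "?B (unit_vec (Suc (2 * i))) (unit_vec (Suc (2 * j))) = 0"
    if "i < ?m" "j < ?m" for i j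
  proof -
    have sum: "(\<Sum>k<?m. if k = i then f k else 0) = f i" for f :: "nat \<Rightarrow> 'a"
      using that(1) by simp
    have par: "2 * i \<noteq> Suc (2 * j)" "Suc (2 * i) \<noteq> 2 * j" for i j :: nat by presburger+
    show "?B (unit_vec (2 * i)) (unit_vec (2 * j)) = 0"
      unfolding alt_form_def by (rule sum.neutral) (use par in \<open>auto simp: unit_vec_def\<close>)
    show "?B (unit_vec (Suc (2 * i))) (unit_vec (Suc (2 * j))) = 0"
      unfolding alt_form_def by (rule sum.neutral) (use par in \<open>auto simp: unit_vec_def\<close>)
    show 1: "?B (unit_vec (Suc (2 * i))) (unit_vec (2 * j)) = \<delta> i j"
      unfolding sum[of "\<lambda>k. \<delta> k j", symmetric] alt_form_def
      by (rule sum.cong) (use par in \<open>auto simp: unit_vec_def \<delta>_def\<close>)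
    have "?B (unit_vec (Suc (2 * j))) (unit_vec (2 * i)) = \<delta> i j"
      unfolding sum[of "\<lambda>k. \<delta> k j", symmetric] alt_form_def
      by (rule sum.cong) (use par in \<open>auto simp: unit_vec_def \<delta>_def\<close>)
    then show "?B (unit_vec (2 * i)) (unit_vec (Suc (2 * j))) = - \<delta> i j"
      using alt by metis
  qed
  have gram: "gram_tuple xs \<longleftrightarrow> (\<forall>i<?m. \<forall>j<?m. G (\<lambda>i. xs (2 * i)) (\<lambda>i. xs (Suc (2 * i))) i j)" for xs
    unfolding gram_tuple_def n all_less_double G_def using unit by (auto simp: all_less_double)
  have frame: "zs \<in> ?F \<longleftrightarrow> length zs = ?m \<and> (\<forall>i<?m. zs ! i \<in> ?S \<and> vscale (\<pi> ^ (lam ! i)) (fst (zs ! i)) \<in> Y0 \<and>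
      vscale (\<pi> ^ (lam ! i)) (snd (zs ! i)) \<in> Y0) \<and>
      (\<forall>i<?m. \<forall>j<?m. G (\<lambda>i. fst (zs ! i)) (\<lambda>i. snd (zs ! i)) i j)" for zs
  proof -
    let ?x = "\<lambda>i. fst (zs ! i)" and ?y = "\<lambda>i. snd (zs ! i)"
    let ?o = "\<lambda>i j. ?B (?x i) (?x j) \<in> ipow 0 \<and> ?B (?x i) (?y j) \<in> ipow 0 \<and> ?B (?y i) (?x j) \<in> ipow 0 \<and> ?B (?y i) (?y j) \<in> ipow 0"
    have G1: "G ?x ?y i j \<longleftrightarrow> ?o i j" if "i \<noteq> j" for i j
      using that by (simp add: G_def \<delta>_def)
    \<comment> \<open>On a diagonal block the alternating law leaves a single condition, the one on
      \<open>B y x\<close> in \<open>symp_gram\<close>.\<close>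
    have G2: "G ?x ?y i i \<longleftrightarrow> ?B (?y i) (?x i) - 1 / \<pi> ^ (lam ! i) \<in> ipow 0" for i
    proof -
      have "?B (?x i) (?y i) + \<delta> i i = - (?B (?y i) (?x i) - \<delta> i i)"
        using alt[of "?x i" "?y i"] by simp
      then have "?B (?x i) (?y i) + \<delta> i i \<in> ipow 0 \<longleftrightarrow> ?B (?y i) (?x i) - \<delta> i i \<in> ipow 0"
        by (simp only: ipow_uminus)
      then show ?thesis unfolding G_def by (simp add: alt0 \<delta>_def)
    qed
    have o: "?o i j \<longleftrightarrow> ?o j i" for i j using flip by blast
    have "(\<forall>i<?m. ?B (?y i) (?x i) - 1 / \<pi> ^ (lam ! i) \<in> ipow 0) \<and> (\<forall>j<?m. \<forall>i<j. ?o i j) \<longleftrightarrow>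
        (\<forall>i<?m. \<forall>j<?m. G ?x ?y i j)" (is "?l \<longleftrightarrow> ?r")
    proof
      assume l: ?l
      show ?r
      proof (intro allI impI)
        fix i j assume ij: "i < ?m" "j < ?m"
        consider "i < j" | "i = j" | "j < i" by (rule linorder_cases)
        then show "G ?x ?y i j"
        proof cases
          case 1
          then have "?o i j" using l ij by blast
          then show ?thesis using G1[of i j] 1 by blast
        next
          case 2
          have "?B (?y i) (?x i) - 1 / \<pi> ^ (lam ! i) \<in> ipow 0" using l ij by blast
          then show ?thesis unfolding 2[symmetric] G2 .
        next
          case 3
          then have "?o j i" using l ij by blast
          then have "?o i j" using o by blast
          then show ?thesis using G1[of i j] 3 by blast
        qed
      qed
    next
      assume r: ?r
      show ?l
      proof (intro conjI[of "\<forall>i<?m. _ i"] allI impI)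
        fix i assume "i < ?m"
        then have "G ?x ?y i i" using r by blast
        then show "?B (?y i) (?x i) - 1 / \<pi> ^ (lam ! i) \<in> ipow 0" unfolding G2 .
      next
        fix i j assume "j < ?m" "i < j"
        then have "i < ?m" "i \<noteq> j" by auto
        with r \<open>j < ?m\<close> have "G ?x ?y i j" by blast
        then show "?o i j" unfolding G1[OF \<open>i \<noteq> j\<close>] .
      qed
    qed
    moreover have "set zs \<subseteq> ?S \<longleftrightarrow> (\<forall>i<?m. zs ! i \<in> ?S)" if "length zs = ?m"
      unfolding subset_code(1) all_set_conv_all_nth that by blast
    ultimately show ?thesis
      unfolding frames_def symp_gram_def symp_orth_def case_prod_unfold mem_Collect_eq by blast
  qed
  let ?g = "\<lambda>zs. \<lambda>k\<in>{..<n}. if even k then fst (zs ! (k div 2)) else snd (zs ! (k div 2))"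
  let ?h = "\<lambda>xs. map (\<lambda>i. (xs (2 * i), xs (Suc (2 * i)))) [0..<?m]"
  have "bij_betw ?g ?F {xs \<in> hom_tuples. gram_tuple xs}"
  proof (rule bij_betw_byWitness[where f' = ?h])
    show "\<forall>zs\<in>?F. ?h (?g zs) = zs"
    proof
      fix zs assume "zs \<in> ?F"
      then have "length zs = ?m" unfolding frame by blast
      then show "?h (?g zs) = zs" by (intro nth_equalityI) (simp_all add: n)
    qed
    show "\<forall>xs\<in>{xs \<in> hom_tuples. gram_tuple xs}. ?g (?h xs) = xs"
    proof clarify
      fix xs assume "xs \<in> hom_tuples"
      show "?g (?h xs) = xs"
      proof (rule extensionalityI[OF restrict_extensional hom_tuplesD(4)[OF \<open>xs \<in> hom_tuples\<close>]])
        fix k assume "k \<in> {..<n}"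
        then have "k div 2 < ?m" "k < n" using n by auto
        then show "?g (?h xs) k = xs k" by (simp add: odd_pos)
      qed
    qed
    show "?g ` ?F \<subseteq> {xs \<in> hom_tuples. gram_tuple xs}"
    proof (rule image_subsetI)
      fix zs assume zs: "zs \<in> ?F"
      have "?g zs \<in> hom_tuples"
      proof (rule hom_tuplesI)
        fix k assume "k < n"
        then have k: "k div 2 < ?m" using n by auto
        have Lk: "L ! k = lam ! (k div 2)"
          using Li[OF k] by (cases "even k") (simp_all add: odd_pos)
        show "(if even k then fst (zs ! (k div 2)) else snd (zs ! (k div 2))) \<in> X0 \<inter> reps Y0"
          "vscale (\<pi> ^ (L ! k)) (if even k then fst (zs ! (k div 2)) else snd (zs ! (k div 2))) \<in> Y0"
          unfolding Lk using zs k unfolding frame by auto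
      qed
      moreover have "gram_tuple (?g zs)"
        using zs unfolding frame gram G_def by (simp add: n)
      ultimately show "?g zs \<in> {xs \<in> hom_tuples. gram_tuple xs}" by blast
    qed
    show "?h ` {xs \<in> hom_tuples. gram_tuple xs} \<subseteq> ?F"
    proof (rule image_subsetI)
      fix xs assume "xs \<in> {xs \<in> hom_tuples. gram_tuple xs}"
      then have xs: "xs \<in> hom_tuples" "gram_tuple xs" by auto
      have "2 * i < n" "Suc (2 * i) < n" if "i < ?m" for i using that n by auto
      then show "?h xs \<in> ?F"
        unfolding frame using hom_tuplesD(1-3)[OF xs(1)] Li xs(2) unfolding gram G_def by (simp, metis)
    qed
  qed
  from bij_betw_same_card[OF this] have "card ?F = card isometries"
    by (simp only: card_isometries)
  moreover have "alt_auts v \<pi> lam = isometries"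
    unfolding alt_auts_def alt_pairing_def isometries_def unfolding L length_double_parts ..
  moreover have "type_inv X0 (double_parts lam)" using type_inv_X0 by (simp add: L)
  ultimately show ?thesis
    using card_symp_frames[OF alt alt0 perf_X0 _ part] by simp
qed

lemma (in uniformized_field) field_with_trivial_involution: "field_with_involution v \<pi> (\<lambda>x. x)"
  by unfold_locales simp_all

section \<open>From powers of q to geometric sequences\<close>

lemma powr_geometric:
  fixes q :: real
  assumes "0 < q"
  shows "(1 / q) powr a = q powr (- a)"
  using assms by (simp add: powr_minus_divide powr_divide)

lemma powr_mult_power:
  fixes q :: real
  assumes "0 < q"
  shows "q powr a * (1 / q) ^ k = q powr (a - real k)"
  using assms by (simp add: powr_diff powr_realpow power_one_over)

lemma powr_power_nat:
  fixes q :: real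
  assumes "0 < q"
  shows "(q powr a) ^ k = q powr (a * real k)"
  using assms by (simp add: powr_powr flip: powr_realpow)

theorem theorem5p1:
  fixes v :: "'a::field \<Rightarrow> int" and \<pi> :: 'a and \<sigma> :: "'a \<Rightarrow> 'a"
    and q :: nat and t u :: real and lam :: "nat list"
  assumes F: "nonarch_local_field v"
    and unif: "\<pi> \<noteq> 0" "v \<pi> = 1"
    and t: "t = 1 / real q"
    and lam: "is_partition lam"
  shows
    "(q = card (carrier (residue_field v)) \<longrightarrow>
        P_meas v q u lam =
          real q powr (- u * sum_list lam) * (\<Prod>j. 1 - real q powr (- u - real (j + 1))) /
            (real q ^ (sum_list lam + 2 * n_part lam) * b_part lam (1 / real q)) \<and>
        P_meas v q u lam =
          HL_P lam t (\<lambda>i. t powr (real (i + 1) + u)) * HL_Q lam t (\<lambda>j. t ^ j) /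
            HL_Pi t (\<lambda>i. t powr (real (i + 1) + u)) (\<lambda>j. t ^ j)) \<and>
     (q = card (carrier (residue_field v)) \<longrightarrow>
        P_alt_meas v \<pi> q u lam =
          real q powr ((2 - 2 * u) * sum_list lam) *
            (\<Prod>j. 1 - real q powr (- 2 * u - 2 * real (j + 1) + 1)) /
            (real q ^ (4 * n_part lam + 3 * sum_list lam) * b_part lam (1 / real q ^ 2)) \<and>
        P_alt_meas v \<pi> q u lam =
          HL_P lam (t ^ 2) (\<lambda>i. t powr (real (2 * i + 1) + 2 * u)) * HL_Q lam (t ^ 2) (\<lambda>j. t ^ (2 * j)) /
            HL_Pi (t ^ 2) (\<lambda>i. t powr (real (2 * i + 1) + 2 * u)) (\<lambda>j. t ^ (2 * j))) \<and>
     (field_involution \<sigma> \<and> unramified_over v (fixed_field \<sigma>) \<and> \<pi> \<in> fixed_field \<sigma> \<and>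
      q ^ 2 = card (carrier (residue_field v)) \<longrightarrow>
        P_her_meas v \<sigma> \<pi> q u lam =
          real q powr (- u * sum_list lam) *
            (\<Prod>j. 1 - (-1) ^ j * real q powr (- u - real (j + 1))) /
            (real q ^ (sum_list lam + 2 * n_part lam) * b_part lam (- 1 / real q)) \<and>
        P_her_meas v \<sigma> \<pi> q u lam =
          HL_P lam (- t) (\<lambda>i. (-1) ^ i * t powr (real (i + 1) + u)) * HL_Q lam (- t) (\<lambda>j. (- t) ^ j) /
            HL_Pi (- t) (\<lambda>i. (-1) ^ i * t powr (real (i + 1) + u)) (\<lambda>j. (- t) ^ j))"
proof -
  interpret nonarch_local_field v by (rule F)
  interpret uniformized_field v \<pi> by unfold_locales (use unif in simp_all)
  let ?S = "sum_list lam" and ?N = "n_part lam"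
  have S: "real q powr (a * real ?S) = (real q powr a) ^ ?S" if "0 < q" for a
    using that by (simp add: powr_power_nat)
  show ?thesis
  proof (intro conjI impI; (elim conjE)?)
    assume "q = card (carrier (residue_field v))"
    then have q: "Q = q" by (simp add: Q_def)
    have q2: "2 \<le> q" using Q_ge_2 q by simp
    interpret std_lattice v \<pi> "\<lambda>x. x" lam
      unfolding std_lattice_def by (rule field_with_trivial_involution)
    have card: "real (card auts) = real q ^ (?S + 2 * ?N) * b_part lam (1 / real q)"
      using card_auts[OF refl lam] unfolding q .
    show eq1: "P_meas v q u lam = real q powr (- u * ?S) * (\<Prod>j. 1 - real q powr (- u - real (j + 1))) /
        (real q ^ (?S + 2 * ?N) * b_part lam (1 / real q))"
      unfolding P_meas_def card by simp
    interpret hl: hl_base t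
      by unfold_locales (use q2 in \<open>auto simp: t\<close>)
    \<comment> \<open>First term of the sequence t^(1+u), t^(2+u), ..., whose ratio is t.\<close>
    define x where "x = t powr (1 + u)"
    have x: "x = real q powr (- 1 - u)" "x \<noteq> 0"
      using q2 by (simp_all add: x_def t powr_geometric)
    have xt: "x * t ^ j = real q powr (- 1 - u - real j)" for j
      unfolding x t by (rule powr_mult_power) (use q2 in simp)
    have xs: "(\<lambda>i. t powr (real (i + 1) + u)) = (\<lambda>i. x * t ^ i)"
      unfolding xt unfolding t using q2 by (simp add: powr_geometric algebra_simps)
    have pr: "(\<lambda>j. 1 - real q powr (- u - real (j + 1))) = (\<lambda>j. 1 - x * t ^ j)"
    proof -
      have "- u - real (j + 1) = - 1 - u - real j" for j by simp
      then show ?thesis by (simp only: xt)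
    qed
    have "x ^ ?S * t ^ (2 * ?N) = real q powr (- u * ?S) / real q ^ (?S + 2 * ?N)"
    proof -
      have "x = real q powr (- u - 1)"
        unfolding x by (rule arg_cong[where f = "(powr) (real q)"]) simp
      also have "\<dots> = real q powr (- u) / real q" using q2 by (simp only: powr_diff) simp
      finally have "x = real q powr (- u) / real q" .
      then show ?thesis using q2 S[of "- u"] by (simp add: t power_divide power_add)
    qed
    then show "P_meas v q u lam = HL_P lam t (\<lambda>i. t powr (real (i + 1) + u)) * HL_Q lam t (\<lambda>j. t ^ j) /
        HL_Pi t (\<lambda>i. t powr (real (i + 1) + u)) (\<lambda>j. t ^ j)"
      unfolding eq1 xs pr hl.HL_measure_geometric[OF x(2)] by (simp add: t)
  next
    assume "q = card (carrier (residue_field v))"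
    then have q: "Q = q" by (simp add: Q_def)
    have q2: "2 \<le> q" using Q_ge_2 q by simp
    interpret std_lattice v \<pi> "\<lambda>x. x" "double_parts lam"
      unfolding std_lattice_def by (rule field_with_trivial_involution)
    have card: "real (card (alt_auts v \<pi> lam)) = real q ^ (4 * ?N + 3 * ?S) * b_part lam (1 / real q ^ 2)"
      using card_alt_auts[OF refl refl lam] unfolding q .
    have carr: "real (card (carrier (alt_module v lam))) = real q ^ (2 * ?S)"
      unfolding card_carrier_M(2) q by simp
    \<comment> \<open>The order q^(2 |\<lambda>|) of the module accounts for the shift from -2u to 2
      - 2u.\<close>
    have pow: "real q powr (- 2 * u * ?S) * real q ^ (2 * ?S) = real q powr ((2 - 2 * u) * ?S)"
    proof -
      have "real q ^ (2 * ?S) = real q powr (2 * real ?S)"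
        using q2 powr_realpow[of "real q" "2 * ?S"] by simp
      then show ?thesis by (simp add: algebra_simps flip: powr_add)
    qed
    show eq1: "P_alt_meas v \<pi> q u lam = real q powr ((2 - 2 * u) * ?S) *
        (\<Prod>j. 1 - real q powr (- 2 * u - 2 * real (j + 1) + 1)) /
        (real q ^ (4 * ?N + 3 * ?S) * b_part lam (1 / real q ^ 2))"
      unfolding P_alt_meas_def card carr pow by simp
    interpret hl: hl_base "t ^ 2"
    proof
      have "(1 / real q) ^ 2 < 1 ^ 2" using q2 by (intro power_strict_mono) auto
      then show "\<bar>t ^ 2\<bar> < 1" by (simp add: t)
    qed (use q2 in \<open>simp add: t\<close>)
    define x where "x = t powr (1 + 2 * u)"
    have x: "x = real q powr (- 1 - 2 * u)" "x \<noteq> 0"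
      using q2 by (simp_all add: x_def t powr_geometric)
    have xt: "x * (t ^ 2) ^ j = real q powr (- 1 - 2 * u - real (2 * j))" for j
      unfolding x t power_mult[symmetric] by (rule powr_mult_power) (use q2 in simp)
    have xs: "(\<lambda>i. t powr (real (2 * i + 1) + 2 * u)) = (\<lambda>i. x * (t ^ 2) ^ i)"
      unfolding xt unfolding t using q2 by (simp add: powr_geometric algebra_simps)
    have pr: "(\<lambda>j. 1 - real q powr (- 2 * u - 2 * real (j + 1) + 1)) = (\<lambda>j. 1 - x * (t ^ 2) ^ j)"
    proof -
      have "- 2 * u - 2 * real (j + 1) + 1 = - 1 - 2 * u - real (2 * j)" for j by simp
      then show ?thesis by (simp only: xt)
    qed
    have "x ^ ?S * (t ^ 2) ^ (2 * ?N) = real q powr ((2 - 2 * u) * ?S) / real q ^ (4 * ?N + 3 * ?S)"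
    proof -
      \<comment> \<open>The exponent -1 - 2u is split as (2 - 2u) - 3, the 3 matching the term 3
        |\<lambda>| in the order of the automorphism group.\<close>
      have "x = real q powr (2 - 2 * u) / real q ^ 3"
      proof -
        have "x = real q powr (2 - 2 * u - 3)"
          unfolding x by (rule arg_cong[where f = "(powr) (real q)"]) simp
        also have "\<dots> = real q powr (2 - 2 * u) / real q powr 3" by (rule powr_diff)
        finally show ?thesis using q2 powr_realpow[of "real q" 3] by simp
      qed
      then show ?thesis using q2 S[of "2 - 2 * u"]
        by (simp add: t power_divide power_add power_mult[symmetric] mult.commute)
    qed
    then show "P_alt_meas v \<pi> q u lam =
        HL_P lam (t ^ 2) (\<lambda>i. t powr (real (2 * i + 1) + 2 * u)) * HL_Q lam (t ^ 2) (\<lambda>j. t ^ (2 * j)) /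
          HL_Pi (t ^ 2) (\<lambda>i. t powr (real (2 * i + 1) + 2 * u)) (\<lambda>j. t ^ (2 * j))"
      unfolding eq1 xs pr power_mult[of t 2] hl.HL_measure_geometric[OF x(2)] by (simp add: t power_one_over)
  next
    assume \<sigma>: "field_involution \<sigma>" "\<pi> \<in> fixed_field \<sigma>" and "q ^ 2 = card (carrier (residue_field v))"
    then have q: "Q = q ^ 2" by (simp add: Q_def)
    interpret field_with_involution v \<pi> \<sigma>
      by unfold_locales (use \<sigma> in \<open>auto simp: field_involution_def fixed_field_def\<close>)
    interpret hermitian_field v \<pi> \<sigma> q
      by unfold_locales (use \<sigma> q in \<open>auto simp: field_involution_def\<close>)
    interpret std_lattice v \<pi> \<sigma> lam by unfold_locales
    have card: "real (card (her_auts v \<sigma> \<pi> lam)) = real q ^ (?S + 2 * ?N) * b_part lam (- 1 / real q)"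
      by (rule card_her_auts[OF hermitian_field_axioms lam])
    show eq1: "P_her_meas v \<sigma> \<pi> q u lam = real q powr (- u * ?S) *
        (\<Prod>j. 1 - (-1) ^ j * real q powr (- u - real (j + 1))) /
        (real q ^ (?S + 2 * ?N) * b_part lam (- 1 / real q))"
      unfolding P_her_meas_def card by simp
    note q2 = q_ge_2
    \<comment> \<open>The alternating signs of both sequences are absorbed into the ratio -t. In the
      specialized value -t occurs with the even exponent 2 n(\<lambda>), so no sign remains
      there.\<close>
    interpret hl: hl_base "- t"
      by unfold_locales (use q2 in \<open>auto simp: t\<close>)
    define x where "x = t powr (1 + u)"
    have x: "x = real q powr (- 1 - u)" "x \<noteq> 0"
      using q2 by (simp_all add: x_def t powr_geometric)
    have xt: "x * (- t) ^ j = (-1) ^ j * real q powr (- 1 - u - real j)" for j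
    proof -
      have "x * t ^ j = real q powr (- 1 - u - real j)"
        unfolding x t by (rule powr_mult_power) (use q2 in simp)
      then show ?thesis unfolding power_minus[of t] by (simp only: mult.left_commute[of x])
    qed
    have xs: "(\<lambda>i. (-1) ^ i * t powr (real (i + 1) + u)) = (\<lambda>i. x * (- t) ^ i)"
      unfolding xt unfolding t using q2 by (simp add: powr_geometric algebra_simps)
    have pr: "(\<lambda>j. 1 - (-1) ^ j * real q powr (- u - real (j + 1))) = (\<lambda>j. 1 - x * (- t) ^ j)"
    proof -
      have "- u - real (j + 1) = - 1 - u - real j" for j by simp
      then show ?thesis by (simp only: xt)
    qed
    have "x ^ ?S * (- t) ^ (2 * ?N) = real q powr (- u * ?S) / real q ^ (?S + 2 * ?N)"
    proof -
      have "x = real q powr (- u - 1)"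
        unfolding x by (rule arg_cong[where f = "(powr) (real q)"]) simp
      also have "\<dots> = real q powr (- u) / real q" using q2 by (simp only: powr_diff) simp
      finally have "x = real q powr (- u) / real q" .
      then show ?thesis using q2 S[of "- u"] by (simp add: t power_divide power_add)
    qed
    moreover have "- 1 / real q = - t" by (simp add: t)
    ultimately show "P_her_meas v \<sigma> \<pi> q u lam =
        HL_P lam (- t) (\<lambda>i. (-1) ^ i * t powr (real (i + 1) + u)) * HL_Q lam (- t) (\<lambda>j. (- t) ^ j) /
          HL_Pi (- t) (\<lambda>i. (-1) ^ i * t powr (real (i + 1) + u)) (\<lambda>j. (- t) ^ j)"
      unfolding eq1 xs pr hl.HL_measure_geometric[OF x(2)] by simp
  qed
qed

end
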